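(* For every $u\in[0,\infty]$ there exists an ergodic Lebesgue measure preserving rigid transformation $T$ whose upper measure-theoretic slow entropy with respect to the polynomial scale $a_n(t)=n^t$ satisfies $\overline{\mathrm{ent}}^{\mu}_{n^t}(T)=u$.
   Context: "Lebesgue measure preserving transformation" means an invertible transformation $T$ of $X$ preserving normalized Lebesgue measure $\mu$; the constructions can be viewed as taking place on $X=\mathbb{T}^2=\mathbb{R}^2/\mathbb{Z}^2$, the disc $\mathbb{D}$, or the annulus $\mathbb{A}=\mathbb{S}^1\times[0,1]$. Rigid: there is an increasing sequence $\{t_n\}_{n\in\mathbb{N}}$ of positive integers such that $f\circ T^{t_n}\to f$ in $L^2$ for every $f\in L^2(X,\mu)$. Slow entropy. Let $T$ be an (invertible) measure-preserving transformation of a standard Borel probability space $(X,\mathcal{B},\mu)$, $\mathcal{P}=\{P_1,\dots,P_m\}$ a finite measurable partition. The $n$-name of $x$ is $w(x)=(w_k(x))_{k=0}^{n-1}\in\{1,\dots,m\}^n$ with $T^k(x)\in P_{w_k(x)}$. For words of length $n$, $d_n^H(w,w')=\frac1n\#\{0\le k\le n-1: w_k\ne w'_k\}$ (Hamming metric). Put $B_{\mathcal{P},n}(x,T,\epsilon)=\{y\in X: d_n^H(w(x),w(y))<\epsilon\}$ and let $S_{\mathcal{P}}(T,n,\epsilon)$ be the minimal cardinality of a family of such balls whose union has $\mu$-measure greater than $1-\epsilon$. For a family $\{a_n(t)\}_{n\in\mathbb{N},t>0}$ of positive sequences increasing to infinity and monotone in $t$, let $B(\epsilon,\mathcal{P})=\{t>0:\limsup_{n\to\infty}\frac{S_{\mathcal{P}}(T,n,\epsilon)}{a_n(t)}>0\}$,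 $A(\epsilon,\mathcal{P})=\sup B(\epsilon,\mathcal{P})$ if this set is nonempty and $A(\epsilon,\mathcal{P})=0$ otherwise. The upper slow entropy is $\overline{\mathrm{ent}}_{a_n(t)}^{\mu}(T)=\sup_{\mathcal{P}}\lim_{\epsilon\to0}A(\epsilon,\mathcal{P})$, the supremum being over finite measurable partitions. *)

theory Defs
  imports "HOL-Probability.Probability"
begin

text \<open>The torus \<open>\<real>\<^sup>2/\<int>\<^sup>2\<close> and the annulus \<open>(\<real>/\<int>) \<times> [0,1]\<close> are represented by
  their standard fundamental domains; only their Borel and measure structure is used.\<close>

definition torus :: "(real \<times> real) set" where
  "torus = {0..<1} \<times> {0..<1}"

definition disc :: "(real \<times> real) set" where
  "disc = cball 0 1"

definition annulus :: "(real \<times> real) set" where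
  "annulus = {0..<1} \<times> {0..1}"

definition normalized_lebesgue :: "(real \<times> real) set \<Rightarrow> (real \<times> real) measure" where
  "normalized_lebesgue X = uniform_measure (restrict_space lborel X) X"

definition invertible_measure_preserving :: "'a measure \<Rightarrow> ('a \<Rightarrow> 'a) \<Rightarrow> bool" where
  "invertible_measure_preserving M T \<longleftrightarrow>
     bij_betw T (space M) (space M) \<and>
     T \<in> measurable M M \<and>
     the_inv_into (space M) T \<in> measurable M M \<and>
     distr M M T = M"

definition ergodic :: "'a measure \<Rightarrow> ('a \<Rightarrow> 'a) \<Rightarrow> bool" where
  "ergodic M T \<longleftrightarrow>
     (\<forall>A\<in>sets M. T -` A \<inter> space M = A \<longrightarrow> measure M A = 0 \<or> measure M A = 1)"

definition square_integrable :: "'a measure \<Rightarrow> ('a \<Rightarrow> complex) \<Rightarrow> bool" where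
  "square_integrable M f \<longleftrightarrow>
     f \<in> borel_measurable M \<and> integrable M (\<lambda>x. (cmod (f x))\<^sup>2)"

definition rigid :: "'a measure \<Rightarrow> ('a \<Rightarrow> 'a) \<Rightarrow> bool" where
  "rigid M T \<longleftrightarrow>
     (\<exists>t :: nat \<Rightarrow> nat. strict_mono t \<and> (\<forall>n. t n > 0) \<and>
        (\<forall>f. square_integrable M f \<longrightarrow>
           (\<lambda>n. \<integral>x. (cmod (f ((T ^^ t n) x) - f x))\<^sup>2 \<partial>M) \<longlonglongrightarrow> 0))"

text \<open>A partition \<open>{P\<^sub>1, \<dots>, P\<^sub>m}\<close> is an enumeration of its cells as a list, so the alphabet of the
  names is \<open>{0, \<dots>, m-1}\<close>.\<close>

definition finite_measurable_partitions :: "'a measure \<Rightarrow> 'a set list set" where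
  "finite_measurable_partitions M =
     {P. distinct P \<and> set P \<subseteq> sets M \<and> partition_on (space M) (set P)}"

definition cell_index :: "'a set list \<Rightarrow> 'a \<Rightarrow> nat" where
  "cell_index P x = (THE i. i < length P \<and> x \<in> P ! i)"

definition name :: "'a set list \<Rightarrow> ('a \<Rightarrow> 'a) \<Rightarrow> nat \<Rightarrow> 'a \<Rightarrow> nat list" where
  "name P T n x = map (\<lambda>k. cell_index P ((T ^^ k) x)) [0..<n]"

definition hamming_dist :: "nat \<Rightarrow> 'b list \<Rightarrow> 'b list \<Rightarrow> real" where
  "hamming_dist n w w' = real (card {k. k < n \<and> w ! k \<noteq> w' ! k}) / real n"

definition hamming_ball ::
    "'a measure \<Rightarrow> 'a set list \<Rightarrow> ('a \<Rightarrow> 'a) \<Rightarrow> nat \<Rightarrow> real \<Rightarrow> 'a \<Rightarrow> 'a set" where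
  "hamming_ball M P T n \<epsilon> x =
     {y \<in> space M. hamming_dist n (name P T n x) (name P T n y) < \<epsilon>}"

definition covering_number ::
    "'a measure \<Rightarrow> 'a set list \<Rightarrow> ('a \<Rightarrow> 'a) \<Rightarrow> nat \<Rightarrow> real \<Rightarrow> nat" where
  "covering_number M P T n \<epsilon> =
     (LEAST k. \<exists>F. F \<subseteq> hamming_ball M P T n \<epsilon> ` space M \<and> finite F \<and> card F = k \<and>
        measure M (\<Union>F) > 1 - \<epsilon>)"

definition growth_set ::
    "(nat \<Rightarrow> real \<Rightarrow> real) \<Rightarrow> 'a measure \<Rightarrow> 'a set list \<Rightarrow> ('a \<Rightarrow> 'a) \<Rightarrow> real \<Rightarrow> real set" where
  "growth_set a M P T \<epsilon> =
     {t. t > 0 \<and> limsup (\<lambda>n. ereal (real (covering_number M P T n \<epsilon>) / a n t)) > 0}"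

definition growth_exponent ::
    "(nat \<Rightarrow> real \<Rightarrow> real) \<Rightarrow> 'a measure \<Rightarrow> 'a set list \<Rightarrow> ('a \<Rightarrow> 'a) \<Rightarrow> real \<Rightarrow> ereal" where
  "growth_exponent a M P T \<epsilon> =
     (if growth_set a M P T \<epsilon> = {} then 0 else (SUP t\<in>growth_set a M P T \<epsilon>. ereal t))"

text \<open>The limit below exists in the extended reals, because the growth exponent does not
  decrease as \<open>\<epsilon>\<close> decreases to \<open>0\<close>.\<close>

definition upper_slow_entropy ::
    "(nat \<Rightarrow> real \<Rightarrow> real) \<Rightarrow> 'a measure \<Rightarrow> ('a \<Rightarrow> 'a) \<Rightarrow> ereal" where
  "upper_slow_entropy a M T =
     (SUP P\<in>finite_measurable_partitions M.
        Lim (at_right 0) (\<lambda>\<epsilon>. growth_exponent a M P T \<epsilon>))"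

text \<open>At \<open>n = 0\<close> this is \<open>0\<close>, which does not affect the limit superior.\<close>

definition polynomial_scale :: "nat \<Rightarrow> real \<Rightarrow> real" where
  "polynomial_scale n t = real n powr t"

end

theory Submission
  imports Defs "HOL-Real_Asymp.Real_Asymp"
begin

text \<open>The example on the torus is a skew product
  \<open>T (x, y) = (x + \<alpha>, y + \<beta> + \<phi> x)\<close> over a Liouville rotation, where
  \<open>\<phi> = (\<Sum>n. g n (x + \<alpha>) - g n x)\<close> and \<open>\<alpha> = (\<Sum>n. 1 / Q n)\<close>. The function \<open>g n\<close> is
  \<open>1 / Q n\<close>-periodic and writes a word of \<open>R n\<close> bits into each period, with bumps of height \<open>1/2\<close>
  for the ones; the rotation traverses one bit in time \<open>B n\<close>. Up to time \<open>2 ^ n * Q n\<close>, much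
  smaller than \<open>B n\<close>, the map is uniformly close to a periodic rotation conjugated by the shear
  by \<open>g 0 + \<dots> + g (n-1)\<close>. This gives rigidity, and, since the orbits of the periodic rotation
  fill a grid, ergodicity.

  If all windows of length \<open>L = O(log (R n))\<close> of the word are far apart in the Hamming metric,
  the names of length \<open>L * B n\<close> separate the \<open>R n\<close> positions in the word, so the covering number
  at that time is at least a multiple of \<open>R n\<close>. Conversely \<open>\<phi>\<close> contributes a Lipschitz
  constant of order \<open>R n * Q n\<close> only for the times between multiples of \<open>B n\<close> and of \<open>B (n+1)\<close>,
  so the covering number is there at most of order \<open>R n * Q n\<close>. With \<open>Q n\<close> negligible against
  \<open>B n\<close> and \<open>R n\<close> of the order of \<open>B n\<close> to the power \<open>u\<close> the slow entropy is \<open>u\<close>.\<close>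

section \<open>Isomorphisms of measure spaces\<close>

text \<open>The sum of the \<open>g n\<close> need not converge, since all bumps have the same
  height; only the increments \<open>g n (x + alpha) - g n x\<close> are summable. This lets every
  stage store new information: a convergent sum would conjugate the map to a rotation. The height
  1/2 is the largest displacement on a circle, so a bit can be recognised from the fibre coordinate
  alone, whatever the starting height. The fibre rotation by \<open>beta\<close>, the sum of
  \<open>1 / (2 ^ n * Q n)\<close>, is there for ergodicity: when the base of the periodic
  approximation has closed up after \<open>Q n\<close> steps, the fibre has advanced by an odd
  multiple of \<open>1 / 2 ^ n\<close>. With powers of two as denominators, odd numerators are
  coprime to them. As the upper entropy is a limit superior, the lower bound is needed only at the
  sparse times \<open>L * B n\<close>, the upper bound at all times. Disc and annulus enter only as
  measure spaces, but \<open>invertible_measure_preserving\<close> asks for a bijection at every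
  point, so boundary points cannot be dropped as a null set and have to be absorbed exactly.\<close>

definition measure_iso :: "'a measure \<Rightarrow> 'b measure \<Rightarrow> ('a \<Rightarrow> 'b) \<Rightarrow> bool" where
  "measure_iso M N h \<longleftrightarrow>
     bij_betw h (space M) (space N) \<and> h \<in> measurable M N \<and>
     the_inv_into (space M) h \<in> measurable N M \<and> distr M N h = N"

lemma measure_isoI:
  assumes h: "h \<in> measurable M N" and k: "k \<in> measurable N M"
    and kh: "\<And>x. x \<in> space M \<Longrightarrow> k (h x) = x" and hk: "\<And>y. y \<in> space N \<Longrightarrow> h (k y) = y"
    and d: "distr M N h = N"
  shows "measure_iso M N h"
proof -
  have b: "bij_betw h (space M) (space N)"
    by (rule bij_betw_byWitness[where f' = k])
       (use kh hk measurable_space[OF h] measurable_space[OF k] in auto)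
  have "the_inv_into (space M) h y = k y" if "y \<in> space N" for y
    using that b hk[OF that] measurable_space[OF k that]
    by (metis bij_betw_def the_inv_into_f_eq)
  then have "the_inv_into (space M) h \<in> measurable N M"
    using k by (subst measurable_cong[where g = k]) auto
  then show ?thesis
    using b h d by (simp add: measure_iso_def)
qed

lemma measure_isoE:
  assumes "measure_iso M N h"
  obtains k where "h \<in> measurable M N" "k \<in> measurable N M"
    "\<And>x. x \<in> space M \<Longrightarrow> k (h x) = x" "\<And>y. y \<in> space N \<Longrightarrow> h (k y) = y"
    "distr M N h = N" "distr N M k = M"
proof -
  let ?k = "the_inv_into (space M) h"
  have b: "bij_betw h (space M) (space N)" and h: "h \<in> measurable M N"
    and k: "?k \<in> measurable N M" and d: "distr M N h = N"
    using assms by (auto simp: measure_iso_def)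
  have kh: "?k (h x) = x" if "x \<in> space M" for x
    using b that by (simp add: bij_betw_def the_inv_into_f_f)
  have hk: "h (?k y) = y" if "y \<in> space N" for y
    using b that by (simp add: bij_betw_def f_the_inv_into_f)
  have "distr N M ?k = distr (distr M N h) M ?k"
    by (simp add: d)
  also have "\<dots> = distr M M (?k \<circ> h)"
    by (rule distr_distr[OF k h])
  also have "\<dots> = distr M M (\<lambda>x. x)"
    by (rule distr_cong) (auto simp: kh)
  also have "\<dots> = M"
    by (rule distr_id2) simp
  finally show thesis
    using that[of ?k] h k kh hk d by blast
qed

lemma measure_iso_comp:
  assumes "measure_iso M N h" "measure_iso N L g"
  shows "measure_iso M L (\<lambda>x. g (h x))"
proof -
  obtain k where k: "h \<in> measurable M N" "k \<in> measurable N M"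
    "\<And>x. x \<in> space M \<Longrightarrow> k (h x) = x" "\<And>y. y \<in> space N \<Longrightarrow> h (k y) = y" "distr M N h = N"
    using measure_isoE[OF assms(1)] by metis
  obtain j where j: "g \<in> measurable N L" "j \<in> measurable L N"
    "\<And>x. x \<in> space N \<Longrightarrow> j (g x) = x" "\<And>y. y \<in> space L \<Longrightarrow> g (j y) = y" "distr N L g = L"
    using measure_isoE[OF assms(2)] by metis
  have "distr M L (g \<circ> h) = distr (distr M N h) L g"
    by (rule distr_distr[OF j(1) k(1), symmetric])
  then have d: "distr M L (\<lambda>x. g (h x)) = L"
    by (simp add: k j o_def)
  show ?thesis
  proof (rule measure_isoI[where k = "\<lambda>y. k (j y)"])
    show "(\<lambda>x. g (h x)) \<in> measurable M L" "(\<lambda>y. k (j y)) \<in> measurable L M"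
      using k j by (auto intro: measurable_compose)
    show "k (j (g (h x))) = x" if "x \<in> space M" for x
      using that k j measurable_space[OF k(1)] by simp
    show "g (h (k (j y))) = y" if "y \<in> space L" for y
      using that k j measurable_space[OF j(2)] by simp
  qed (rule d)
qed

lemma measure_iso_sym:
  assumes "measure_iso M N h" and k: "k \<in> measurable N M"
    and kh: "\<And>x. x \<in> space M \<Longrightarrow> k (h x) = x"
  shows "measure_iso N M k"
proof -
  obtain j where j: "h \<in> measurable M N" "j \<in> measurable N M"
    "\<And>x. x \<in> space M \<Longrightarrow> j (h x) = x" "\<And>y. y \<in> space N \<Longrightarrow> h (j y) = y" "distr N M j = M"
    using measure_isoE[OF assms(1)] by metis
  have eq: "k y = j y" if "y \<in> space N" for y
    using that j(4)[OF that] kh[of "j y"] measurable_space[OF j(2) that] by simp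
  have "distr N M k = distr N M j"
    by (rule distr_cong) (auto simp: eq)
  then show ?thesis
    using j k kh eq by (intro measure_isoI[where k = h]) auto
qed

lemma invertible_measure_preserving_iff_iso:
  "invertible_measure_preserving M T \<longleftrightarrow> measure_iso M M T"
  by (simp add: invertible_measure_preserving_def measure_iso_def)

section \<open>Transport of dynamical invariants by conjugation\<close>

locale iso_pair =
  fixes M :: "'a measure" and N :: "'b measure" and h k
  assumes h[measurable]: "h \<in> measurable M N" and k[measurable]: "k \<in> measurable N M"
    and kh: "x \<in> space M \<Longrightarrow> k (h x) = x" and hk: "y \<in> space N \<Longrightarrow> h (k y) = y"
    and distr_h: "distr M N h = N"
begin

lemma h_space: "x \<in> space M \<Longrightarrow> h x \<in> space N"
  using measurable_space[OF h] .

lemma k_space: "x \<in> space N \<Longrightarrow> k x \<in> space M"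
  using measurable_space[OF k] .

lemma image_eq_vimage: "S \<subseteq> space M \<Longrightarrow> h ` S = k -` S \<inter> space N"
  using h_space hk kh by (auto simp: image_iff) (metis subsetD)+

lemma vimage_image: "S \<subseteq> space M \<Longrightarrow> h -` (h ` S) \<inter> space M = S"
  using kh by (auto simp: image_iff) (metis subsetD)

lemma inj_h: "inj_on h (space M)"
  using kh by (metis inj_onI)

lemma space_N_eq: "space N = h ` space M"
  using h_space k_space hk by (auto simp: image_iff) metis

lemma image_in_sets_iff: "S \<subseteq> space M \<Longrightarrow> h ` S \<in> sets N \<longleftrightarrow> S \<in> sets M"
  using image_eq_vimage vimage_image measurable_sets[OF h] measurable_sets[OF k] by metis

lemma measure_image: "S \<subseteq> space M \<Longrightarrow> measure N (h ` S) = measure M S"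
proof (cases "S \<in> sets M")
  case True
  assume S: "S \<subseteq> space M"
  have "measure N (h ` S) = measure (distr M N h) (h ` S)"
    by (simp add: distr_h)
  also have "\<dots> = measure M (h -` (h ` S) \<inter> space M)"
    using S True by (intro measure_distr) (auto simp: image_in_sets_iff)
  finally show ?thesis
    by (simp add: S vimage_image)
qed (simp add: image_in_sets_iff measure_notin_sets)

context
  fixes T :: "'a \<Rightarrow> 'a"
  assumes T: "T \<in> measurable M M"
begin

definition conj_map :: "'b \<Rightarrow> 'b" where
  "conj_map y = h (T (k y))"

lemma conj_map_measurable[measurable]: "conj_map \<in> measurable N N"
  unfolding conj_map_def using T by measurable

lemma pow_measurable[measurable]: "(T ^^ n) \<in> measurable M M"
  by (induction n) (auto intro: measurable_compose[OF _ T] simp: id_def o_def)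

lemma conj_pow: "x \<in> space M \<Longrightarrow> (conj_map ^^ n) (h x) = h ((T ^^ n) x)"
proof (induction n)
  case (Suc n)
  then have "(T ^^ n) x \<in> space M"
    using measurable_space[OF pow_measurable] by blast
  with Suc show ?case
    by (simp add: conj_map_def kh)
qed simp

lemma ergodic_conj: "ergodic M T \<Longrightarrow> ergodic N conj_map"
  unfolding ergodic_def
proof (intro ballI impI)
  fix A
  assume e: "\<forall>A\<in>sets M. T -` A \<inter> space M = A \<longrightarrow> measure M A = 0 \<or> measure M A = 1"
    and A: "A \<in> sets N" and inv: "conj_map -` A \<inter> space N = A"
  define B where "B = h -` A \<inter> space M"
  have B: "B \<in> sets M" unfolding B_def using A by simp
  have "h (T x) \<in> A \<longleftrightarrow> h x \<in> A" if "x \<in> space M" for x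
  proof -
    have "h x \<in> conj_map -` A \<inter> space N \<longleftrightarrow> h x \<in> A"
      using inv by simp
    then show ?thesis
      using that h_space[OF that] by (simp add: conj_map_def kh)
  qed
  then have "T -` B \<inter> space M = B"
    unfolding B_def using measurable_space[OF T] by auto
  moreover have "measure N A = measure M B"
    unfolding B_def using measure_distr[OF h A] by (simp add: distr_h)
  ultimately show "measure N A = 0 \<or> measure N A = 1"
    using e B by simp
qed

lemma rigid_conj: "rigid M T \<Longrightarrow> rigid N conj_map"
  unfolding rigid_def
proof (elim exE conjE)
  fix t :: "nat \<Rightarrow> nat"
  assume t: "strict_mono t" "\<forall>n. 0 < t n"
    and r: "\<forall>f. square_integrable M f \<longrightarrow>
           (\<lambda>n. \<integral>x. (cmod (f ((T ^^ t n) x) - f x))\<^sup>2 \<partial>M) \<longlonglongrightarrow> 0"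
  have "(\<lambda>n. \<integral>x. (cmod (f ((conj_map ^^ t n) x) - f x))\<^sup>2 \<partial>N) \<longlonglongrightarrow> 0"
    if f: "square_integrable N f" for f
  proof -
    have [measurable]: "f \<in> borel_measurable N" and i: "integrable N (\<lambda>x. (cmod (f x))\<^sup>2)"
      using f by (auto simp: square_integrable_def)
    have "integrable (distr M N h) (\<lambda>x. (cmod (f x))\<^sup>2)"
      using i by (simp add: distr_h)
    then have "square_integrable M (\<lambda>x. f (h x))"
      unfolding square_integrable_def by (subst (asm) integrable_distr_eq) auto
    then have l: "(\<lambda>n. \<integral>x. (cmod (f (h ((T ^^ t n) x)) - f (h x)))\<^sup>2 \<partial>M) \<longlonglongrightarrow> 0"
      using r by blast
    have "(\<integral>x. (cmod (f ((conj_map ^^ t n) x) - f x))\<^sup>2 \<partial>N) =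
        (\<integral>x. (cmod (f (h ((T ^^ t n) x)) - f (h x)))\<^sup>2 \<partial>M)" for n
    proof -
      have "(\<integral>x. (cmod (f ((conj_map ^^ t n) x) - f x))\<^sup>2 \<partial>N) =
          (\<integral>x. (cmod (f ((conj_map ^^ t n) x) - f x))\<^sup>2 \<partial>distr M N h)"
        by (simp add: distr_h)
      also have "\<dots> = (\<integral>x. (cmod (f ((conj_map ^^ t n) (h x)) - f (h x)))\<^sup>2 \<partial>M)"
        by (rule integral_distr) measurable
      also have "\<dots> = (\<integral>x. (cmod (f (h ((T ^^ t n) x)) - f (h x)))\<^sup>2 \<partial>M)"
        by (rule Bochner_Integration.integral_cong) (auto simp: conj_pow)
      finally show ?thesis .
    qed
    then show ?thesis using l by simp
  qed
  then show "\<exists>t :: nat \<Rightarrow> nat. strict_mono t \<and> (\<forall>n. t n > 0) \<and>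
        (\<forall>f. square_integrable N f \<longrightarrow>
           (\<lambda>n. \<integral>x. (cmod (f ((conj_map ^^ t n) x) - f x))\<^sup>2 \<partial>N) \<longlonglongrightarrow> 0)"
    using t by blast
qed

context
  fixes P :: "'a set list"
  assumes P: "\<And>A. A \<in> set P \<Longrightarrow> A \<subseteq> space M"
begin

text \<open>Mapping the cells in list order keeps their indices, so names agree letter by letter and
  not only up to renaming of the alphabet.\<close>

lemma name_conj: "x \<in> space M \<Longrightarrow> name (map ((`) h) P) conj_map n (h x) = name P T n x"
proof -
  have c: "cell_index (map ((`) h) P) (h x) = cell_index P x" if x: "x \<in> space M" for x
  proof -
    have "h x \<in> map ((`) h) P ! i \<longleftrightarrow> x \<in> P ! i" if "i < length P" for i
      using that x P[OF nth_mem[OF that]] inj_h by (auto simp: inj_on_image_mem_iff)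
    then show ?thesis
      unfolding cell_index_def by (metis length_map)
  qed
  assume x: "x \<in> space M"
  show ?thesis
    unfolding name_def using x measurable_space[OF pow_measurable x] by (simp add: conj_pow c)
qed

lemma hamming_ball_conj:
  assumes x: "x \<in> space M"
  shows "hamming_ball N (map ((`) h) P) conj_map n e (h x) = h ` hamming_ball M P T n e x"
  unfolding hamming_ball_def space_N_eq using x by (auto simp: name_conj)

text \<open>Injectivity of \<open>h\<close> carries over to its action on subsets of
  \<open>space M\<close>. Families of balls correspond with equal cardinality and equal measure of
  the union, so both \<open>LEAST\<close> range over the same numbers.\<close>

lemma covering_number_conj:
  "covering_number N (map ((`) h) P) conj_map n e = covering_number M P T n e"
proof -
  let ?B = "hamming_ball M P T n e"
  let ?B' = "hamming_ball N (map ((`) h) P) conj_map n e"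
  have sub: "?B x \<subseteq> space M" for x by (auto simp: hamming_ball_def)
  have B': "?B' ` space N = (`) h ` ?B ` space M"
    unfolding space_N_eq image_image by (rule image_cong[OF refl]) (simp add: hamming_ball_conj)
  have inj: "inj_on ((`) h) (Pow (space M))"
    using inj_h by (rule inj_on_image_Pow)
  have "(\<exists>F. F \<subseteq> ?B' ` space N \<and> finite F \<and> card F = c \<and> measure N (\<Union>F) > 1 - e) \<longleftrightarrow>
      (\<exists>F. F \<subseteq> ?B ` space M \<and> finite F \<and> card F = c \<and> measure M (\<Union>F) > 1 - e)"
    (is "?L \<longleftrightarrow> ?R") for c
  proof -
    have key: "finite ((`) h ` F) = finite F" "card ((`) h ` F) = card F"
      "measure N (\<Union>((`) h ` F)) = measure M (\<Union>F)" if F: "F \<subseteq> ?B ` space M" for F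
    proof -
      have F': "F \<subseteq> Pow (space M)" using F sub by auto
      then have i: "inj_on ((`) h) F" using inj inj_on_subset by blast
      then show "finite ((`) h ` F) = finite F" "card ((`) h ` F) = card F"
        by (auto simp: finite_image_iff card_image)
      have "\<Union>((`) h ` F) = h ` \<Union>F" by auto
      then show "measure N (\<Union>((`) h ` F)) = measure M (\<Union>F)"
        using F' measure_image[of "\<Union>F"] by auto
    qed
    have "?L \<longleftrightarrow> (\<exists>F. F \<subseteq> ?B ` space M \<and> finite ((`) h ` F) \<and> card ((`) h ` F) = c \<and>
        measure N (\<Union>((`) h ` F)) > 1 - e)"
      unfolding B' by (metis (no_types, lifting) subset_image_iff)
    then show ?thesis using key by (metis (no_types, lifting))
  qed
  then show ?thesis
    unfolding covering_number_def by simp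
qed

lemma growth_exponent_conj:
  "growth_exponent a N (map ((`) h) P) conj_map e = growth_exponent a M P T e"
  unfolding growth_exponent_def growth_set_def covering_number_conj ..

end

text \<open>Equality, not mere inclusion, is what makes the two suprema over partitions agree;
  preimages of cells supply the converse inclusion.\<close>

lemma partitions_conj:
  "finite_measurable_partitions N = map ((`) h) ` finite_measurable_partitions M"
proof (rule equalityI)
  show "map ((`) h) ` finite_measurable_partitions M \<subseteq> finite_measurable_partitions N"
  proof (rule image_subsetI)
    fix P assume P: "P \<in> finite_measurable_partitions M"
    then have sub: "\<And>A. A \<in> set P \<Longrightarrow> A \<subseteq> space M"
      by (auto simp: finite_measurable_partitions_def dest: sets.sets_into_space)
    have "inj_on ((`) h) (set P)"
      using inj_on_image_Pow[OF inj_h] sub by (meson PowI inj_on_subset subsetI)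
    moreover have "partition_on (space N) ((`) h ` set P)"
    proof (rule partition_onI)
      show "\<Union>((`) h ` set P) = space N"
        using P by (simp add: finite_measurable_partitions_def partition_on_def space_N_eq
          flip: image_Union)
      show "disjnt A B" if AB: "A \<in> (`) h ` set P" "B \<in> (`) h ` set P" "A \<noteq> B" for A B
      proof -
        obtain A' B' where "A' \<in> set P" "B' \<in> set P" "A = h ` A'" "B = h ` B'"
          using AB by auto
        moreover from this AB have "A' \<noteq> B'"
          by auto
        with calculation have "A' \<inter> B' = {}"
          using P by (auto simp: finite_measurable_partitions_def partition_on_def disjoint_def)
        ultimately show ?thesis
          using sub inj_on_image_Int[OF inj_h, of A' B'] by (auto simp: disjnt_def)
      qed
      show "{} \<notin> (`) h ` set P"
        using P by (auto simp: finite_measurable_partitions_def partition_on_def)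
    qed
    ultimately show "map ((`) h) P \<in> finite_measurable_partitions N"
      using P sub by (auto simp: finite_measurable_partitions_def distinct_map image_in_sets_iff)
  qed
  show "finite_measurable_partitions N \<subseteq> map ((`) h) ` finite_measurable_partitions M"
  proof
    fix P assume P: "P \<in> finite_measurable_partitions N"
    let ?k = "\<lambda>A. h -` A \<inter> space M"
    have im: "h ` ?k A = A" if "A \<in> set P" for A
    proof -
      have "A \<subseteq> space N"
        using that P by (auto simp: finite_measurable_partitions_def dest: sets.sets_into_space)
      then show ?thesis
        unfolding space_N_eq by auto
    qed
    define P' where "P' = map ?k P"
    have eq: "map ((`) h) P' = P"
      unfolding P'_def using im by (simp add: map_idI)
    have "inj_on ?k (set P)"
      using im by (metis (no_types, lifting) inj_onI)
    moreover have "partition_on (space M) (?k ` set P)"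
    proof (rule partition_onI)
      have U: "\<Union>(set P) = space N"
        using P by (auto simp: finite_measurable_partitions_def partition_on_def)
      show "\<Union>(?k ` set P) = space M"
        using h_space U by (simp add: set_eq_iff) metis
      show "disjnt A B" if AB: "A \<in> ?k ` set P" "B \<in> ?k ` set P" "A \<noteq> B" for A B
      proof -
        obtain A' B' where *: "A' \<in> set P" "B' \<in> set P" "A = ?k A'" "B = ?k B'"
          using AB by auto
        with AB have "A' \<noteq> B'"
          by auto
        with * have "A' \<inter> B' = {}"
          using P by (auto simp: finite_measurable_partitions_def partition_on_def disjoint_def)
        with * show ?thesis
          by (auto simp: disjnt_def)
      qed
      show "{} \<notin> ?k ` set P"
      proof
        assume "{} \<in> ?k ` set P"
        then obtain A where "A \<in> set P" "?k A = {}" by (metis (no_types, lifting) imageE)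
        with im[of A] have "{} \<in> set P" by auto
        with P show False
          by (auto simp: finite_measurable_partitions_def partition_on_def)
      qed
    qed
    ultimately have "P' \<in> finite_measurable_partitions M"
      using P unfolding P'_def
      by (auto simp: finite_measurable_partitions_def distinct_map)
    then show "P \<in> map ((`) h) ` finite_measurable_partitions M"
      using eq by (metis imageI)
  qed
qed

lemma upper_slow_entropy_conj: "upper_slow_entropy a N conj_map = upper_slow_entropy a M T"
proof -
  have "growth_exponent a N (map ((`) h) P) conj_map e = growth_exponent a M P T e"
    if "P \<in> finite_measurable_partitions M" for P e
    using that
    by (intro growth_exponent_conj)
       (auto simp: finite_measurable_partitions_def dest: sets.sets_into_space)
  then show ?thesis
    unfolding upper_slow_entropy_def partitions_conj image_image
    by (intro SUP_cong refl) presburger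
qed

end
end

text \<open>With this it suffices to build one example, on the torus.\<close>

lemma slow_entropy_example_transport:
  assumes iso: "measure_iso M N h"
    and T: "invertible_measure_preserving M T" "ergodic M T" "rigid M T"
      "upper_slow_entropy a M T = u"
  shows "\<exists>T'. invertible_measure_preserving N T' \<and> ergodic N T' \<and> rigid N T' \<and>
    upper_slow_entropy a N T' = u"
proof -
  obtain k where k: "h \<in> measurable M N" "k \<in> measurable N M"
    "\<And>x. x \<in> space M \<Longrightarrow> k (h x) = x" "\<And>y. y \<in> space N \<Longrightarrow> h (k y) = y" "distr M N h = N"
    using measure_isoE[OF iso] by metis
  interpret iso_pair M N h k
    by unfold_locales (use k in auto)
  have isok: "measure_iso N M k"
    by (rule measure_iso_sym[OF iso]) (auto simp: kh)
  have Tm: "T \<in> measurable M M"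
    using T(1) by (simp add: invertible_measure_preserving_def)
  have isoT: "measure_iso M M T"
    using T(1) by (simp add: invertible_measure_preserving_iff_iso)
  have "measure_iso N N (\<lambda>y. h (T (k y)))"
    by (rule measure_iso_comp[OF measure_iso_comp[OF isok isoT] iso])
  then have "measure_iso N N (conj_map T)"
    unfolding conj_map_def[OF Tm, abs_def] .
  then show ?thesis
    using ergodic_conj[OF Tm T(2)] rigid_conj[OF Tm T(3)] upper_slow_entropy_conj[OF Tm, of a] T(4)
    by (auto simp: invertible_measure_preserving_iff_iso)
qed

section \<open>Binary sequences with well separated windows\<close>

text \<open>A pair of letters counts 1 if equal and 1/16 if different; a pair not yet settled by the
  first \<open>r\<close> bits counts with the mean 17/32 of these values. The position
  \<open>j' + l\<close> decides, being the later of the two when \<open>j < j'\<close>.\<close>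

definition window_potential :: "nat \<Rightarrow> (nat \<Rightarrow> bool) \<Rightarrow> nat \<Rightarrow> nat \<times> nat \<Rightarrow> real" where
  "window_potential L w r = (\<lambda>(j, j'). \<Prod>l<L. if j' + l < r
     then (if w (j + l) = w (j' + l) then 1 else 1/16) else 17/32)"

lemma window_potential_nonneg: "0 \<le> window_potential L w r p"
  by (cases p) (auto simp: window_potential_def intro!: prod_nonneg)

text \<open>Bit \<open>r\<close> settles at most the factor with \<open>j' + l = r\<close>, and
  there the partner bit at \<open>j + l < r\<close> is already fixed: one choice gives 1, the other
  1/16. Overlapping windows therefore cause no dependence.\<close>

lemma window_potential_step:
  assumes "j < j'"
  shows "window_potential L (w(r := True)) (Suc r) (j, j') +
      window_potential L (w(r := False)) (Suc r) (j, j') = 2 * window_potential L w r (j, j')"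
proof -
  define F where "F = (\<lambda>(w :: nat \<Rightarrow> bool) r l. if j' + l < r
     then (if w (j + l) = w (j' + l) then 1 else 1/16) else (17/32 :: real))"
  have P: "window_potential L w r (j, j') = (\<Prod>l<L. F w r l)" for w r
    by (simp add: window_potential_def F_def)
  have same: "F (w(r := b)) (Suc r) l = F w r l" if "j' + l \<noteq> r" for b l
    using that assms by (auto simp: F_def)
  show ?thesis
  proof (cases "j' \<le> r \<and> r < j' + L")
    case True
    define l0 where "l0 = r - j'"
    have l0: "j' + l0 = r" "l0 < L" using True by (auto simp: l0_def)
    have "(\<Prod>l<L. G l) = G l0 * (\<Prod>l\<in>{..<L} - {l0}. G l)" for G :: "nat \<Rightarrow> real"
      using l0 by (intro prod.remove) auto
    note rem = this
    have rest: "(\<Prod>l\<in>{..<L} - {l0}. F (w(r := b)) (Suc r) l) = (\<Prod>l\<in>{..<L} - {l0}. F w r l)" for b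
    proof (rule prod.cong[OF refl])
      fix l assume "l \<in> {..<L} - {l0}"
      then show "F (w(r := b)) (Suc r) l = F w r l"
        using l0 by (intro same) auto
    qed
    have "F (w(r := True)) (Suc r) l0 + F (w(r := False)) (Suc r) l0 = 2 * F w r l0"
      using l0 assms by (auto simp: F_def)
    then show ?thesis
      unfolding P rem rest by (metis distrib_right mult.assoc)
  next
    case False
    have "(\<Prod>l<L. F (w(r := b)) (Suc r) l) = (\<Prod>l<L. F w r l)" for b
    proof (rule prod.cong[OF refl])
      fix l assume "l \<in> {..<L}"
      then show "F (w(r := b)) (Suc r) l = F w r l"
        using False by (intro same) auto
    qed
    then show ?thesis unfolding P by simp
  qed
qed

text \<open>Bits are chosen one after the other so that the potential, which is the conditional
  expectation of the final sum for uniformly random remaining bits, never increases.\<close>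

lemma ex_separated_windows:
  assumes "real R ^ 2 * (4/5) ^ L < 1"
  shows "\<exists>w :: nat \<Rightarrow> bool. \<forall>j j'. j < j' \<and> j' + L \<le> R \<longrightarrow>
      L \<le> 8 * card {l \<in> {..<L}. w (j + l) \<noteq> w (j' + l)}"
proof -
  \<comment> \<open>The condition \<open>0 < L\<close> forces \<open>j' < R\<close>, which leaves at
    most \<open>R ^ 2\<close> pairs; for \<open>L = 0\<close> the claim is trivial.\<close>
  define S where "S = {(j, j'). j < j' \<and> j' + L \<le> R \<and> 0 < L}"
  have Ssub: "S \<subseteq> {..<R} \<times> {..<R}"
    by (auto simp: S_def)
  then have finS: "finite S"
    using finite_subset by blast
  have cardS: "real (card S) \<le> real R ^ 2"
    using card_mono[OF _ Ssub] by (simp add: card_cartesian_product power2_eq_square flip: of_nat_mult)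
  have ex: "\<exists>w. (\<Sum>p\<in>S. window_potential L w r p) \<le> real (card S) * (17/32) ^ L" for r
  proof (induction r)
    case 0
    have "window_potential L w 0 p = (17/32) ^ L" for w p
      by (cases p) (simp add: window_potential_def)
    then show ?case by simp
  next
    case (Suc r)
    then obtain w where w: "(\<Sum>p\<in>S. window_potential L w r p) \<le> real (card S) * (17/32) ^ L"
      by blast
    have "(\<Sum>p\<in>S. window_potential L (w(r := True)) (Suc r) p) +
        (\<Sum>p\<in>S. window_potential L (w(r := False)) (Suc r) p) =
        (\<Sum>p\<in>S. 2 * window_potential L w r p)"
      by (subst sum.distrib[symmetric], rule sum.cong[OF refl])
        (auto simp: S_def window_potential_step)
    also have "\<dots> \<le> 2 * (real (card S) * (17/32) ^ L)"
      unfolding sum_distrib_left[symmetric] using w by linarith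
    \<comment> \<open>One of the two bits does not exceed the average.\<close>
    finally show ?case
      by (metis (no_types, lifting) add_mono_thms_linordered_field(5) linorder_not_le mult_2)
  qed
  obtain w where w: "(\<Sum>p\<in>S. window_potential L w R p) \<le> real (card S) * (17/32) ^ L"
    using ex by blast
  have "L \<le> 8 * card {l \<in> {..<L}. w (j + l) \<noteq> w (j' + l)}" if "j < j'" "j' + L \<le> R" for j j'
  proof (rule ccontr)
    define c where "c = card {l \<in> {..<L}. w (j + l) \<noteq> w (j' + l)}"
    assume "\<not> ?thesis"
    then have c: "8 * c < L" by (simp add: c_def)
    have p: "(j, j') \<in> S" using that c by (auto simp: S_def)
    have "window_potential L w R (j, j') = (\<Prod>l<L. if w (j + l) \<noteq> w (j' + l) then 1/16 else 1)"
      unfolding window_potential_def using that by (auto intro!: prod.cong)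
    also have "\<dots> = (1/16) ^ c"
      by (simp add: prod.If_cases c_def Int_def)
    finally have "(1/16) ^ c = window_potential L w R (j, j')" ..
    also have "\<dots> \<le> (\<Sum>p\<in>S. window_potential L w R p)"
      using p finS
      by (intro member_le_sum) (auto simp: window_potential_nonneg)
    also have "\<dots> \<le> real R ^ 2 * (17/32) ^ L"
      using w cardS by (meson dual_order.trans mult_right_mono zero_le_divide_iff zero_le_numeral zero_le_power)
    finally have a: "(1/16 :: real) ^ c \<le> real R ^ 2 * (17/32) ^ L" .
    \<comment> \<open>A pair with \<open>8 * c < L\<close> would contribute
      \<open>(1/16) ^ c\<close> by itself. As \<open>(85/128) ^ 8\<close> is at most 1/16, this is
      at least \<open>(85/128) ^ L\<close>. Since 17/32 is 85/128 times 4/5, a factor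
      \<open>(4/5) ^ L\<close> is left over and beats the number of pairs.\<close>
    have "(85/128 :: real) ^ L \<le> (85/128) ^ (8 * c)"
      using c by (intro power_decreasing) auto
    also have "\<dots> = ((85/128) ^ 8) ^ c"
      by (simp add: power_mult)
    also have "\<dots> \<le> (1/16) ^ c"
      by (intro power_mono) (simp_all add: power_divide)
    finally have "(85/128 :: real) ^ L \<le> real R ^ 2 * (17/32) ^ L"
      using a by simp
    moreover have "(85/128 :: real) ^ L * (4/5) ^ L = (17/32) ^ L"
      unfolding power_mult_distrib[symmetric] by simp
    ultimately have "(85/128 :: real) ^ L \<le> (real R ^ 2 * (4/5) ^ L) * (85/128) ^ L"
      by (simp add: mult_ac)
    moreover have "(real R ^ 2 * (4/5) ^ L) * (85/128) ^ L < 1 * (85/128) ^ L"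
      using assms by (intro mult_strict_right_mono) auto
    ultimately show False by simp
  qed
  then show ?thesis by blast
qed

section \<open>Covering numbers\<close>

lemma cell_index_unique:
  assumes "P \<in> finite_measurable_partitions M" "x \<in> space M"
  shows "\<exists>!i. i < length P \<and> x \<in> P ! i"
proof -
  have "x \<in> \<Union>(set P)" and d: "disjoint (set P)" "distinct P"
    using assms by (auto simp: finite_measurable_partitions_def partition_on_def)
  then obtain i where i: "i < length P" "x \<in> P ! i"
    by (metis Union_iff in_set_conv_nth)
  moreover have "j = i" if "j < length P" "x \<in> P ! j" for j
  proof (rule ccontr)
    assume "j \<noteq> i"
    then have "P ! j \<noteq> P ! i"
      using d that i by (simp add: nth_eq_iff_index_eq)
    then show False
      using d(1) that i by (metis disjointD disjoint_iff nth_mem)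
  qed
  ultimately show ?thesis by blast
qed

lemma cell_index_props:
  assumes "P \<in> finite_measurable_partitions M" "x \<in> space M"
  shows "cell_index P x < length P" "x \<in> P ! cell_index P x"
  using theI'[OF cell_index_unique[OF assms]] by (auto simp: cell_index_def)

lemma cell_index_eqI:
  assumes "P \<in> finite_measurable_partitions M" "x \<in> space M" "i < length P" "x \<in> P ! i"
  shows "cell_index P x = i"
  using cell_index_unique[OF assms(1,2)] cell_index_props[OF assms(1,2)] assms(3,4) by blast

lemma cell_index_measurable:
  assumes "P \<in> finite_measurable_partitions M"
  shows "cell_index P \<in> measurable M (count_space UNIV)"
proof (rule measurable_count_space_eq2_countable[THEN iffD2], intro conjI ballI)
  fix i
  have "cell_index P -` {i} \<inter> space M = (if i < length P then P ! i else {})"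
  proof -
    have "P ! i \<subseteq> space M" if "i < length P"
    proof -
      have "P ! i \<in> sets M"
        using assms nth_mem[OF that] unfolding finite_measurable_partitions_def by blast
      then show ?thesis by (rule sets.sets_into_space)
    qed
    then show ?thesis
      using cell_index_props[OF assms] cell_index_eqI[OF assms] by (auto simp: subset_eq)
  qed
  then show "cell_index P -` {i} \<inter> space M \<in> sets M"
    using assms by (auto simp: finite_measurable_partitions_def)
qed auto

lemma name_nth: "k < n \<Longrightarrow> name P T n x ! k = cell_index P ((T ^^ k) x)"
  by (simp add: name_def)

lemma hamming_dist_name:
  "hamming_dist n (name P T n x) (name P T n y) =
     real (card {k \<in> {..<n}. cell_index P ((T ^^ k) x) \<noteq> cell_index P ((T ^^ k) y)}) / real n"
proof -
  have "{k. k < n \<and> name P T n x ! k \<noteq> name P T n y ! k} =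
      {k \<in> {..<n}. cell_index P ((T ^^ k) x) \<noteq> cell_index P ((T ^^ k) y)}"
    by (auto simp: name_nth)
  then show ?thesis by (simp add: hamming_dist_def)
qed

lemma hamming_dist_triangle:
  "hamming_dist n u w \<le> hamming_dist n u v + hamming_dist n v w"
proof -
  have "card {k. k < n \<and> u ! k \<noteq> w ! k} \<le>
      card ({k. k < n \<and> u ! k \<noteq> v ! k} \<union> {k. k < n \<and> v ! k \<noteq> w ! k})"
    by (rule card_mono) auto
  also have "\<dots> \<le> card {k. k < n \<and> u ! k \<noteq> v ! k} + card {k. k < n \<and> v ! k \<noteq> w ! k}"
    by (rule card_Un_le)
  finally show ?thesis
    unfolding hamming_dist_def
    by (simp add: divide_right_mono flip: add_divide_distrib of_nat_add)
qed

lemma hamming_dist_commute: "hamming_dist n u v = hamming_dist n v u"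
  by (simp add: hamming_dist_def eq_commute)

locale mp_system = prob_space M for M :: "'a measure" +
  fixes T :: "'a \<Rightarrow> 'a"
  assumes T_measurable: "T \<in> measurable M M"
    and T_distr: "distr M M T = M"
begin

lemma T_pow_measurable [measurable]: "(T ^^ n) \<in> measurable M M"
  by (induction n) (auto intro: measurable_compose[OF _ T_measurable] simp: id_def o_def)

lemma T_pow_space: "x \<in> space M \<Longrightarrow> (T ^^ n) x \<in> space M"
  using measurable_space[OF T_pow_measurable] .

lemma T_pow_distr: "distr M M (T ^^ n) = M"
proof (induction n)
  case 0
  show ?case using distr_id2[of M M] by (simp add: id_def)
next
  case (Suc n)
  have "distr M M (T ^^ Suc n) = distr (distr M M (T ^^ n)) M T"
    using distr_distr[OF T_measurable T_pow_measurable] by (simp only: funpow.simps)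
  then show ?case by (simp only: Suc T_distr)
qed

lemma T_pow_vimage:
  assumes "A \<in> sets M"
  shows "measure M ((T ^^ n) -` A \<inter> space M) = measure M A"
  using measure_distr[OF T_pow_measurable assms, of n] by (simp add: T_pow_distr)

context
  fixes P assumes P: "P \<in> finite_measurable_partitions M"
begin

lemma cell_index_pow_measurable [measurable]:
  "(\<lambda>x. cell_index P ((T ^^ k) x)) \<in> measurable M (count_space UNIV)"
  using measurable_compose[OF T_pow_measurable cell_index_measurable[OF P]] .

lemma hamming_ball_sets: "hamming_ball M P T n e x \<in> sets M"
proof -
  have "(\<lambda>y. hamming_dist n (name P T n x) (name P T n y)) =
      (\<lambda>y. (\<Sum>k<n. if cell_index P ((T ^^ k) x) \<noteq> cell_index P ((T ^^ k) y) then 1 else 0) / real n)"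
    unfolding hamming_dist_name by (auto simp: sum.If_cases Int_def)
  also have "\<dots> \<in> borel_measurable M"
    by measurable
  finally show ?thesis
    unfolding hamming_ball_def by measurable
qed

text \<open>A ball depends on its centre only through the name, and there are finitely many names of
  length \<open>n\<close>.\<close>

lemma finite_balls: "finite (hamming_ball M P T n e ` space M)"
proof -
  have "name P T n ` space M \<subseteq> {xs. set xs \<subseteq> {..<length P} \<and> length xs = n}"
    using cell_index_props(1)[OF P T_pow_space] by (auto simp: name_def)
  then have "finite (name P T n ` space M)"
    using finite_lists_length_eq finite_subset by blast
  moreover have "hamming_ball M P T n e ` space M =
      (\<lambda>w. {y \<in> space M. hamming_dist n w (name P T n y) < e}) ` name P T n ` space M"
    unfolding image_image hamming_ball_def ..
  ultimately show ?thesis by simp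
qed

text \<open>Ensures that \<open>LEAST\<close> has something to choose from: the finite family of all
  balls covers the space.\<close>

lemma covering_number_attained:
  assumes "0 < e"
  shows "\<exists>F. F \<subseteq> hamming_ball M P T n e ` space M \<and> finite F \<and>
    card F = covering_number M P T n e \<and> measure M (\<Union>F) > 1 - e"
proof -
  let ?F = "hamming_ball M P T n e ` space M"
  have "\<Union>?F = space M"
    using assms by (auto simp: hamming_ball_def hamming_dist_def)
  then have "measure M (\<Union>?F) > 1 - e"
    using assms prob_space by simp
  then have "\<exists>F. F \<subseteq> ?F \<and> finite F \<and> card F = card ?F \<and> measure M (\<Union>F) > 1 - e"
    using finite_balls by blast
  then show ?thesis
    unfolding covering_number_def by (rule LeastI)
qed

lemma covering_number_leI:
  assumes "F \<subseteq> hamming_ball M P T n e ` space M" "finite F" "card F \<le> N" "measure M (\<Union>F) > 1 - e"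
  shows "covering_number M P T n e \<le> N"
proof -
  have "covering_number M P T n e \<le> card F"
    unfolding covering_number_def using assms by (intro Least_le exI[of _ F]) simp
  then show ?thesis using assms(3) by simp
qed

lemma covering_number_antimono:
  assumes "0 < e" "e \<le> e'"
  shows "covering_number M P T n e' \<le> covering_number M P T n e"
proof -
  obtain F where F: "F \<subseteq> hamming_ball M P T n e ` space M" "finite F"
    "card F = covering_number M P T n e" "measure M (\<Union>F) > 1 - e"
    using covering_number_attained[OF assms(1)] by metis
  \<comment> \<open>One centre per ball, so that enlarging the radius cannot increase the number of
    balls.\<close>
  obtain C where C: "C \<subseteq> space M" "finite C" "F = hamming_ball M P T n e ` C"
    "inj_on (hamming_ball M P T n e) C"
    using F(1,2) by (metis finite_image_iff subset_image_inj)
  let ?F = "hamming_ball M P T n e' ` C"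
  show ?thesis
  proof (rule covering_number_leI)
    show "?F \<subseteq> hamming_ball M P T n e' ` space M" "finite ?F"
      using C by auto
    show "card ?F \<le> covering_number M P T n e"
      using C card_image_le[OF C(2), of "hamming_ball M P T n e'"]
      by (simp add: F(3)[symmetric] card_image)
    have "measure M (\<Union>F) \<le> measure M (\<Union>?F)"
    proof (rule finite_measure_mono)
      show "\<Union>F \<subseteq> \<Union>?F"
        using C assms by (force simp: hamming_ball_def)
      show "\<Union>?F \<in> sets M"
        using C hamming_ball_sets by auto
    qed
    then show "measure M (\<Union>?F) > 1 - e'"
      using F assms by linarith
  qed
qed

text \<open>By the Markov inequality most points spend a proportion of time less than \<open>e/2\<close> outside
  \<open>K\<close>, and two such points in a common class lie in one Hamming ball.\<close>

lemma covering_number_upper: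
  assumes e: "0 < e" and m: "0 < m" and K: "K \<in> sets M" "measure M (space M - K) < e\<^sup>2 / 2"
    and c: "finite (c ` space M)" "card (c ` space M) \<le> N"
    and close: "\<And>z z' i. z \<in> space M \<Longrightarrow> z' \<in> space M \<Longrightarrow> c z = c z' \<Longrightarrow> i < m \<Longrightarrow>
       (T ^^ i) z \<in> K \<Longrightarrow> (T ^^ i) z' \<in> K \<Longrightarrow>
       cell_index P ((T ^^ i) z) = cell_index P ((T ^^ i) z')"
  shows "covering_number M P T m e \<le> N"
proof -
  have Kc: "space M - K \<in> sets M" using K by auto
  define f where "f z = (\<Sum>i<m. indicator (space M - K) ((T ^^ i) z) :: real)" for z
  have [measurable]: "f \<in> borel_measurable M"
    unfolding f_def using Kc by measurable
  have f_card: "f z = card {i \<in> {..<m}. (T ^^ i) z \<notin> K}" if "z \<in> space M" for z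
  proof -
    have "f z = (\<Sum>i<m. if (T ^^ i) z \<notin> K then 1 else 0)"
      unfolding f_def using that T_pow_space by (intro sum.cong) (auto simp: indicator_def)
    then show ?thesis by (simp add: sum.If_cases Int_def)
  qed
  have int1: "integrable M (\<lambda>z. indicator (space M - K) ((T ^^ i) z) :: real)" for i
    using Kc by (intro integrable_const_bound[where B = 1]) auto
  have E1: "(\<integral>z. indicator (space M - K) ((T ^^ i) z) \<partial>M) = measure M (space M - K)" for i
  proof -
    have "(\<integral>z. indicator (space M - K) ((T ^^ i) z) \<partial>M) =
        (\<integral>z. indicator ((T ^^ i) -` (space M - K) \<inter> space M) z \<partial>M)"
      by (rule Bochner_Integration.integral_cong) (auto simp: indicator_def)
    also have "\<dots> = measure M ((T ^^ i) -` (space M - K) \<inter> space M)"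
      by simp
    finally show ?thesis
      using T_pow_vimage[OF Kc] by simp
  qed
  have f_nonneg: "0 \<le> f z" for z
    unfolding f_def by (simp add: sum_nonneg)
  have int: "integrable M f"
    unfolding f_def using int1 by auto
  have Ef: "(\<integral>z. f z \<partial>M) = m * measure M (space M - K)"
    unfolding f_def using int1 E1 by (subst Bochner_Integration.integral_sum) auto
  define G where "G = {z \<in> space M. f z < e / 2 * m}"
  have G: "G \<in> sets M" unfolding G_def by measurable
  \<comment> \<open>The mean of \<open>f\<close> is below \<open>m * e\<^sup>2 / 2\<close>, so the
    threshold \<open>e / 2 * m\<close> is exceeded with probability below \<open>e\<close>; and the
    bad times of two good points add up to less than \<open>e * m\<close>.\<close>
  have "measure M {z \<in> space M. e / 2 * m \<le> f z} \<le> (\<integral>z. f z \<partial>M) / (e / 2 * m)"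
    using int e m by (intro integral_Markov_inequality_measure[where A = "{}"])
      (auto intro!: AE_I2 simp: f_nonneg)
  also have "\<dots> = measure M (space M - K) * 2 / e"
    using m e by (simp add: Ef field_simps)
  also have "\<dots> < (e\<^sup>2 / 2) * 2 / e"
    using K e by (intro divide_strict_right_mono mult_strict_right_mono) auto
  also have "\<dots> = e" using e by (simp add: power2_eq_square)
  finally have bad: "measure M {z \<in> space M. e / 2 * m \<le> f z} < e" .
  have "space M - G = {z \<in> space M. e / 2 * m \<le> f z}"
    unfolding G_def by auto
  with bad have mG: "measure M G > 1 - e"
    using prob_compl[OF G] by simp
  \<comment> \<open>Representatives are taken inside \<open>G\<close>, because the centre of a ball
    must also spend little time outside \<open>K\<close>.\<close>
  define r where "r v = (SOME z. z \<in> G \<and> c z = v)" for v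
  have r: "r (c z) \<in> G" "c (r (c z)) = c z" if "z \<in> G" for z
    unfolding r_def using someI[of "\<lambda>y. y \<in> G \<and> c y = c z" z] that by auto
  have GM: "G \<subseteq> space M" by (auto simp: G_def)
  let ?F = "(\<lambda>v. hamming_ball M P T m e (r v)) ` c ` G"
  have fin: "finite (c ` G)" "card (c ` G) \<le> N"
    using c GM by (meson finite_subset image_mono) (meson c GM card_mono image_mono order_trans)
  show ?thesis
  proof (rule covering_number_leI)
    show "?F \<subseteq> hamming_ball M P T m e ` space M"
      using r(1) GM by auto
    show "finite ?F" using fin by simp
    show "card ?F \<le> N"
      using card_image_le[OF fin(1)] fin(2) le_trans by blast
    have "G \<subseteq> \<Union>?F"
    proof
      fix z assume z: "z \<in> G"
      let ?y = "r (c z)"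
      have y: "?y \<in> G" "c ?y = c z" using r z by auto
      have "{k \<in> {..<m}. cell_index P ((T ^^ k) ?y) \<noteq> cell_index P ((T ^^ k) z)} \<subseteq>
          {i \<in> {..<m}. (T ^^ i) ?y \<notin> K} \<union> {i \<in> {..<m}. (T ^^ i) z \<notin> K}"
        using close[of ?y z] y z GM by auto
      then have "card {k \<in> {..<m}. cell_index P ((T ^^ k) ?y) \<noteq> cell_index P ((T ^^ k) z)} \<le>
          card ({i \<in> {..<m}. (T ^^ i) ?y \<notin> K} \<union> {i \<in> {..<m}. (T ^^ i) z \<notin> K})"
        by (intro card_mono) auto
      also have "\<dots> \<le> card {i \<in> {..<m}. (T ^^ i) ?y \<notin> K} + card {i \<in> {..<m}. (T ^^ i) z \<notin> K}"
        by (rule card_Un_le)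
      finally have "real (card {k \<in> {..<m}. cell_index P ((T ^^ k) ?y) \<noteq> cell_index P ((T ^^ k) z)})
          \<le> f ?y + f z"
        using f_card[of ?y] f_card[of z] y z GM by (simp add: subset_iff flip: of_nat_add)
      also have "\<dots> < e * m"
        using y z by (auto simp: G_def)
      finally have "hamming_dist m (name P T m ?y) (name P T m z) < e"
        using m by (simp add: hamming_dist_name divide_less_eq)
      then show "z \<in> \<Union>?F"
        using z GM by (auto simp: hamming_ball_def intro!: bexI[of _ z])
    qed
    moreover have "\<Union>?F \<in> sets M"
      using fin hamming_ball_sets by (intro sets.finite_Union) auto
    ultimately have "measure M G \<le> measure M (\<Union>?F)"
      by (intro finite_measure_mono)
    then show "measure M (\<Union>?F) > 1 - e"
      using mG by simp
  qed
qed

text \<open>A Hamming ball meets at most one of the sets \<open>A i j\<close> for each \<open>i\<close>.\<close>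

lemma covering_number_lower:
  fixes A :: "'i \<Rightarrow> 'j \<Rightarrow> 'a set"
  assumes e: "0 < e" and fin: "finite I" "finite J"
    and A: "\<And>i j. i \<in> I \<Longrightarrow> j \<in> J \<Longrightarrow> A i j \<in> sets M" "\<And>i j. i \<in> I \<Longrightarrow> j \<in> J \<Longrightarrow> measure M (A i j) = s"
    and disj: "disjoint_family_on (\<lambda>(i, j). A i j) (I \<times> J)"
    and large: "2 * e \<le> real (card I) * real (card J) * s"
    and sep: "\<And>i j j' z z'. i \<in> I \<Longrightarrow> j \<in> J \<Longrightarrow> j' \<in> J \<Longrightarrow> j \<noteq> j' \<Longrightarrow> z \<in> A i j \<Longrightarrow> z' \<in> A i j' \<Longrightarrow>
       2 * e \<le> hamming_dist n (name P T n z) (name P T n z')"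
  shows "real (card J) \<le> 2 * real (covering_number M P T n e)"
proof -
  obtain F where F: "F \<subseteq> hamming_ball M P T n e ` space M" "finite F"
    "card F = covering_number M P T n e" "measure M (\<Union>F) > 1 - e"
    using covering_number_attained[OF e] by metis
  define E where "E = (\<Union>(i, j)\<in>I \<times> J. A i j)"
  have E: "E \<in> sets M" unfolding E_def using fin A by auto
  have mE: "measure M E = real (card I) * real (card J) * s"
    unfolding E_def using fin A disj
  proof (subst finite_measure_finite_Union)
    have "(\<Sum>p\<in>I \<times> J. measure M (case p of (i, j) \<Rightarrow> A i j)) = (\<Sum>p\<in>I \<times> J. s)"
      using A by (intro sum.cong) auto
    then show "(\<Sum>p\<in>I \<times> J. measure M (case p of (i, j) \<Rightarrow> A i j)) =
        real (card I) * real (card J) * s"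
      by (simp add: card_cartesian_product)
  qed (use fin A disj in auto)
  have I0: "card I \<noteq> 0" and J0: "card J \<noteq> 0" and s_nz: "s \<noteq> 0"
  proof -
    have "real (card I) * real (card J) * s \<noteq> 0"
      using e large by linarith
    then show "card I \<noteq> 0" "card J \<noteq> 0" "s \<noteq> 0"
      by (metis mult_zero_left mult_zero_right of_nat_0)+
  qed
  then obtain i0 j0 where "i0 \<in> I" "j0 \<in> J"
    by (metis card.empty ex_in_conv)
  then have "0 \<le> s"
    using A(2) measure_nonneg by metis
  then have s0: "0 < real (card I) * s"
    using I0 s_nz by simp
  have U: "\<Union>F \<in> sets M"
    using F(1,2) hamming_ball_sets by (intro sets.finite_Union) auto
  have ball: "measure M (E \<inter> B) \<le> real (card I) * s" if B: "B \<in> F" for B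
  proof -
    obtain x where x: "B = hamming_ball M P T n e x"
      using B F(1) by blast
    have Bs: "B \<in> sets M" using x hamming_ball_sets by simp
    have "\<exists>j\<in>J. (\<Union>j'\<in>J. A i j') \<inter> B \<subseteq> A i j" if i: "i \<in> I" for i
    proof (cases "(\<Union>j'\<in>J. A i j') \<inter> B = {}")
      case True
      then show ?thesis using \<open>j0 \<in> J\<close> by auto
    next
      case False
      then obtain j z where j: "j \<in> J" "z \<in> A i j" "z \<in> B" by auto
      have "j' = j" if j': "j' \<in> J" "z' \<in> A i j'" "z' \<in> B" for j' z'
      proof (rule ccontr)
        assume "j' \<noteq> j"
        then have "2 * e \<le> hamming_dist n (name P T n z') (name P T n z)"
          using sep i j j' by blast
        also have "\<dots> \<le> hamming_dist n (name P T n x) (name P T n z') +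
            hamming_dist n (name P T n x) (name P T n z)"
          using hamming_dist_triangle hamming_dist_commute by metis
        also have "\<dots> < 2 * e"
          using j j' by (auto simp: x hamming_ball_def)
        finally show False by simp
      qed
      then show ?thesis using j by blast
    qed
    then obtain j where j: "\<And>i. i \<in> I \<Longrightarrow> j i \<in> J" "\<And>i. i \<in> I \<Longrightarrow> (\<Union>j'\<in>J. A i j') \<inter> B \<subseteq> A i (j i)"
      by metis
    have "measure M (E \<inter> B) \<le> measure M (\<Union>i\<in>I. A i (j i))"
    proof (rule finite_measure_mono)
      show "E \<inter> B \<subseteq> (\<Union>i\<in>I. A i (j i))"
        using j(2) unfolding E_def by fast
      show "(\<Union>i\<in>I. A i (j i)) \<in> sets M"
        using j(1) fin A(1) by (intro sets.finite_UN) auto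
    qed
    also have "\<dots> \<le> (\<Sum>i\<in>I. measure M (A i (j i)))"
      using j fin A by (intro finite_measure_subadditive_finite) auto
    also have "\<dots> = real (card I) * s"
      using j A by simp
    finally show ?thesis .
  qed
  have "measure M E - e \<le> measure M (E \<inter> \<Union>F)"
  proof -
    have "measure M (E - \<Union>F) \<le> measure M (space M - \<Union>F)"
      using E U sets.sets_into_space[OF E] by (intro finite_measure_mono) auto
    also have "\<dots> < e"
      using F(4) prob_compl[OF U] by simp
    finally have "measure M (E - \<Union>F) < e" .
    moreover have "measure M E = measure M (E \<inter> \<Union>F) + measure M (E - \<Union>F)"
      using E U finite_measure_Diff'[of E "\<Union>F"] by simp
    ultimately show ?thesis by simp
  qed
  also have "\<dots> = measure M (\<Union>B\<in>F. E \<inter> B)"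
    by (simp add: Int_UN_distrib flip: Int_Union)
  also have "\<dots> \<le> (\<Sum>B\<in>F. measure M (E \<inter> B))"
    using F(1,2) E hamming_ball_sets
    by (intro finite_measure_subadditive_finite) auto
  also have "\<dots> \<le> (\<Sum>B\<in>F. real (card I) * s)"
    by (rule sum_mono) (rule ball)
  also have "\<dots> = real (card F) * (real (card I) * s)" by simp
  finally have "measure M E - e \<le> real (card F) * (real (card I) * s)" .
  \<comment> \<open>By \<open>large\<close>, \<open>e\<close> is at most half the measure of
    \<open>E\<close>. So at least half of \<open>E\<close> is covered, while one ball catches at
    most the fraction \<open>1 / card J\<close> of it; this half is the factor 2.\<close>
  then have "real (card J) * (real (card I) * s) \<le> 2 * real (card F) * (real (card I) * s)"
    using mE large by (simp add: algebra_simps)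
  then have "real (card J) \<le> 2 * real (card F)"
    using s0 mult_le_cancel_right_pos by blast
  then show ?thesis by (simp add: F(3))
qed

end

section \<open>From covering numbers to entropy\<close>

lemma growth_exponent_nonneg: "0 \<le> growth_exponent a M P T e"
proof (cases "growth_set a M P T e = {}")
  case False
  then obtain t where t: "t \<in> growth_set a M P T e" by blast
  then have "0 \<le> ereal t" by (simp add: growth_set_def)
  also have "\<dots> \<le> (SUP t\<in>growth_set a M P T e. ereal t)"
    using t by (rule SUP_upper)
  finally show ?thesis by (simp add: growth_exponent_def False)
qed (simp add: growth_exponent_def)

lemma growth_exponent_antimono:
  assumes P: "P \<in> finite_measurable_partitions M" and e: "0 < e" "e \<le> e'"
    and a: "\<And>n t. 0 \<le> a n t"
  shows "growth_exponent a M P T e' \<le> growth_exponent a M P T e"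
proof (cases "growth_set a M P T e' = {}")
  case True
  then show ?thesis
    using growth_exponent_nonneg by (simp add: growth_exponent_def[of a M P T e'])
next
  case False
  have "limsup (\<lambda>n. ereal (real (covering_number M P T n e') / a n t)) \<le>
      limsup (\<lambda>n. ereal (real (covering_number M P T n e) / a n t))" for t
    using covering_number_antimono[OF P e] a
    by (intro Limsup_mono always_eventually allI) (simp add: divide_right_mono)
  then have sub: "growth_set a M P T e' \<subseteq> growth_set a M P T e"
    unfolding growth_set_def by (auto intro: less_le_trans)
  moreover from this have "growth_set a M P T e \<noteq> {}"
    using False by blast
  ultimately show ?thesis
    using False by (simp add: growth_exponent_def SUP_subset_mono)
qed

end

text \<open>\<open>Lim\<close> is a definite description, meaningful only once convergence is known;
  for a monotone function into the extended reals the limit exists and is the supremum.\<close>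

lemma tendsto_at_right_antimono:
  fixes f :: "real \<Rightarrow> ereal"
  assumes "\<And>x y. 0 < x \<Longrightarrow> x \<le> y \<Longrightarrow> f y \<le> f x"
  shows "(f \<longlongrightarrow> (SUP x\<in>{0<..}. f x)) (at_right 0)"
proof (rule order_tendstoI)
  fix a assume "a < (SUP x\<in>{0<..}. f x)"
  then obtain x where x: "0 < x" "a < f x"
    unfolding less_SUP_iff by auto
  then show "\<forall>\<^sub>F y in at_right 0. a < f y"
    unfolding eventually_at_right_field
    by (intro exI[of _ x]) (auto intro: less_le_trans[OF _ assms])
next
  fix a assume a: "(SUP x\<in>{0<..}. f x) < a"
  have "f y < a" if "0 < y" for y
    using that a SUP_upper[of y "{0<..}" f] by auto
  then show "\<forall>\<^sub>F y in at_right 0. f y < a"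
    unfolding eventually_at_right_field by (intro exI[of _ 1]) auto
qed

text \<open>Only exponents strictly on either side of \<open>u\<close> are tested, so the borderline
  exponent never has to be decided. For the lower bound one partition and small \<open>e\<close> are
  enough, because the exponent grows as \<open>e\<close> shrinks.\<close>

lemma (in mp_system) upper_slow_entropy_eqI:
  assumes u: "0 \<le> u" and a: "\<And>n t. 0 \<le> a n t"
    and upper: "\<And>P e t. P \<in> finite_measurable_partitions M \<Longrightarrow> 0 < e \<Longrightarrow> 0 < t \<Longrightarrow> u < ereal t \<Longrightarrow>
      limsup (\<lambda>n. ereal (real (covering_number M P T n e) / a n t)) \<le> 0"
    and P0: "P0 \<in> finite_measurable_partitions M" and e0: "0 < e0"
    and lower: "\<And>e t. 0 < e \<Longrightarrow> e < e0 \<Longrightarrow> 0 < t \<Longrightarrow> ereal t < u \<Longrightarrow>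
      0 < limsup (\<lambda>n. ereal (real (covering_number M P0 T n e) / a n t))"
  shows "upper_slow_entropy a M T = u"
proof -
  have le: "growth_exponent a M P T e \<le> u" if P: "P \<in> finite_measurable_partitions M" "0 < e" for P e
  proof -
    have "ereal t \<le> u" if "t \<in> growth_set a M P T e" for t
      using that upper[OF P, of t] by (force simp: growth_set_def)
    then show ?thesis
      using u by (auto simp: growth_exponent_def intro!: SUP_least)
  qed
  have ge: "u \<le> growth_exponent a M P0 T e" if e: "0 < e" "e < e0" for e
  proof (rule dense_le)
    fix z assume z: "z < u"
    show "z \<le> growth_exponent a M P0 T e"
    \<comment> \<open>\<open>growth_set\<close> holds positive exponents only, so negative
      \<open>z\<close> are left to nonnegativity.\<close>
    proof (cases "z < 0")
      case True
      then show ?thesis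
        using growth_exponent_nonneg[of a P0 e] by simp
    next
      case False
      from z obtain t where t: "z < ereal t" "ereal t < u"
        using ereal_dense2 by blast
      have "0 < ereal t" using t False by (meson le_less_trans not_le)
      then have "0 < t" by simp
      then have tg: "t \<in> growth_set a M P0 T e"
        using lower[OF e _ t(2)] by (simp add: growth_set_def)
      then have "ereal t \<le> growth_exponent a M P0 T e"
        by (auto simp: growth_exponent_def intro: SUP_upper)
      then show ?thesis using t by simp
    qed
  qed
  have L: "Lim (at_right 0) (\<lambda>e. growth_exponent a M P T e) =
      (SUP e\<in>{0<..}. growth_exponent a M P T e)"
    if P: "P \<in> finite_measurable_partitions M" for P
    by (intro tendsto_Lim tendsto_at_right_antimono growth_exponent_antimono[OF P] a)
      (auto simp: trivial_limit_at_right_real)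
  have Lle: "Lim (at_right 0) (\<lambda>e. growth_exponent a M P T e) \<le> u"
    if P: "P \<in> finite_measurable_partitions M" for P
    unfolding L[OF P] by (auto intro!: SUP_least le[OF P])
  have "u \<le> growth_exponent a M P0 T (e0 / 2)"
    using e0 by (intro ge) auto
  also have "\<dots> \<le> Lim (at_right 0) (\<lambda>e. growth_exponent a M P0 T e)"
    unfolding L[OF P0] using e0 by (intro SUP_upper) auto
  finally have "u \<le> upper_slow_entropy a M T"
    unfolding upper_slow_entropy_def by (meson P0 SUP_upper2)
  moreover have "upper_slow_entropy a M T \<le> u"
    unfolding upper_slow_entropy_def by (rule SUP_least) (rule Lle)
  ultimately show ?thesis by simp
qed

section \<open>The torus\<close>

text \<open>Distance at most \<open>d\<close> in the circle, stated for arbitrary real lifts, so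
  that estimates can be made in the reals and \<open>frac\<close> disappears.\<close>

definition circle_near :: "real \<Rightarrow> real \<Rightarrow> real \<Rightarrow> bool" where
  "circle_near d a b \<longleftrightarrow> (\<exists>k::int. \<bar>a - b - of_int k\<bar> \<le> d)"

lemma circle_nearI: "\<bar>a - b - of_int k\<bar> \<le> d \<Longrightarrow> circle_near d a b"
  unfolding circle_near_def by blast

lemma circle_near_abs: "\<bar>a - b\<bar> \<le> d \<Longrightarrow> circle_near d a b"
  by (rule circle_nearI[of _ _ 0]) simp

lemma circle_near_mono: "circle_near d a b \<Longrightarrow> d \<le> e \<Longrightarrow> circle_near e a b"
  unfolding circle_near_def by (meson order_trans)

lemma circle_near_sym: "circle_near d a b \<Longrightarrow> circle_near d b a"
  unfolding circle_near_def by (metis abs_minus_commute diff_diff_add diff_diff_eq2 minus_diff_eq of_int_minus uminus_add_conv_diff diff_minus_eq_add)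

lemma circle_near_trans:
  assumes "circle_near d a b" "circle_near e b c"
  shows "circle_near (d + e) a c"
proof -
  obtain k l :: int where "\<bar>a - b - k\<bar> \<le> d" "\<bar>b - c - l\<bar> \<le> e"
    using assms by (auto simp: circle_near_def)
  then have "\<bar>a - c - of_int (k + l)\<bar> \<le> d + e"
    by (simp add: abs_le_iff)
  then show ?thesis by (rule circle_nearI)
qed

lemma circle_near_frac_left [simp]: "circle_near d (frac a) b \<longleftrightarrow> circle_near d a b"
proof
  assume "circle_near d (frac a) b"
  then obtain k :: int where "\<bar>frac a - b - k\<bar> \<le> d" by (auto simp: circle_near_def)
  then have "\<bar>a - b - of_int (\<lfloor>a\<rfloor> + k)\<bar> \<le> d" by (simp add: frac_def algebra_simps)
  then show "circle_near d a b" by (rule circle_nearI)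
next
  assume "circle_near d a b"
  then obtain k :: int where "\<bar>a - b - k\<bar> \<le> d" by (auto simp: circle_near_def)
  then have "\<bar>frac a - b - of_int (k - \<lfloor>a\<rfloor>)\<bar> \<le> d" by (simp add: frac_def algebra_simps)
  then show "circle_near d (frac a) b" by (rule circle_nearI)
qed

lemma circle_near_frac_right [simp]: "circle_near d a (frac b) \<longleftrightarrow> circle_near d a b"
  using circle_near_frac_left circle_near_sym by metis

text \<open>The fundamental domain is not compact and its Euclidean metric is not that of the
  quotient. The distance after embedding respects the identification of opposite sides, and compact
  sets keep compact images.\<close>

definition torus_emb :: "real \<times> real \<Rightarrow> complex \<times> complex" where
  "torus_emb z = (cis (2 * pi * fst z), cis (2 * pi * snd z))"

lemma cis_near:
  assumes "circle_near d a b"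
  shows "cmod (cis (2 * pi * a) - cis (2 * pi * b)) \<le> 2 * pi * d"
proof -
  obtain k :: int where k: "\<bar>a - b - k\<bar> \<le> d"
    using assms by (auto simp: circle_near_def)
  define t where "t = 2 * pi * (a - b - k)"
  have "cis (2 * pi * a) = cis (2 * pi * b) * cis t * cis (2 * pi * k)"
    by (simp add: cis_mult t_def algebra_simps)
  also have "cis (2 * pi * k) = 1"
    by (rule cis_multiple_2pi) simp
  finally have "cis (2 * pi * a) - cis (2 * pi * b) = cis (2 * pi * b) * (cis t - 1)"
    by (simp add: algebra_simps)
  then have "cmod (cis (2 * pi * a) - cis (2 * pi * b)) = cmod (exp (\<i> * of_real t) - 1)"
    by (simp add: norm_mult cis_conv_exp)
  also have "\<dots> = 2 * \<bar>sin (t / 2)\<bar>"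
    by (rule dist_exp_i_1)
  also have "\<dots> \<le> \<bar>t\<bar>"
    using abs_sin_x_le_abs_x[of "t / 2"] by simp
  also have "\<dots> \<le> 2 * pi * d"
    using k by (simp add: t_def abs_mult)
  finally show ?thesis .
qed

lemma torus_emb_near:
  assumes "circle_near d (fst z) (fst z')" "circle_near d (snd z) (snd z')"
  shows "dist (torus_emb z) (torus_emb z') \<le> 4 * pi * d"
proof -
  have "dist (torus_emb z) (torus_emb z') \<le>
      dist (fst (torus_emb z)) (fst (torus_emb z')) + dist (snd (torus_emb z)) (snd (torus_emb z'))"
    unfolding dist_prod_def by (rule sqrt_sum_squares_le_sum) auto
  also have "\<dots> \<le> 2 * pi * d + 2 * pi * d"
    using cis_near[OF assms(1)] cis_near[OF assms(2)]
    by (intro add_mono) (auto simp: torus_emb_def dist_norm)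
  finally show ?thesis by simp
qed

lemma continuous_torus_emb: "continuous_on S torus_emb"
  unfolding torus_emb_def by (intro continuous_intros)

lemma inj_on_torus_emb: "inj_on torus_emb torus"
proof (rule inj_onI)
  have *: "a = b" if "cis (2 * pi * a) = cis (2 * pi * b)" "0 \<le> a" "a < 1" "0 \<le> b" "b < 1" for a b
  proof -
    have "exp (\<i> * complex_of_real (2 * pi * a)) = exp (\<i> * complex_of_real (2 * pi * b))"
      using that(1) by (simp add: cis_conv_exp)
    then obtain n :: int where "\<i> * complex_of_real (2 * pi * a) =
        \<i> * complex_of_real (2 * pi * b) + complex_of_real (of_int (2 * n) * pi) * \<i>"
      unfolding exp_eq by auto
    then have n: "2 * pi * a = 2 * pi * b + 2 * of_int n * pi"
      by (drule_tac arg_cong[where f = Im]) simp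
    then have "2 * pi * (a - b - of_int n) = 0" by (simp add: algebra_simps)
    then have ab: "a - b = of_int n" by simp
    then have "\<bar>real_of_int n\<bar> < 1" using that by linarith
    then have "n = 0" by linarith
    with ab show ?thesis by simp
  qed
  fix z z' assume "z \<in> torus" "z' \<in> torus" "torus_emb z = torus_emb z'"
  then show "z = z'"
    using *[of "fst z" "fst z'"] *[of "snd z" "snd z'"]
    by (auto simp: torus_def torus_emb_def prod_eq_iff)
qed

lemma space_normalized_lebesgue [simp]: "space (normalized_lebesgue X) = X"
  by (simp add: normalized_lebesgue_def space_restrict_space)

lemma sets_normalized_lebesgue:
  "X \<in> sets borel \<Longrightarrow> A \<in> sets (normalized_lebesgue X) \<longleftrightarrow> A \<in> sets borel \<and> A \<subseteq> X"
  by (auto simp: normalized_lebesgue_def sets_restrict_space_iff)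

lemma emeasure_normalized_lebesgue:
  assumes X: "X \<in> sets borel" and A: "A \<in> sets (normalized_lebesgue X)"
  shows "emeasure (normalized_lebesgue X) A = emeasure lborel A / emeasure lborel X"
proof -
  have AX: "A \<in> sets borel" "A \<subseteq> X" using A sets_normalized_lebesgue[OF X] by auto
  then show ?thesis
    unfolding normalized_lebesgue_def using X
    by (subst emeasure_uniform_measure)
      (auto simp: sets_restrict_space_iff emeasure_restrict_space Int_absorb1)
qed

lemma torus_borel [measurable]: "torus \<in> sets borel"
  unfolding torus_def by (intro borel_Times) auto

lemma emeasure_lborel_Times:
  fixes A B :: "real set"
  assumes "A \<in> sets borel" "B \<in> sets borel"
  shows "emeasure lborel (A \<times> B) = emeasure lborel A * emeasure lborel B"
  using assms by (simp add: lborel.emeasure_pair_measure_Times flip: lborel_prod)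

lemma emeasure_torus [simp]: "emeasure lborel torus = 1"
  unfolding torus_def by (simp add: emeasure_lborel_Times)

abbreviation torus_measure :: "(real \<times> real) measure" where
  "torus_measure \<equiv> normalized_lebesgue torus"

lemma sets_torus_measure: "A \<in> sets torus_measure \<longleftrightarrow> A \<in> sets borel \<and> A \<subseteq> torus"
  by (rule sets_normalized_lebesgue[OF torus_borel])

lemma emeasure_torus_measure:
  "A \<in> sets torus_measure \<Longrightarrow> emeasure torus_measure A = emeasure lborel A"
  by (simp add: emeasure_normalized_lebesgue divide_ennreal_def)

lemma prob_space_torus_measure: "prob_space torus_measure"
  by (rule prob_spaceI) (simp add: emeasure_torus_measure sets_torus_measure)

lemma torus_inner_compact:
  assumes A: "A \<in> sets torus_measure" and e: "0 < e"
  shows "\<exists>C\<subseteq>A. compact C \<and> C \<in> sets torus_measure \<and> measure torus_measure (A - C) < e"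
proof -
  interpret prob_space torus_measure by (rule prob_space_torus_measure)
  have Ab: "A \<in> sets borel" "A \<subseteq> torus" using A by (auto simp: sets_torus_measure)
  \<comment> \<open>\<open>inner_regular\<close> asks for all Borel sets of the plane, so the
    measure is extended by zero outside the torus.\<close>
  define N where "N = uniform_measure lborel torus"
  have N: "emeasure N B = emeasure torus_measure B" if "B \<in> sets torus_measure" for B
    unfolding N_def using that
    by (subst emeasure_uniform_measure)
      (auto simp: emeasure_torus_measure sets_torus_measure Int_absorb1 divide_ennreal_def)
  have sN: "sets N = sets borel" by (simp add: N_def)
  have fin: "emeasure N (space N) \<noteq> \<infinity>"
    by (simp add: N_def emeasure_uniform_measure divide_ennreal_def)
  have "emeasure N A = (SUP K \<in> {K. K \<subseteq> A \<and> compact K}. emeasure N K)"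
    by (rule inner_regular[OF sN fin Ab(1)])
  note sup = this
  have "\<exists>C. C \<subseteq> A \<and> compact C \<and> emeasure N A < emeasure N C + ennreal e"
  proof (cases "emeasure N A = 0")
    case True
    then show ?thesis using e by (intro exI[of _ "{}"]) simp
  next
    case False
    define s where "s = measure torus_measure A"
    have s: "emeasure N A = ennreal s" "0 < s"
      using False by (auto simp: N[OF A] emeasure_eq_measure s_def zero_less_measure_iff)
    \<comment> \<open>Capping the gap by \<open>s\<close> keeps the argument of
      \<open>ennreal\<close> positive, so nothing is truncated.\<close>
    have "ennreal (s - min e s / 2) < (SUP K \<in> {K. K \<subseteq> A \<and> compact K}. emeasure N K)"
      unfolding sup[symmetric] using s e by (auto simp: ennreal_less_iff min_def)
    then obtain C where C: "C \<subseteq> A" "compact C" "ennreal (s - min e s / 2) < emeasure N C"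
      by (auto simp: less_SUP_iff)
    have CM: "C \<in> sets torus_measure"
      using C Ab by (auto simp: sets_torus_measure intro: borel_compact)
    have "ennreal (s - min e s / 2) < ennreal (measure torus_measure C)"
      using C N[OF CM] by (simp add: emeasure_eq_measure)
    then have "s - min e s / 2 < measure torus_measure C"
      using s e by (subst (asm) ennreal_less_iff) (auto simp: min_def)
    then have "s < measure torus_measure C + e"
      using s e by (auto simp: min_def split: if_splits)
    then have "emeasure N A < emeasure N C + ennreal e"
      using s e by (simp add: N[OF CM] emeasure_eq_measure ennreal_less_iff flip: ennreal_plus)
    then show ?thesis using C by blast
  qed
  then obtain C where C: "C \<subseteq> A" "compact C" "emeasure N A < emeasure N C + ennreal e"
    by blast
  have CM: "C \<in> sets torus_measure"
    using C Ab by (auto simp: sets_torus_measure intro: borel_compact)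
  have "measure torus_measure A < measure torus_measure C + e"
    using C(3) e by (simp add: N[OF CM] N[OF A] emeasure_eq_measure ennreal_less_iff flip: ennreal_plus)
  then have "measure torus_measure (A - C) < e"
    using finite_measure_Diff[OF A CM C(1)] by simp
  then show ?thesis using C CM by blast
qed

text \<open>Disjoint compact sets stay compact and disjoint under the injective continuous
  embedding, hence have positive distance; a finite family has a smallest one.\<close>

lemma compact_family_separated:
  fixes C :: "'i \<Rightarrow> (real \<times> real) set"
  assumes "finite I" and C: "\<And>i. i \<in> I \<Longrightarrow> compact (C i)" "\<And>i. i \<in> I \<Longrightarrow> C i \<subseteq> torus"
    and disj: "\<And>i j. i \<in> I \<Longrightarrow> j \<in> I \<Longrightarrow> i \<noteq> j \<Longrightarrow> C i \<inter> C j = {}"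
  shows "\<exists>d>0. \<forall>i\<in>I. \<forall>j\<in>I. \<forall>x\<in>C i. \<forall>y\<in>C j. i \<noteq> j \<longrightarrow> d \<le> dist (torus_emb x) (torus_emb y)"
proof -
  have sep: "\<exists>d>0. \<forall>x\<in>torus_emb ` C i. \<forall>y\<in>torus_emb ` C j. d \<le> dist x y"
    if ij: "i \<in> I" "j \<in> I" "i \<noteq> j" for i j
  proof (rule separate_compact_closed)
    show "compact (torus_emb ` C i)" "closed (torus_emb ` C j)"
      using C ij by (auto intro!: compact_continuous_image compact_imp_closed continuous_torus_emb)
    show "torus_emb ` C i \<inter> torus_emb ` C j = {}"
      using C ij disj[OF ij] inj_on_torus_emb by (auto simp: inj_on_def) blast
  qed
  define d where "d i j = (SOME d. 0 < d \<and>
      (\<forall>x\<in>torus_emb ` C i. \<forall>y\<in>torus_emb ` C j. d \<le> dist x y))" for i j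
  have d: "0 < d i j" "\<And>x y. x \<in> C i \<Longrightarrow> y \<in> C j \<Longrightarrow> d i j \<le> dist (torus_emb x) (torus_emb y)"
    if "i \<in> I" "j \<in> I" "i \<noteq> j" for i j
    using someI_ex[OF sep[OF that]] unfolding d_def by blast+
  \<comment> \<open>The 1 keeps \<open>Min\<close> meaningful when there is no pair of distinct
    indices.\<close>
  define D where "D = insert 1 ((\<lambda>(i, j). d i j) ` (I \<times> I - Id))"
  have fin: "finite D"
    using assms(1) by (simp add: D_def)
  have "0 < Min D"
    using fin d(1) by (subst Min_gr_iff) (auto simp: D_def)
  moreover have "Min D \<le> dist (torus_emb x) (torus_emb y)"
    if "i \<in> I" "j \<in> I" "i \<noteq> j" "x \<in> C i" "y \<in> C j" for i j x y
  proof -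
    have "Min D \<le> d i j"
      using that fin by (intro Min_le) (auto simp: D_def intro!: image_eqI[of _ _ "(i, j)"])
    then show ?thesis using d(2)[OF that(1,2,3) that(4,5)] by simp
  qed
  ultimately show ?thesis by blast
qed

text \<open>A form of Lusin's theorem: inside the cells lie compact sets of almost full measure with
  a positive gap between them. It turns closeness of orbits into equality of names, for rigidity and
  for the upper entropy bound.\<close>

lemma torus_lusin:
  assumes P: "P \<in> finite_measurable_partitions torus_measure" and e: "0 < e"
  shows "\<exists>K\<in>sets torus_measure. measure torus_measure (torus - K) < e \<and>
    (\<exists>d>0. \<forall>z\<in>K. \<forall>z'\<in>K. circle_near d (fst z) (fst z') \<longrightarrow> circle_near d (snd z) (snd z') \<longrightarrow>
       cell_index P z = cell_index P z')"
proof -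
  interpret prob_space torus_measure by (rule prob_space_torus_measure)
  define n where "n = length P"
  have Pi: "P ! i \<in> sets torus_measure" if "i < n" for i
    using P that by (auto simp: finite_measurable_partitions_def n_def)
  \<comment> \<open>Dividing by \<open>Suc n\<close> makes the sum of the \<open>n\<close> errors
    strictly smaller than \<open>e\<close>.\<close>
  have "\<exists>C\<subseteq>P ! i. compact C \<and> C \<in> sets torus_measure \<and>
      measure torus_measure (P ! i - C) < e / real (Suc n)" if "i < n" for i
    using Pi[OF that] e by (intro torus_inner_compact) auto
  then obtain C where C: "\<And>i. i < n \<Longrightarrow> C i \<subseteq> P ! i" "\<And>i. i < n \<Longrightarrow> compact (C i)"
      "\<And>i. i < n \<Longrightarrow> C i \<in> sets torus_measure"
      "\<And>i. i < n \<Longrightarrow> measure torus_measure (P ! i - C i) < e / real (Suc n)"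
    by metis
  have sub: "C i \<subseteq> torus" if "i < n" for i
    using C(3)[OF that] by (simp add: sets_torus_measure)
  have idx: "cell_index P z = i" if "i < n" "z \<in> C i" for i z
    using that C(1)[OF that(1)] sub[OF that(1)]
    by (intro cell_index_eqI[OF P]) (auto simp: n_def)
  obtain d where d: "0 < d" "\<And>i j x y. i < n \<Longrightarrow> j < n \<Longrightarrow> x \<in> C i \<Longrightarrow> y \<in> C j \<Longrightarrow> i \<noteq> j \<Longrightarrow>
      d \<le> dist (torus_emb x) (torus_emb y)"
  proof -
    have "\<exists>d>0. \<forall>i\<in>{..<n}. \<forall>j\<in>{..<n}. \<forall>x\<in>C i. \<forall>y\<in>C j. i \<noteq> j \<longrightarrow>
        d \<le> dist (torus_emb x) (torus_emb y)"
    proof (rule compact_family_separated)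
      show "C i \<inter> C j = {}" if "i \<in> {..<n}" "j \<in> {..<n}" "i \<noteq> j" for i j
        using idx[of i] idx[of j] that by (metis disjoint_iff lessThan_iff)
    qed (use C sub in auto)
    then show thesis using that by blast
  qed
  define K where "K = (\<Union>i<n. C i)"
  have K: "K \<in> sets torus_measure"
    unfolding K_def using C(3) by auto
  have "torus - K \<subseteq> (\<Union>i<n. P ! i - C i)"
    using cell_index_props[OF P] by (fastforce simp: K_def n_def)
  then have "measure torus_measure (torus - K) \<le> measure torus_measure (\<Union>i<n. P ! i - C i)"
    using Pi C(3) by (intro finite_measure_mono sets.finite_UN) auto
  also have "\<dots> \<le> (\<Sum>i<n. measure torus_measure (P ! i - C i))"
    using Pi C(3) by (intro finite_measure_subadditive_finite) auto
  also have "\<dots> \<le> (\<Sum>i<n. e / real (Suc n))"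
    using C(4) by (intro sum_mono less_imp_le) auto
  also have "\<dots> = e * (real n / real (Suc n))" by simp
  also have "\<dots> < e * 1"
    using e by (intro mult_strict_left_mono) auto
  finally have "measure torus_measure (torus - K) < e" by simp
  \<comment> \<open>\<open>torus_emb_near\<close> costs a factor \<open>4 * pi\<close>; radius
    \<open>d / (8 * pi)\<close> keeps the images within \<open>d / 2\<close>, below the gap between
    different compact pieces.\<close>
  moreover have "cell_index P z = cell_index P z'"
    if z: "z \<in> K" "z' \<in> K" and near: "circle_near (d / (8 * pi)) (fst z) (fst z')"
      "circle_near (d / (8 * pi)) (snd z) (snd z')" for z z'
  proof (rule ccontr)
    assume ne: "cell_index P z \<noteq> cell_index P z'"
    obtain i j where ij: "i < n" "j < n" "z \<in> C i" "z' \<in> C j"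
      using z by (auto simp: K_def)
    then have "i \<noteq> j" using ne idx by auto
    then have "d \<le> dist (torus_emb z) (torus_emb z')"
      using d(2) ij by blast
    also have "\<dots> \<le> 4 * pi * (d / (8 * pi))"
      by (rule torus_emb_near[OF near])
    also have "\<dots> = d / 2" by simp
    finally show False using d(1) by simp
  qed
  moreover have "0 < d / (8 * pi)" using d(1) by simp
  ultimately show ?thesis using K by blast
qed

section \<open>Skew translations of the torus\<close>

lemma frac_add_of_int [simp]: "frac (a + of_int k) = frac (a :: real)"
  by (simp add: frac_def)

lemma frac_frac_add: "frac (frac a + b) = frac (a + b :: real)"
proof -
  have "frac a + b = (a + b) + of_int (- \<lfloor>a\<rfloor>)"
    by (simp add: frac_def)
  then show ?thesis by (simp only: frac_add_of_int)
qed

lemma emeasure_lborel_shift: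
  fixes A :: "real set"
  assumes "A \<in> sets borel"
  shows "emeasure lborel {y. y + c \<in> A} = emeasure lborel A"
proof -
  have "emeasure lborel A = emeasure (distr lborel borel ((+) c)) A"
    by (simp add: lborel_distr_plus)
  also have "\<dots> = emeasure lborel {y. y + c \<in> A}"
    using assms by (subst emeasure_distr) (auto simp: vimage_def add.commute)
  finally show ?thesis ..
qed

lemma emeasure_circle_rotation:
  fixes A :: "real set"
  assumes A: "A \<in> sets borel" "A \<subseteq> {0..<1}"
  shows "emeasure lborel {y \<in> {0..<1}. frac (y + c) \<in> A} = emeasure lborel A"
proof -
  define d where "d = frac c"
  have d: "0 \<le> d" "d < 1" by (auto simp: d_def frac_lt_1)
  let ?A1 = "A \<inter> {d..<1}" and ?A2 = "A \<inter> {0..<d}"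
  have f: "frac (y + c) = (if y + d < 1 then y + d else y + d - 1)" if "y \<in> {0..<1}" for y
  proof -
    have "frac (y + c) = frac (y + d)" by (simp add: d_def)
    also have "\<dots> = (if y + d < 1 then y + d else y + d - 1)"
      using that d by (auto simp: frac_unique_iff intro!: frac_unique_iff[THEN iffD2])
    finally show ?thesis .
  qed
  \<comment> \<open>The preimage has two pieces, according to whether adding \<open>d\<close> wraps
    around; they are translates of the parts of \<open>A\<close> on either side of
    \<open>d\<close>.\<close>
  have "{y \<in> {0..<1}. frac (y + c) \<in> A} = {y. y + d \<in> ?A1} \<union> {y. y + (d - 1) \<in> ?A2}"
  proof (rule set_eqI)
    fix y
    show "y \<in> {y \<in> {0..<1}. frac (y + c) \<in> A} \<longleftrightarrow> y \<in> {y. y + d \<in> ?A1} \<union> {y. y + (d - 1) \<in> ?A2}"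
      using f[of y] d A by (cases "y \<in> {0..<1}") (auto simp: add_diff_eq)
  qed
  moreover have "{y. y + d \<in> ?A1} \<inter> {y. y + (d - 1) \<in> ?A2} = {}" by auto
  moreover have "{y. y + d \<in> ?A1} \<in> sets borel" "{y. y + (d - 1) \<in> ?A2} \<in> sets borel"
    using A by measurable
  ultimately have "emeasure lborel {y \<in> {0..<1}. frac (y + c) \<in> A} =
      emeasure lborel {y. y + d \<in> ?A1} + emeasure lborel {y. y + (d - 1) \<in> ?A2}"
    by (simp add: plus_emeasure)
  also have "\<dots> = emeasure lborel ?A1 + emeasure lborel ?A2"
    using A by (intro arg_cong2[where f = "(+)"] emeasure_lborel_shift) auto
  also have "\<dots> = emeasure lborel (?A1 \<union> ?A2)"
    using A by (intro plus_emeasure) auto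
  also have "?A1 \<union> ?A2 = A"
    using A d by auto
  finally show ?thesis .
qed

definition skew_map :: "(real \<Rightarrow> real) \<Rightarrow> real \<times> real \<Rightarrow> real \<times> real" where
  "skew_map f z = (fst z, frac (snd z + f (fst z)))"

lemma skew_map_measurable:
  assumes [measurable]: "f \<in> borel_measurable borel"
  shows "skew_map f \<in> borel_measurable borel" "skew_map f \<in> measurable torus_measure torus_measure"
proof -
  show 1: "skew_map f \<in> borel_measurable borel"
    unfolding skew_map_def frac_def borel_prod[symmetric] by measurable
  have "skew_map f \<in> measurable (restrict_space borel torus) (restrict_space borel torus)"
    using measurable_restrict_space1[OF 1]
    by (intro measurable_restrict_space2)
      (auto simp: space_restrict_space skew_map_def torus_def frac_lt_1)
  moreover have "sets torus_measure = sets (restrict_space borel torus)"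
    by (auto simp: sets_torus_measure sets_restrict_space_iff)
  ultimately show "skew_map f \<in> measurable torus_measure torus_measure"
    by (simp cong: measurable_cong_sets)
qed

lemma torus_measure_iso_I:
  assumes h: "h \<in> measurable torus_measure torus_measure" and k: "k \<in> measurable torus_measure torus_measure"
    and "\<And>z. z \<in> torus \<Longrightarrow> k (h z) = z" "\<And>z. z \<in> torus \<Longrightarrow> h (k z) = z"
    and e: "\<And>A. A \<in> sets borel \<Longrightarrow> A \<subseteq> torus \<Longrightarrow> emeasure lborel (h -` A \<inter> torus) = emeasure lborel A"
  shows "measure_iso torus_measure torus_measure h"
proof (rule measure_isoI[OF h k])
  show "distr torus_measure torus_measure h = torus_measure"
  proof (rule measure_eqI)
    fix A assume "A \<in> sets (distr torus_measure torus_measure h)"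
    then have A: "A \<in> sets torus_measure" by simp
    have "emeasure (distr torus_measure torus_measure h) A = emeasure torus_measure (h -` A \<inter> torus)"
      using emeasure_distr[OF h A] by simp
    also have "\<dots> = emeasure lborel (h -` A \<inter> torus)"
      using measurable_sets[OF h A] by (intro emeasure_torus_measure) simp
    also have "\<dots> = emeasure torus_measure A"
      using A e by (simp add: sets_torus_measure emeasure_torus_measure)
    finally show "emeasure (distr torus_measure torus_measure h) A = emeasure torus_measure A" .
  qed simp
qed (use assms in auto)

text \<open>Each vertical section is merely rotated, so integration over the base reduces invariance
  to the rotation of a circle.\<close>

lemma measure_iso_skew_map:
  assumes [measurable]: "f \<in> borel_measurable borel"
  shows "measure_iso torus_measure torus_measure (skew_map f)"
proof (rule torus_measure_iso_I)
  show "skew_map f \<in> measurable torus_measure torus_measure"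
    "skew_map (\<lambda>x. - f x) \<in> measurable torus_measure torus_measure"
    by (rule skew_map_measurable; measurable)+
  show "skew_map (\<lambda>x. - f x) (skew_map f z) = z" "skew_map f (skew_map (\<lambda>x. - f x) z) = z"
    if "z \<in> torus" for z
    using that by (auto simp: skew_map_def torus_def frac_frac_add frac_eq diff_conv_add_uminus[symmetric]
        frac_frac_add[where b = "- _", simplified])
  fix A :: "(real \<times> real) set" assume A: "A \<in> sets borel" "A \<subseteq> torus"
  have A': "A \<in> sets (lborel \<Otimes>\<^sub>M lborel)"
    using A unfolding lborel_prod by simp
  have "skew_map f -` A \<inter> torus \<in> sets borel"
    using skew_map_measurable(1)[OF assms] A by (auto intro: measurable_sets_borel)
  then have B: "skew_map f -` A \<inter> torus \<in> sets (lborel \<Otimes>\<^sub>M lborel)"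
    unfolding lborel_prod by simp
  have "emeasure lborel (skew_map f -` A \<inter> torus) =
      (\<integral>\<^sup>+x. emeasure lborel (Pair x -` (skew_map f -` A \<inter> torus)) \<partial>lborel)"
    using lborel.emeasure_pair_measure_alt[OF B] by (simp add: lborel_prod)
  also have "\<dots> = (\<integral>\<^sup>+x. emeasure lborel (Pair x -` A) \<partial>lborel)"
  proof (rule nn_integral_cong)
    fix x :: real
    have "Pair x -` A \<in> sets borel"
      using sets_Pair1[OF A', of x] by simp
    moreover have "Pair x -` A \<subseteq> {0..<1}"
      using A by (auto simp: torus_def)
    moreover have "Pair x -` (skew_map f -` A \<inter> torus) = {y \<in> {0..<1}. frac (y + f x) \<in> Pair x -` A}"
      using A by (auto simp: skew_map_def torus_def)
    ultimately show "emeasure lborel (Pair x -` (skew_map f -` A \<inter> torus)) = emeasure lborel (Pair x -` A)"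
      using emeasure_circle_rotation[of "Pair x -` A" "f x"] by simp
  qed
  also have "\<dots> = emeasure lborel A"
    using lborel.emeasure_pair_measure_alt[OF A'] by (simp add: lborel_prod)
  finally show "emeasure lborel (skew_map f -` A \<inter> torus) = emeasure lborel A" .
qed

definition torus_swap :: "real \<times> real \<Rightarrow> real \<times> real" where
  "torus_swap z = (snd z, fst z)"

lemma measure_iso_torus_swap: "measure_iso torus_measure torus_measure torus_swap"
proof (rule torus_measure_iso_I)
  have 1: "torus_swap \<in> borel_measurable borel"
    unfolding torus_swap_def borel_prod[symmetric] by measurable
  have "torus_swap \<in> measurable (restrict_space borel torus) (restrict_space borel torus)"
    using measurable_restrict_space1[OF 1]
    by (intro measurable_restrict_space2)
      (auto simp: space_restrict_space torus_swap_def torus_def)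
  moreover have "sets torus_measure = sets (restrict_space borel torus)"
    by (auto simp: sets_torus_measure sets_restrict_space_iff)
  ultimately show m: "torus_swap \<in> measurable torus_measure torus_measure"
    by (simp cong: measurable_cong_sets)
  then show "torus_swap \<in> measurable torus_measure torus_measure" .
  fix A :: "(real \<times> real) set" assume A: "A \<in> sets borel" "A \<subseteq> torus"
  have A': "A \<in> sets (lborel \<Otimes>\<^sub>M lborel)"
    using A unfolding lborel_prod by simp
  have eq: "torus_swap -` A \<inter> torus = (\<lambda>(x, y). (y, x)) -` A \<inter> space (lborel \<Otimes>\<^sub>M lborel)"
    using A by (auto simp: torus_swap_def torus_def space_pair_measure)
  have "emeasure lborel A = emeasure (lborel \<Otimes>\<^sub>M lborel) A"
    by (simp add: lborel_prod)
  also have "\<dots> = emeasure (distr (lborel \<Otimes>\<^sub>M lborel) (lborel \<Otimes>\<^sub>M lborel) (\<lambda>(x, y). (y, x))) A"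
    by (rule arg_cong[OF lborel_pair.distr_pair_swap])
  also have "\<dots> = emeasure (lborel \<Otimes>\<^sub>M lborel) (torus_swap -` A \<inter> torus)"
    unfolding eq by (rule emeasure_distr[OF measurable_pair_swap' A'])
  finally show "emeasure lborel (torus_swap -` A \<inter> torus) = emeasure lborel A"
    by (simp add: lborel_prod)
qed (auto simp: torus_swap_def)

definition skew_product :: "real \<Rightarrow> (real \<Rightarrow> real) \<Rightarrow> real \<times> real \<Rightarrow> real \<times> real" where
  "skew_product a f z = (frac (fst z + a), frac (snd z + f (fst z)))"

text \<open>The base rotation is a shear by a constant, seen after exchanging the coordinates; so
  shears and the exchange generate the whole map.\<close>

lemma measure_iso_skew_product:
  assumes "f \<in> borel_measurable borel"
  shows "measure_iso torus_measure torus_measure (skew_product a f)"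
proof -
  have "skew_product a f = (\<lambda>z. torus_swap (skew_map (\<lambda>_. a) (torus_swap (skew_map f z))))"
    by (auto simp: skew_product_def torus_swap_def skew_map_def)
  then show ?thesis
    using measure_iso_comp[OF measure_iso_comp[OF measure_iso_comp[OF measure_iso_skew_map[OF assms]
      measure_iso_torus_swap] measure_iso_skew_map[of "\<lambda>_. a"]] measure_iso_torus_swap]
    by simp
qed

section \<open>The disc and the annulus as copies of the torus\<close>

text \<open>A bijection that multiplies all measures by one constant preserves the normalized
  measures. The area of the disc thus never has to be computed.\<close>

lemma measure_iso_scaling:
  assumes X: "X \<in> sets borel" and Y: "Y \<in> sets borel" "emeasure lborel Y \<noteq> 0" "emeasure lborel Y \<noteq> \<infinity>"
    and h: "h \<in> measurable (restrict_space borel X) borel" and k: "k \<in> measurable (restrict_space borel Y) borel"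
    and hX: "\<And>z. z \<in> X \<Longrightarrow> h z \<in> Y" and kY: "\<And>z. z \<in> Y \<Longrightarrow> k z \<in> X"
    and kh: "\<And>z. z \<in> X \<Longrightarrow> k (h z) = z" and hk: "\<And>z. z \<in> Y \<Longrightarrow> h (k z) = z"
    and c: "c \<noteq> 0" "c \<noteq> \<infinity>"
    and e: "\<And>A. A \<in> sets borel \<Longrightarrow> A \<subseteq> Y \<Longrightarrow> emeasure lborel (h -` A \<inter> X) = c * emeasure lborel A"
  shows "measure_iso (normalized_lebesgue X) (normalized_lebesgue Y) h"
proof -
  have s: "sets (normalized_lebesgue Z) = sets (restrict_space borel Z)" if "Z \<in> sets borel" for Z
    using that by (auto simp: sets_normalized_lebesgue sets_restrict_space_iff)
  have "h \<in> measurable (restrict_space borel X) (restrict_space borel Y)"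
    using h hX by (intro measurable_restrict_space2) (auto simp: space_restrict_space)
  then have hm: "h \<in> measurable (normalized_lebesgue X) (normalized_lebesgue Y)"
    using measurable_cong_sets[OF s[OF X] s[OF Y(1)]] by blast
  have "k \<in> measurable (restrict_space borel Y) (restrict_space borel X)"
    using k kY by (intro measurable_restrict_space2) (auto simp: space_restrict_space)
  then have km: "k \<in> measurable (normalized_lebesgue Y) (normalized_lebesgue X)"
    using measurable_cong_sets[OF s[OF Y(1)] s[OF X]] by blast
  have eX: "emeasure lborel X = c * emeasure lborel Y"
  proof -
    have "h -` Y \<inter> X = X" using hX by auto
    then show ?thesis using e[OF Y(1)] by simp
  qed
  show ?thesis
  proof (rule measure_isoI[OF hm km])
    show "distr (normalized_lebesgue X) (normalized_lebesgue Y) h = normalized_lebesgue Y"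
    proof (rule measure_eqI)
      fix A assume "A \<in> sets (distr (normalized_lebesgue X) (normalized_lebesgue Y) h)"
      then have A: "A \<in> sets (normalized_lebesgue Y)" by simp
      have A': "A \<in> sets borel" "A \<subseteq> Y" using A sets_normalized_lebesgue[OF Y(1)] by auto
      have hA: "h -` A \<inter> X \<in> sets (normalized_lebesgue X)"
        using measurable_sets[OF hm A] by simp
      have "emeasure (distr (normalized_lebesgue X) (normalized_lebesgue Y) h) A =
          emeasure (normalized_lebesgue X) (h -` A \<inter> X)"
        using emeasure_distr[OF hm A] by simp
      also have "\<dots> = emeasure lborel (h -` A \<inter> X) / emeasure lborel X"
        by (rule emeasure_normalized_lebesgue[OF X hA])
      also have "\<dots> = (c * emeasure lborel A) / (c * emeasure lborel Y)"
        by (simp only: eX e[OF A'])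
      also have "\<dots> = emeasure lborel A / emeasure lborel Y"
      proof -
        have "emeasure lborel A \<le> emeasure lborel Y"
          using A' Y by (intro emeasure_mono) auto
        then obtain a y c' where r: "emeasure lborel A = ennreal a" "emeasure lborel Y = ennreal y" "c = ennreal c'"
          "0 \<le> a" "0 < y" "0 < c'"
          using Y c by (cases "emeasure lborel A"; cases "emeasure lborel Y"; cases c) (auto simp: top_unique less_le)
        have "c * emeasure lborel A = ennreal (c' * a)" "c * emeasure lborel Y = ennreal (c' * y)"
          using r by (auto simp: ennreal_mult)
        then show ?thesis
          using r by (simp add: divide_ennreal)
      qed
      also have "\<dots> = emeasure (normalized_lebesgue Y) A"
        by (rule emeasure_normalized_lebesgue[OF Y(1) A, symmetric])
      finally show "emeasure (distr (normalized_lebesgue X) (normalized_lebesgue Y) h) A =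
          emeasure (normalized_lebesgue Y) A" .
    qed simp
  qed (use kh hk in auto)
qed

lemma measure_iso_null_modification:
  assumes X: "X \<in> sets borel" and Y: "Y \<in> sets borel" "emeasure lborel Y \<noteq> 0" "emeasure lborel Y \<noteq> \<infinity>"
    and h: "h \<in> borel_measurable borel" and k: "k \<in> borel_measurable borel"
    and hX: "\<And>z. z \<in> X \<Longrightarrow> h z \<in> Y" and kY: "\<And>z. z \<in> Y \<Longrightarrow> k z \<in> X"
    and kh: "\<And>z. z \<in> X \<Longrightarrow> k (h z) = z" and hk: "\<And>z. z \<in> Y \<Longrightarrow> h (k z) = z"
    and N: "N \<in> null_sets lborel"
    and idh: "\<And>z. z \<notin> N \<Longrightarrow> h z = z" and idk: "\<And>z. z \<notin> N \<Longrightarrow> k z = z"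
  shows "measure_iso (normalized_lebesgue X) (normalized_lebesgue Y) h"
proof (rule measure_iso_scaling[OF X Y _ _ hX kY kh hk, where c = 1])
  show "h \<in> measurable (restrict_space borel X) borel" "k \<in> measurable (restrict_space borel Y) borel"
    using h k by (auto intro: measurable_restrict_space1)
  fix A :: "(real \<times> real) set" assume A: "A \<in> sets borel" "A \<subseteq> Y"
  have hA: "h -` A \<inter> X \<in> sets lborel"
    using measurable_sets_borel[OF h A(1)] X by auto
  have eq: "(h -` A \<inter> X) - N = A - N"
  proof (intro equalityI subsetI)
    fix z assume "z \<in> A - N"
    moreover from this have "k z \<in> X" "k z = z" using kY[of z] A idk by auto
    ultimately show "z \<in> (h -` A \<inter> X) - N" using idh by auto
  qed (use idh in auto)
  have "emeasure lborel (h -` A \<inter> X) = emeasure lborel ((h -` A \<inter> X) - N)"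
    by (rule emeasure_Diff_null_set[OF N hA, symmetric])
  also have "\<dots> = emeasure lborel A"
    unfolding eq using A by (intro emeasure_Diff_null_set[OF N]) simp
  finally show "emeasure lborel (h -` A \<inter> X) = 1 * emeasure lborel A" by simp
qed auto

text \<open>The countable set \<open>D\<close> is absorbed by re-enumerating a countably infinite
  subset of \<open>A\<close>. Both maps differ from the identity only on a countable set, which
  makes them Borel and harmless for Lebesgue measure.\<close>

lemma hilbert_hotel:
  fixes A D :: "'a :: {second_countable_topology, t1_space} set"
  assumes "countable D" "A \<inter> D = {}" "infinite A"
  obtains h k C where "countable C" "h \<in> borel_measurable borel" "k \<in> borel_measurable borel"
    "\<And>x. x \<in> A \<union> D \<Longrightarrow> h x \<in> A" "\<And>x. x \<in> A \<Longrightarrow> k x \<in> A \<union> D"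
    "\<And>x. x \<in> A \<union> D \<Longrightarrow> k (h x) = x" "\<And>x. x \<in> A \<Longrightarrow> h (k x) = x"
    "\<And>x. x \<notin> C \<Longrightarrow> h x = x" "\<And>x. x \<notin> C \<Longrightarrow> k x = x"
proof -
  obtain E where E: "countable E" "infinite E" "E \<subseteq> A"
    using infinite_countable_subset'[OF assms(3)] by blast
  have ED: "countable (E \<union> D)" "infinite (E \<union> D)" using E assms by auto
  define f where "f x = from_nat_into E (to_nat_on (E \<union> D) x)" for x
  have "bij_betw f (E \<union> D) E"
  proof -
    have "bij_betw (from_nat_into E \<circ> to_nat_on (E \<union> D)) (E \<union> D) E"
      by (rule bij_betw_trans[OF to_nat_on_infinite[OF ED] bij_betw_from_nat_into[OF E(1,2)]])
    then show ?thesis by (simp add: f_def[abs_def] o_def)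
  qed
  note f = this
  define g where "g = the_inv_into (E \<union> D) f"
  have g: "g (f x) = x" if "x \<in> E \<union> D" for x
    unfolding g_def using f that by (intro the_inv_into_f_f) (auto simp: bij_betw_def)
  have fg: "f (g y) = y" if "y \<in> E" for y
    unfolding g_def using f that by (intro f_the_inv_into_f) (auto simp: bij_betw_def)
  have fE: "f x \<in> E" if "x \<in> E \<union> D" for x
    using f that by (auto simp: bij_betw_def)
  have gE: "g y \<in> E \<union> D" if "y \<in> E" for y
    using the_inv_into_into[of f "E \<union> D" y "E \<union> D"] f that unfolding g_def by (auto simp: bij_betw_def)
  define h where "h x = (if x \<in> E \<union> D then f x else x)" for x
  define k where "k x = (if x \<in> E then g x else x)" for x
  have "h \<in> borel_measurable borel"
    by (rule measurable_discrete_difference[of "\<lambda>x. x" borel borel "E \<union> D"]) (use ED in \<open>auto simp: h_def\<close>)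
  moreover have "k \<in> borel_measurable borel"
    by (rule measurable_discrete_difference[of "\<lambda>x. x" borel borel "E"]) (use E in \<open>auto simp: k_def\<close>)
  moreover have "h x \<in> A" if "x \<in> A \<union> D" for x
    using that fE[of x] E(3) by (auto simp: h_def)
  moreover have "k x \<in> A \<union> D" if "x \<in> A" for x
    using that gE[of x] E(3) by (auto simp: k_def)
  moreover have "k (h x) = x" if "x \<in> A \<union> D" for x
    using that fE[of x] g[of x] assms(2) by (auto simp: h_def k_def)
  moreover have "h (k x) = x" if "x \<in> A" for x
    using that gE[of x] fg[of x] assms(2) by (auto simp: h_def k_def)
  moreover have "h x = x" "k x = x" if "x \<notin> E \<union> D" for x
    using that by (auto simp: h_def k_def)
  ultimately show thesis using that ED(1) by blast
qed

lemma null_sets_countable_strip: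
  assumes "countable (C :: real set)"
  shows "C \<times> (UNIV :: real set) \<in> null_sets lborel" "(UNIV :: real set) \<times> C \<in> null_sets lborel"
proof -
  have C: "C \<in> null_sets lborel" by (rule countable_imp_null_set_lborel[OF assms])
  have "C \<in> sets borel" using C by auto
  then have "C \<times> (UNIV :: real set) \<in> sets borel" "(UNIV :: real set) \<times> C \<in> sets borel"
    by (auto intro: borel_Times)
  moreover have "emeasure lborel (C \<times> (UNIV :: real set)) = 0" "emeasure lborel ((UNIV :: real set) \<times> C) = 0"
    using null_setsD1[OF C] \<open>C \<in> sets borel\<close> by (simp_all add: emeasure_lborel_Times)
  ultimately show "C \<times> (UNIV :: real set) \<in> null_sets lborel" "(UNIV :: real set) \<times> C \<in> null_sets lborel"
    by (auto simp: null_sets_def)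
qed

lemma measurable_map_prod:
  assumes [measurable]: "f \<in> borel_measurable borel" "g \<in> borel_measurable borel"
  shows "(\<lambda>z :: real \<times> real. (f (fst z) :: real, g (snd z) :: real)) \<in> borel_measurable borel"
  unfolding borel_prod[symmetric] by measurable

text \<open>The boundary lines that the fundamental domains include or omit are uncountable, so the
  Hilbert hotel is applied to the coordinates.\<close>

lemma measure_iso_torus_annulus: "\<exists>h. measure_iso torus_measure (normalized_lebesgue annulus) h"
proof -
  have 1: "countable {1::real}" "{0..<1::real} \<inter> {1} = {}" "infinite {0..<1::real}"
    by (auto simp: infinite_Ico)
  obtain h k :: "real \<Rightarrow> real" and C where hk: "countable C" "h \<in> borel_measurable borel" "k \<in> borel_measurable borel"
    "\<And>x. x \<in> {0..<1} \<union> {1} \<Longrightarrow> h x \<in> {0..<1}" "\<And>x. x \<in> {0..<1} \<Longrightarrow> k x \<in> {0..<1} \<union> {1}"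
    "\<And>x. x \<in> {0..<1} \<union> {1} \<Longrightarrow> k (h x) = x" "\<And>x. x \<in> {0..<1} \<Longrightarrow> h (k x) = x"
    "\<And>x. x \<notin> C \<Longrightarrow> h x = x" "\<And>x. x \<notin> C \<Longrightarrow> k x = x"
    by (rule hilbert_hotel[OF 1]) (rule that; assumption)
  have U: "{0..<1} \<union> {1} = {0..1::real}" by auto
  note hk' = hk[unfolded U]
  have eA: "emeasure lborel annulus = 1"
    unfolding annulus_def by (simp add: emeasure_lborel_Times)
  have "measure_iso torus_measure (normalized_lebesgue annulus) (\<lambda>z. (fst z, k (snd z)))"
  proof (rule measure_iso_null_modification[where k = "\<lambda>z. (fst z, h (snd z))" and N = "UNIV \<times> C"])
    show "torus \<in> sets borel" by (rule torus_borel)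
    show "annulus \<in> sets borel" unfolding annulus_def by (intro borel_Times) auto
    show "(\<lambda>z :: real \<times> real. (fst z, k (snd z))) \<in> borel_measurable borel"
      "(\<lambda>z :: real \<times> real. (fst z, h (snd z))) \<in> borel_measurable borel"
      using measurable_map_prod[of "\<lambda>x. x" k] measurable_map_prod[of "\<lambda>x. x" h] hk(2,3) by simp_all
    show "(fst z, k (snd z)) = z" "(fst z, h (snd z)) = z" if "z \<notin> UNIV \<times> C" for z :: "real \<times> real"
    proof -
      have "snd z \<notin> C" using that by (cases z) auto
      then show "(fst z, k (snd z)) = z" "(fst z, h (snd z)) = z" using hk(8,9)[of "snd z"] by simp_all
    qed
    show "(UNIV :: real set) \<times> C \<in> null_sets lborel" by (rule null_sets_countable_strip[OF hk(1)])
  qed (use hk' eA in \<open>auto simp: torus_def annulus_def\<close>)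
  then show ?thesis by blast
qed

text \<open>A shape adapted to the disc: the closed fibres match its closed vertical chords, and the
  base lacks its end points because the chords there degenerate.\<close>

definition open_strip :: "(real \<times> real) set" where
  "open_strip = {0<..<1} \<times> {0..1}"

lemma emeasure_open_strip: "open_strip \<in> sets borel" "emeasure lborel open_strip = 1"
  unfolding open_strip_def by (auto simp: emeasure_lborel_Times intro!: borel_Times)

lemma measure_iso_torus_strip: "\<exists>h. measure_iso torus_measure (normalized_lebesgue open_strip) h"
proof -
  have 1: "countable {1::real}" "{0..<1::real} \<inter> {1} = {}" "infinite {0..<1::real}"
    by (auto simp: infinite_Ico)
  obtain h k :: "real \<Rightarrow> real" and C where hk: "countable C" "h \<in> borel_measurable borel" "k \<in> borel_measurable borel"
    "\<And>x. x \<in> {0..<1} \<union> {1} \<Longrightarrow> h x \<in> {0..<1}" "\<And>x. x \<in> {0..<1} \<Longrightarrow> k x \<in> {0..<1} \<union> {1}"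
    "\<And>x. x \<in> {0..<1} \<union> {1} \<Longrightarrow> k (h x) = x" "\<And>x. x \<in> {0..<1} \<Longrightarrow> h (k x) = x"
    "\<And>x. x \<notin> C \<Longrightarrow> h x = x" "\<And>x. x \<notin> C \<Longrightarrow> k x = x"
    by (rule hilbert_hotel[OF 1]) (rule that; assumption)
  have 0: "countable {0::real}" "{0<..<1::real} \<inter> {0} = {}" "infinite {0<..<1::real}"
    by (auto simp: infinite_Ioo)
  obtain h' k' :: "real \<Rightarrow> real" and C' where hk': "countable C'" "h' \<in> borel_measurable borel" "k' \<in> borel_measurable borel"
    "\<And>x. x \<in> {0<..<1} \<union> {0} \<Longrightarrow> h' x \<in> {0<..<1}" "\<And>x. x \<in> {0<..<1} \<Longrightarrow> k' x \<in> {0<..<1} \<union> {0}"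
    "\<And>x. x \<in> {0<..<1} \<union> {0} \<Longrightarrow> k' (h' x) = x" "\<And>x. x \<in> {0<..<1} \<Longrightarrow> h' (k' x) = x"
    "\<And>x. x \<notin> C' \<Longrightarrow> h' x = x" "\<And>x. x \<notin> C' \<Longrightarrow> k' x = x"
    by (rule hilbert_hotel[OF 0]) (rule that; assumption)
  have U: "{0..<1} \<union> {1} = {0..1::real}" "{0<..<1} \<union> {0} = {0..<1::real}" by auto
  note hk1 = hk[unfolded U] and hk2 = hk'[unfolded U]
  have "measure_iso torus_measure (normalized_lebesgue open_strip) (\<lambda>z. (h' (fst z), k (snd z)))"
  proof (rule measure_iso_null_modification[where k = "\<lambda>z. (k' (fst z), h (snd z))" and N = "C' \<times> UNIV \<union> UNIV \<times> C"])
    show "(\<lambda>z. (h' (fst z), k (snd z))) \<in> borel_measurable borel" "(\<lambda>z. (k' (fst z), h (snd z))) \<in> borel_measurable borel"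
      using measurable_map_prod hk(2,3) hk'(2,3) by auto
    show "C' \<times> UNIV \<union> UNIV \<times> C \<in> null_sets lborel"
      by (intro null_sets.Un null_sets_countable_strip hk(1) hk'(1))
    show "(h' (fst z), k (snd z)) = z" "(k' (fst z), h (snd z)) = z"
      if "z \<notin> C' \<times> UNIV \<union> UNIV \<times> C" for z :: "real \<times> real"
    proof -
      have "fst z \<notin> C'" "snd z \<notin> C" using that by (cases z; auto)+
      then show "(h' (fst z), k (snd z)) = z" "(k' (fst z), h (snd z)) = z"
        using hk(8,9)[of "snd z"] hk'(8,9)[of "fst z"] by simp_all
    qed
    show "torus \<in> sets borel" "open_strip \<in> sets borel"
      "emeasure lborel open_strip \<noteq> 0" "emeasure lborel open_strip \<noteq> \<infinity>"
      by (simp_all add: torus_borel emeasure_open_strip)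
  qed (use hk1 hk2 in \<open>auto simp: torus_def open_strip_def\<close>)
  then show ?thesis by blast
qed

text \<open>Half the length of the vertical chord of the unit disc at abscissa \<open>p\<close>; the
  \<open>max\<close> extends it continuously by zero to the whole line.\<close>

definition half_chord :: "real \<Rightarrow> real" where
  "half_chord p = sqrt (max 0 (1 - p\<^sup>2))"

text \<open>Half the area of the unit disc to the left of \<open>p\<close>. Starting at -2 rather
  than -1 makes the ends of the diameter interior points, where the two-sided derivative
  exists.\<close>

definition disc_area_left :: "real \<Rightarrow> real" where
  "disc_area_left p = integral {-2..p} half_chord"

lemma continuous_half_chord: "continuous_on S half_chord"
  unfolding half_chord_def by (intro continuous_intros continuous_on_max)

lemma half_chord_pos: "\<bar>p\<bar> < 1 \<Longrightarrow> 0 < half_chord p"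
  using abs_square_less_1[of p] by (simp add: half_chord_def max_def)

lemma half_chord_nonneg: "0 \<le> half_chord p"
  by (simp add: half_chord_def)

lemma disc_area_left_deriv:
  assumes "p \<in> {-1..1}"
  shows "(disc_area_left has_real_derivative half_chord p) (at p)"
proof -
  have "(disc_area_left has_real_derivative half_chord p) (at p within {-2..2})"
    unfolding disc_area_left_def using assms
    by (intro integral_has_real_derivative continuous_half_chord) auto
  then show ?thesis
    using assms by (subst (asm) at_within_interior) auto
qed

lemma disc_area_left_strict_mono:
  assumes "-1 \<le> p" "p < q" "q \<le> 1"
  shows "disc_area_left p < disc_area_left q"
proof (rule DERIV_pos_imp_increasing_open[OF assms(2)])
  fix x assume "p < x" "x < q"
  then have "x \<in> {-1..1}" "\<bar>x\<bar> < 1" using assms by auto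
  then show "\<exists>y. (disc_area_left has_real_derivative y) (at x) \<and> 0 < y"
    using disc_area_left_deriv half_chord_pos by blast
next
  have "isCont disc_area_left x" if "x \<in> {p..q}" for x
    using disc_area_left_deriv[of x] that assms by (intro DERIV_isCont) auto
  then show "continuous_on {p..q} disc_area_left"
    by (auto intro: continuous_at_imp_continuous_on)
qed

definition punctured_disc :: "(real \<times> real) set" where
  "punctured_disc = {z \<in> disc. \<bar>fst z\<bar> < 1}"

lemma mem_disc_iff: "z \<in> disc \<longleftrightarrow> (fst z)\<^sup>2 + (snd z)\<^sup>2 \<le> 1"
  by (cases z) (simp add: disc_def dist_prod_def norm_Pair)

lemma mem_punctured_disc_iff: "z \<in> punctured_disc \<longleftrightarrow> \<bar>fst z\<bar> < 1 \<and> \<bar>snd z\<bar> \<le> half_chord (fst z)"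
proof -
  have "(fst z)\<^sup>2 + (snd z)\<^sup>2 \<le> 1 \<longleftrightarrow> \<bar>snd z\<bar> \<le> half_chord (fst z)" if "\<bar>fst z\<bar> < 1"
  proof -
    have "0 < 1 - (fst z)\<^sup>2" using that abs_square_less_1[of "fst z"] by simp
    then have "half_chord (fst z) = sqrt (1 - (fst z)\<^sup>2)" by (simp add: half_chord_def)
    moreover have "\<bar>snd z\<bar> \<le> sqrt (1 - (fst z)\<^sup>2) \<longleftrightarrow> (snd z)\<^sup>2 \<le> 1 - (fst z)\<^sup>2"
      by (metis real_sqrt_abs real_sqrt_le_iff)
    moreover have "(fst z)\<^sup>2 + (snd z)\<^sup>2 \<le> 1 \<longleftrightarrow> (snd z)\<^sup>2 \<le> 1 - (fst z)\<^sup>2" by linarith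
    ultimately show ?thesis by simp
  qed
  then show ?thesis by (auto simp: punctured_disc_def mem_disc_iff)
qed

lemma disc_borel: "disc \<in> sets borel"
  unfolding disc_def by (rule borel_closed) simp

lemma emeasure_lborel_affine_vimage:
  fixes B :: "real set"
  assumes B: "B \<in> sets borel" and s: "0 < s"
  shows "emeasure lborel {q. (q / s + 1) / 2 \<in> B} = ennreal (2 * s) * emeasure lborel B"
proof -
  have "emeasure lborel {q. (q / s + 1) / 2 \<in> B} =
      emeasure (density (distr lborel borel (\<lambda>x. - s + (2 * s) *\<^sub>R x)) (\<lambda>_. ennreal (\<bar>2 * s\<bar> ^ DIM(real)))) {q. (q / s + 1) / 2 \<in> B}"
    using lborel_affine[of "2 * s" "- s"] s by simp
  also have "\<dots> = ennreal (2 * s) * emeasure (distr lborel borel (\<lambda>x. - s + (2 * s) *\<^sub>R x)) {q. (q / s + 1) / 2 \<in> B}"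
    using B s by (subst emeasure_density_const) auto
  also have "emeasure (distr lborel borel (\<lambda>x. - s + (2 * s) *\<^sub>R x)) {q. (q / s + 1) / 2 \<in> B} =
      emeasure lborel {x. ((- s + 2 * s * x) / s + 1) / 2 \<in> B}"
    using B by (subst emeasure_distr) (auto simp: vimage_def)
  also have "{x. ((- s + 2 * s * x) / s + 1) / 2 \<in> B} = B"
  proof -
    have "((- s + 2 * s * x) / s + 1) / 2 = x" for x using s by (simp add: field_simps)
    then show ?thesis by simp
  qed
  finally show ?thesis .
qed

text \<open>The first coordinate becomes the normalized area to the left, the second the position
  within the chord. The horizontal stretching \<open>half_chord p / c\<close> and the vertical
  stretching \<open>1 / (2 * half_chord p)\<close> have a constant product, so areas are only
  rescaled.\<close>

lemma measure_iso_punctured_disc_strip: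
  "\<exists>h. measure_iso (normalized_lebesgue open_strip) (normalized_lebesgue punctured_disc) h"
proof -
  let ?F = disc_area_left and ?s = half_chord
  define a0 where "a0 = ?F (-1)"
  define c where "c = ?F 1 - a0"
  have c: "0 < c" using disc_area_left_strict_mono[of "-1" 1] by (simp add: c_def a0_def)
  define G where "G p = (?F p - a0) / c" for p
  have Gmono: "G p < G q" if "-1 \<le> p" "p < q" "q \<le> 1" for p q
    using disc_area_left_strict_mono[OF that] c by (simp add: G_def divide_strict_right_mono)
  have Gends: "G (-1) = 0" "G 1 = 1" using c by (simp_all add: G_def a0_def c_def)
  have G01: "0 < G p" "G p < 1" if "\<bar>p\<bar> < 1" for p
    using Gmono[of "-1" p] Gmono[of p 1] that Gends by auto
  have Gder: "(G has_real_derivative ?s p / c) (at p)" if "p \<in> {-1..1}" for p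
    unfolding G_def
    using DERIV_cdivide[OF DERIV_diff[OF disc_area_left_deriv[OF that] DERIV_const[of a0]], of c] by simp
  have Gcont: "continuous_on {-1..1} G"
    by (intro continuous_at_imp_continuous_on ballI DERIV_isCont[OF Gder])
  have Ginj: "p = q" if "p \<in> {-1..1}" "q \<in> {-1..1}" "G p = G q" for p q
    using Gmono[of p q] Gmono[of q p] that by (cases p q rule: linorder_cases) auto
  have Gim: "G ` {-1..1} = {0..1}"
  proof (intro equalityI subsetI)
    fix y assume "y \<in> {0..1::real}"
    then show "y \<in> G ` {-1..1}"
      using IVT'[of G "-1" y 1] Gends Gcont by auto
  next
    fix y assume "y \<in> G ` {-1..1}"
    then obtain p where p: "p \<in> {-1..1}" "y = G p" by auto
    then show "y \<in> {0..1}"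
      using G01[of p] Gends by (cases "\<bar>p\<bar> < 1") (auto simp: abs_less_iff not_less le_less)
  qed
  define a where "a = the_inv_into {-1..1} G"
  have inj: "inj_on G {-1..1}" using Ginj by (intro inj_onI) auto
  have aG: "a (G p) = p" if "p \<in> {-1..1}" for p
    unfolding a_def using inj that by (rule the_inv_into_f_f)
  have Ga: "G (a y) = y" and a_mem: "a y \<in> {-1..1}" if "y \<in> {0..1}" for y
  proof -
    show "G (a y) = y"
      unfolding a_def using inj that Gim by (intro f_the_inv_into_f) auto
    show "a y \<in> {-1..1}"
      unfolding a_def using inj that Gim by (intro the_inv_into_into) auto
  qed
  have a_open: "\<bar>a y\<bar> < 1" if "0 < y" "y < 1" for y
  proof -
    have "a y \<noteq> -1" "a y \<noteq> 1" using Ga[of y] Gends that by auto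
    then show ?thesis using a_mem[of y] that by auto
  qed
  have acont: "continuous_on {0..1} a"
    using continuous_on_inv[OF Gcont, of a] aG Gim by auto
  have strip_b: "open_strip \<in> sets borel" by (rule emeasure_open_strip)
  have am: "(\<lambda>z :: real \<times> real. a (fst z)) \<in> borel_measurable (restrict_space borel open_strip)"
  proof (rule borel_measurable_continuous_on_restrict)
    show "continuous_on open_strip (\<lambda>z :: real \<times> real. a (fst z))"
      by (rule continuous_on_compose2[OF acont]) (auto simp: open_strip_def intro: continuous_intros)
  qed
  have sm [measurable]: "?s \<in> borel_measurable borel"
    by (intro borel_measurable_continuous_onI continuous_half_chord)
  define h where "h z = (G (fst z), (snd z / ?s (fst z) + 1) / 2)" for z :: "real \<times> real"
  define k where "k z = (a (fst z), ?s (a (fst z)) * (2 * snd z - 1))" for z :: "real \<times> real"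
  have pd_b: "punctured_disc \<in> sets borel"
  proof -
    have eq: "punctured_disc = disc \<inter> {z. \<bar>fst z\<bar> < 1}" by (auto simp: punctured_disc_def)
    have "open {z :: real \<times> real. \<bar>fst z\<bar> < 1}"
      by (intro open_Collect_less continuous_intros)
    then show ?thesis
      unfolding eq by (intro sets.Int disc_borel borel_open)
  qed
  have Gm: "(\<lambda>z :: real \<times> real. G (fst z)) \<in> borel_measurable (restrict_space borel punctured_disc)"
  proof (rule borel_measurable_continuous_on_restrict)
    show "continuous_on punctured_disc (\<lambda>z :: real \<times> real. G (fst z))"
      by (rule continuous_on_compose2[OF Gcont]) (auto simp: punctured_disc_def intro: continuous_intros)
  qed
  have "measure_iso (normalized_lebesgue punctured_disc) (normalized_lebesgue open_strip) h"
  proof (rule measure_iso_scaling[OF pd_b strip_b, where k = k and c = "ennreal (2 * c)"])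
    have [measurable]: "fst \<in> borel_measurable (restrict_space borel Z)" "snd \<in> borel_measurable (restrict_space borel Z)"
      for Z :: "(real \<times> real) set"
      by (intro measurable_restrict_space1; simp add: borel_prod[symmetric])+
    show "h \<in> measurable (restrict_space borel punctured_disc) borel"
      unfolding h_def borel_prod[symmetric] using Gm[unfolded borel_prod[symmetric]]
      by (intro measurable_Pair) (simp_all add: borel_prod)
    show "k \<in> measurable (restrict_space borel open_strip) borel"
      unfolding k_def borel_prod[symmetric] using am
      by (intro measurable_Pair) (simp_all add: borel_prod measurable_compose[OF am sm])
    show "h z \<in> open_strip" if "z \<in> punctured_disc" for z
    proof -
      have z: "\<bar>fst z\<bar> < 1" "\<bar>snd z\<bar> \<le> ?s (fst z)" using that by (simp_all add: mem_punctured_disc_iff)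
      have "0 < ?s (fst z)" using half_chord_pos[OF z(1)] .
      then have "-1 \<le> snd z / ?s (fst z)" "snd z / ?s (fst z) \<le> 1"
        using z(2) by (auto simp: field_simps abs_le_iff)
      then show ?thesis using G01[OF z(1)] by (simp add: h_def open_strip_def)
    qed
    show "k z \<in> punctured_disc" if "z \<in> open_strip" for z
    proof -
      have z: "0 < fst z" "fst z < 1" "0 \<le> snd z" "snd z \<le> 1" using that by (auto simp: open_strip_def)
      have "\<bar>2 * snd z - 1\<bar> \<le> 1" using z by auto
      then have "\<bar>?s (a (fst z)) * (2 * snd z - 1)\<bar> \<le> ?s (a (fst z)) * 1"
        unfolding abs_mult by (intro mult_mono) (auto simp: half_chord_nonneg)
      then show ?thesis using a_open[of "fst z"] z by (simp add: k_def mem_punctured_disc_iff)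
    qed
    show "k (h z) = z" if "z \<in> punctured_disc" for z
    proof -
      have z: "\<bar>fst z\<bar> < 1" using that by (simp add: mem_punctured_disc_iff)
      have "a (G (fst z)) = fst z" using z by (intro aG) auto
      then show ?thesis
        using half_chord_pos[OF z] by (simp add: h_def k_def prod_eq_iff field_simps)
    qed
    show "h (k z) = z" if "z \<in> open_strip" for z
    proof -
      have z: "0 < fst z" "fst z < 1" using that by (auto simp: open_strip_def)
      have "G (a (fst z)) = fst z" using z by (intro Ga) auto
      then show ?thesis
        using half_chord_pos[OF a_open[OF z]] by (simp add: h_def k_def prod_eq_iff field_simps)
    qed
    fix A :: "(real \<times> real) set" assume A: "A \<in> sets borel" "A \<subseteq> open_strip"
    have A': "A \<in> sets (lborel \<Otimes>\<^sub>M lborel)" using A unfolding lborel_prod by simp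
    have "h \<in> measurable (restrict_space borel punctured_disc) borel"
      unfolding h_def borel_prod[symmetric] using Gm[unfolded borel_prod[symmetric]]
      by (intro measurable_Pair) (simp_all add: borel_prod)
    then have "h -` A \<inter> space (restrict_space borel punctured_disc) \<in> sets (restrict_space borel punctured_disc)"
      by (rule measurable_sets[OF _ A(1)])
    then have hA: "h -` A \<inter> punctured_disc \<in> sets borel"
      using pd_b by (auto simp: space_restrict_space sets_restrict_space_iff)
    then have hA': "h -` A \<inter> punctured_disc \<in> sets (lborel \<Otimes>\<^sub>M lborel)" unfolding lborel_prod by simp
    have Am: "(\<lambda>x. emeasure lborel (Pair x -` A)) \<in> borel_measurable borel"
      using lborel.measurable_emeasure_Pair[OF A'] by simp
    have "emeasure lborel (h -` A \<inter> punctured_disc) =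
        (\<integral>\<^sup>+p. emeasure lborel (Pair p -` (h -` A \<inter> punctured_disc)) \<partial>lborel)"
      using lborel.emeasure_pair_measure_alt[OF hA'] by (simp add: lborel_prod)
    \<comment> \<open>The chord length \<open>2 * ?s p\<close> is \<open>2 * c\<close> times the
      derivative of \<open>G\<close>, the form needed for the substitution \<open>x = G p\<close>.
      At the ends of the interval the section of \<open>A\<close> is empty, the strip being open
      there.\<close>
    also have "\<dots> = (\<integral>\<^sup>+p. ennreal (2 * c) * (emeasure lborel (Pair (G p) -` A) * ennreal (?s p / c) * indicator {-1..1} p) \<partial>lborel)"
    proof (rule nn_integral_cong)
      fix p :: real
      show "emeasure lborel (Pair p -` (h -` A \<inter> punctured_disc)) =
          ennreal (2 * c) * (emeasure lborel (Pair (G p) -` A) * ennreal (?s p / c) * indicator {-1..1} p)"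
      proof (cases "\<bar>p\<bar> < 1")
        case True
        have s: "0 < ?s p" by (rule half_chord_pos[OF True])
        have B: "Pair (G p) -` A \<in> sets borel" using sets_Pair1[OF A', of "G p"] by simp
        have "Pair p -` (h -` A \<inter> punctured_disc) = {q. (q / ?s p + 1) / 2 \<in> Pair (G p) -` A}"
        proof (intro equalityI subsetI)
          fix q assume q: "q \<in> {q. (q / ?s p + 1) / 2 \<in> Pair (G p) -` A}"
          then have "(q / ?s p + 1) / 2 \<in> {0..1}" using A by (auto simp: open_strip_def)
          then have "-1 \<le> q / ?s p" "q / ?s p \<le> 1" by auto
          then have "\<bar>q\<bar> \<le> ?s p" using s by (auto simp: field_simps abs_le_iff)
          then show "q \<in> Pair p -` (h -` A \<inter> punctured_disc)"
            using q True by (simp add: h_def mem_punctured_disc_iff)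
        qed (auto simp: h_def)
        then have "emeasure lborel (Pair p -` (h -` A \<inter> punctured_disc)) =
            ennreal (2 * ?s p) * emeasure lborel (Pair (G p) -` A)"
          using emeasure_lborel_affine_vimage[OF B s] by simp
        also have "ennreal (2 * ?s p) = ennreal (2 * c) * ennreal (?s p / c)"
          using c s by (simp flip: ennreal_mult)
        moreover have "p \<in> {-1..1}" using True by auto
        ultimately show ?thesis by (simp add: mult_ac)
      next
        case False
        then have "Pair p -` (h -` A \<inter> punctured_disc) = {}" by (auto simp: mem_punctured_disc_iff)
        moreover have "Pair (G p) -` A = {}" if "p \<in> {-1..1}"
        proof -
          have "p = -1 \<or> p = 1" using False that by auto
          then have "G p = 0 \<or> G p = 1" using Gends by auto
          then show ?thesis using A by (auto simp: open_strip_def)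
        qed
        ultimately show ?thesis by (auto simp: indicator_def)
      qed
    qed
    also have "\<dots> = ennreal (2 * c) * (\<integral>\<^sup>+p. emeasure lborel (Pair (G p) -` A) * ennreal (?s p / c) * indicator {-1..1} p \<partial>lborel)"
    proof (rule nn_integral_cmult)
      \<comment> \<open>Continuity of \<open>G\<close> is available on the closed interval only; its
        product with the indicator is Borel and agrees with \<open>G\<close> wherever the integrand
        can be nonzero.\<close>
      have Gr: "(\<lambda>p. G p * indicator {-1..1} p) \<in> borel_measurable borel"
        using borel_measurable_continuous_on_indicator[OF _ Gcont] by (simp add: mult.commute)
      have "(\<lambda>p. emeasure lborel (Pair (G p * indicator {-1..1} p) -` A) * ennreal (?s p / c) * indicator {-1..1} p)
          \<in> borel_measurable borel"
        using measurable_compose[OF Gr Am] by measurable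
      also have "(\<lambda>p. emeasure lborel (Pair (G p * indicator {-1..1} p) -` A) * ennreal (?s p / c) * indicator {-1..1} p) =
          (\<lambda>p. emeasure lborel (Pair (G p) -` A) * ennreal (?s p / c) * indicator {-1..1} p)"
        by (auto simp: indicator_def)
      finally show "(\<lambda>p. emeasure lborel (Pair (G p) -` A) * ennreal (?s p / c) * indicator {-1..1} p) \<in> borel_measurable lborel"
        by simp
    qed
    also have "(\<integral>\<^sup>+p. emeasure lborel (Pair (G p) -` A) * ennreal (?s p / c) * indicator {-1..1} p \<partial>lborel) =
        (\<integral>\<^sup>+x. emeasure lborel (Pair x -` A) * indicator {G (-1)..G 1} x \<partial>lborel)"
      using Gder Am c by (intro nn_integral_substitution_aux[symmetric])
        (auto intro!: continuous_intros continuous_half_chord simp: half_chord_nonneg)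
    also have "\<dots> = (\<integral>\<^sup>+x. emeasure lborel (Pair x -` A) \<partial>lborel)"
    proof (rule nn_integral_cong)
      fix x :: real
      have "Pair x -` A = {}" if "x \<notin> {0..1}" using A that by (auto simp: open_strip_def)
      then show "emeasure lborel (Pair x -` A) * indicator {G (-1)..G 1} x = emeasure lborel (Pair x -` A)"
        unfolding Gends by (cases "x \<in> {0..1}") auto
    qed
    also have "\<dots> = emeasure lborel A"
      using lborel.emeasure_pair_measure_alt[OF A'] by (simp add: lborel_prod)
    finally show "emeasure lborel (h -` A \<inter> punctured_disc) = ennreal (2 * c) * emeasure lborel A" .
  qed (use c emeasure_open_strip in auto)
  \<comment> \<open>The map goes from the disc to the strip, where the area formula is explicit; the
    claim is about its inverse.\<close>
  then obtain k' where "measure_iso (normalized_lebesgue punctured_disc) (normalized_lebesgue open_strip) h"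
      "k' \<in> measurable (normalized_lebesgue open_strip) (normalized_lebesgue punctured_disc)"
      "\<And>x. x \<in> space (normalized_lebesgue punctured_disc) \<Longrightarrow> k' (h x) = x"
    using measure_isoE by metis
  then show ?thesis using measure_iso_sym by blast
qed

lemma measure_iso_punctured_disc_disc:
  "\<exists>h. measure_iso (normalized_lebesgue punctured_disc) (normalized_lebesgue disc) h"
proof -
  let ?D = "{(1, 0), (-1, 0)} :: (real \<times> real) set"
  have Un: "punctured_disc \<union> ?D = disc"
  proof (intro equalityI subsetI)
    fix z assume z: "z \<in> disc"
    show "z \<in> punctured_disc \<union> ?D"
    proof (cases "\<bar>fst z\<bar> < 1")
      case False
      then have "1 \<le> (fst z)\<^sup>2" using abs_square_less_1[of "fst z"] by auto
      then have "(snd z)\<^sup>2 \<le> 0" "(fst z)\<^sup>2 = 1"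
        using z zero_le_power2[of "snd z"] unfolding mem_disc_iff by linarith+
      then have "snd z = 0" "fst z = 1 \<or> fst z = -1" by (auto simp: power2_eq_1_iff)
      then show ?thesis by (cases z) auto
    qed (use z in \<open>auto simp: punctured_disc_def\<close>)
  qed (auto simp: punctured_disc_def mem_disc_iff)
  have "(\<lambda>t. (0::real, t)) ` {0..<1::real} \<subseteq> punctured_disc"
    by (auto simp: punctured_disc_def mem_disc_iff abs_square_le_1)
  moreover have "infinite ((\<lambda>t. (0::real, t)) ` {0..<1::real})"
    by (subst finite_image_iff) (auto simp: inj_on_def infinite_Ico)
  ultimately have inf: "infinite punctured_disc" using finite_subset by blast
  have D: "countable ?D" "punctured_disc \<inter> ?D = {}" by (auto simp: punctured_disc_def)
  obtain h k :: "real \<times> real \<Rightarrow> real \<times> real" and C where hk: "countable C" "h \<in> borel_measurable borel" "k \<in> borel_measurable borel"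
    "\<And>x. x \<in> punctured_disc \<union> ?D \<Longrightarrow> h x \<in> punctured_disc" "\<And>x. x \<in> punctured_disc \<Longrightarrow> k x \<in> punctured_disc \<union> ?D"
    "\<And>x. x \<in> punctured_disc \<union> ?D \<Longrightarrow> k (h x) = x" "\<And>x. x \<in> punctured_disc \<Longrightarrow> h (k x) = x"
    "\<And>x. x \<notin> C \<Longrightarrow> h x = x" "\<And>x. x \<notin> C \<Longrightarrow> k x = x"
    by (rule hilbert_hotel[OF D inf]) (rule that; assumption)
  note hk' = hk[unfolded Un]
  have eq: "punctured_disc = disc - ?D" using Un D(2) by auto
  have pb: "punctured_disc \<in> sets borel"
    unfolding eq by (intro sets.Diff disc_borel borel_closed finite_imp_closed) simp
  have fin: "emeasure lborel disc \<noteq> \<infinity>"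
    unfolding disc_def using emeasure_lborel_cball_finite[of "0::real \<times> real" 1] by simp
  have nz: "emeasure lborel disc \<noteq> 0"
  proof -
    have "{0..1/2} \<times> {0..1/2} \<subseteq> disc"
    proof
      fix z :: "real \<times> real" assume "z \<in> {0..1/2} \<times> {0..1/2}"
      then have "(fst z)\<^sup>2 \<le> (1/2)\<^sup>2" "(snd z)\<^sup>2 \<le> (1/2)\<^sup>2" by (auto intro!: power_mono)
      then show "z \<in> disc" by (simp add: mem_disc_iff power2_eq_square)
    qed
    then have "emeasure lborel ({0..1/2} \<times> {0..1/2} :: (real \<times> real) set) \<le> emeasure lborel disc"
      using disc_borel by (intro emeasure_mono) auto
    then show ?thesis by (auto simp: emeasure_lborel_Times)
  qed
  have "measure_iso (normalized_lebesgue punctured_disc) (normalized_lebesgue disc) k"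
    by (rule measure_iso_null_modification[OF pb disc_borel nz fin hk'(3) hk'(2) hk'(5) hk'(4) hk'(7) hk'(6)
      countable_imp_null_set_lborel[OF hk(1)] hk'(9) hk'(8)])
  then show ?thesis by blast
qed

lemma measure_iso_torus_disc: "\<exists>h. measure_iso torus_measure (normalized_lebesgue disc) h"
proof -
  obtain h1 where h1: "measure_iso torus_measure (normalized_lebesgue open_strip) h1"
    using measure_iso_torus_strip by blast
  obtain h2 where h2: "measure_iso (normalized_lebesgue open_strip) (normalized_lebesgue punctured_disc) h2"
    using measure_iso_punctured_disc_strip by blast
  obtain h3 where h3: "measure_iso (normalized_lebesgue punctured_disc) (normalized_lebesgue disc) h3"
    using measure_iso_punctured_disc_disc by blast
  show ?thesis
    using measure_iso_comp[OF measure_iso_comp[OF h1 h2] h3] by blast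
qed

section \<open>Liouville numbers\<close>

definition liouville :: "(nat \<Rightarrow> nat) \<Rightarrow> real" where
  "liouville D = (\<Sum>n. 1 / real (D n))"

definition liouville_tail :: "(nat \<Rightarrow> nat) \<Rightarrow> nat \<Rightarrow> real" where
  "liouville_tail D n = (\<Sum>i. 1 / real (D (Suc n + i)))"

text \<open>The factor 2 in the divisibility serves twice: it makes the reciprocals summable and
  keeps the numerators odd in \<open>liouville_approx\<close>.\<close>

locale divisor_chain =
  fixes D :: "nat \<Rightarrow> nat"
  assumes D_0: "D 0 = 1" and D_dvd: "2 * D n dvd D (Suc n)" and D_pos: "0 < D n"
begin

lemma D_growth: "D n * 2 ^ i \<le> D (n + i)"
proof (induction i)
  case (Suc i)
  have "2 * D (n + i) \<le> D (Suc (n + i))"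
    by (rule dvd_imp_le[OF D_dvd D_pos])
  then show ?case using Suc by simp
qed simp

lemma inverse_D_le: "1 / real (D (n + i)) \<le> (1 / real (D n)) * (1/2) ^ i"
proof -
  have "real (D n) * 2 ^ i \<le> real (D (n + i))"
    using of_nat_mono[OF D_growth[of n i], where 'a = real] by simp
  then have "1 / real (D (n + i)) \<le> 1 / (real (D n) * 2 ^ i)"
    using D_pos by (intro divide_left_mono) auto
  then show ?thesis by (simp add: field_simps power_divide)
qed

lemma summable_inverse_D: "summable (\<lambda>i. 1 / real (D (n + i)))"
proof (rule summable_comparison_test')
  show "summable (\<lambda>i. (1 / real (D n)) * (1/2) ^ i)"
    by (intro summable_mult summable_geometric) simp
  show "norm (1 / real (D (n + i))) \<le> (1 / real (D n)) * (1/2) ^ i" if "i \<ge> 0" for i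
    using inverse_D_le[of n i] by simp
qed

lemma tail_nonneg: "0 \<le> liouville_tail D n"
  unfolding liouville_tail_def by (rule suminf_nonneg[OF summable_inverse_D]) simp

lemma tail_le: "liouville_tail D n \<le> 2 / real (D (Suc n))"
proof -
  have "liouville_tail D n \<le> (\<Sum>i. (1 / real (D (Suc n))) * (1/2) ^ i)"
    unfolding liouville_tail_def
    by (intro suminf_le inverse_D_le summable_inverse_D summable_mult summable_geometric) simp
  also have "\<dots> = 2 / real (D (Suc n))"
    by (subst suminf_mult) (auto simp: suminf_geometric)
  finally show ?thesis .
qed

lemma tail_Suc: "liouville_tail D n = 1 / real (D (Suc n)) + liouville_tail D (Suc n)"
  unfolding liouville_tail_def using suminf_split_head[OF summable_inverse_D[of "Suc n"]] by simp

text \<open>Passing from \<open>D n\<close> to \<open>D (Suc n)\<close> multiplies the numerator by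
  an even number and adds the 1 of the new term. An odd numerator is coprime to every power of two,
  which later gives full orbits of the periodic approximations.\<close>

lemma liouville_approx: "\<exists>p::int. odd p \<and> real (D n) * liouville D = of_int p + real (D n) * liouville_tail D n"
proof (induction n)
  case 0
  have "liouville D = 1 + liouville_tail D 0"
    unfolding liouville_def liouville_tail_def
    using suminf_split_head[OF summable_inverse_D[of 0]] by (simp add: D_0)
  then show ?case by (intro exI[of _ 1]) (simp add: D_0)
next
  case (Suc n)
  then obtain p :: int where p: "odd p" "real (D n) * liouville D = of_int p + real (D n) * liouville_tail D n"
    by blast
  obtain k where k: "D (Suc n) = 2 * D n * k"
    using D_dvd[of n] by (auto simp: dvd_def)
  have "k > 0" using D_pos[of "Suc n"] k by (cases k) auto
  have "real (D (Suc n)) * liouville D = 2 * real k * (real (D n) * liouville D)"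
    by (simp add: k)
  also have "\<dots> = 2 * real k * of_int p + real (D (Suc n)) * liouville_tail D n"
    unfolding p(2) by (simp add: k algebra_simps)
  also have "real (D (Suc n)) * liouville_tail D n = 1 + real (D (Suc n)) * liouville_tail D (Suc n)"
    unfolding tail_Suc[of n] using D_pos[of "Suc n"] by (simp add: algebra_simps)
  finally have "real (D (Suc n)) * liouville D =
      of_int (2 * int k * p + 1) + real (D (Suc n)) * liouville_tail D (Suc n)"
    by simp
  then show ?case by (intro exI[of _ "2 * int k * p + 1"]) simp
qed

lemma multiple_approx:
  obtains p :: int where "odd p"
    "\<And>i. real i * liouville D = of_int (int i * p) / real (D n) + real i * liouville_tail D n"
proof -
  obtain p :: int where p: "odd p" "real (D n) * liouville D = of_int p + real (D n) * liouville_tail D n"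
    using liouville_approx by blast
  then have "liouville D = of_int p / real (D n) + liouville_tail D n"
    using D_pos[of n] by (simp add: field_simps)
  then have "real i * liouville D = of_int (int i * p) / real (D n) + real i * liouville_tail D n" for i
    by (simp add: algebra_simps)
  then show thesis using that p(1) by blast
qed

end

section \<open>The transfer functions\<close>

text \<open>A trapezoid of slope 4: zero up to distance 1/8 from the ends of the unit interval, 1/2
  on its middle half. The zero part makes a starting point just after a cell boundary read 0; the
  plateau keeps a set bit readable for half of the time.\<close>

definition bump :: "real \<Rightarrow> real" where
  "bump t = max 0 (min (1/2) (4 * min t (1 - t) - 1/2))"

lemma bump_bounds: "0 \<le> bump t" "bump t \<le> 1/2" "bump t \<le> 4 * \<bar>t\<bar>" "bump t \<le> 4 * \<bar>1 - t\<bar>"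
  by (auto simp: bump_def min_def max_def)

lemma bump_lipschitz: "\<bar>bump t - bump s\<bar> \<le> 4 * \<bar>t - s\<bar>"
proof -
  have "\<bar>max 0 (min (1/2) a) - max 0 (min (1/2) b)\<bar> \<le> \<bar>a - b\<bar>" for a b :: real
    by (auto simp: max_def min_def)
  then have "\<bar>bump t - bump s\<bar> \<le> \<bar>(4 * min t (1 - t) - 1/2) - (4 * min s (1 - s) - 1/2)\<bar>"
    unfolding bump_def .
  also have "\<dots> \<le> 4 * \<bar>t - s\<bar>"
    by (auto simp: min_def abs_if)
  finally show ?thesis .
qed

lemma bump_zero: "0 \<le> t \<Longrightarrow> t \<le> 1/8 \<Longrightarrow> bump t = 0"
  by (auto simp: bump_def min_def max_def)

lemma bump_plateau: "1/4 \<le> t \<Longrightarrow> t \<le> 3/4 \<Longrightarrow> bump t = 1/2"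
  by (auto simp: bump_def min_def max_def)

definition bump_word :: "nat \<Rightarrow> (nat \<Rightarrow> bool) \<Rightarrow> real \<Rightarrow> real" where
  "bump_word N w s = (if w (nat (\<lfloor>s\<rfloor> mod int N)) then bump (frac s) else 0)"

lemma bump_word_bounds: "0 \<le> bump_word N w s" "bump_word N w s \<le> 1/2"
  "bump_word N w s \<le> 4 * frac s" "bump_word N w s \<le> 4 * (1 - frac s)"
  using bump_bounds[of "frac s"] frac_ge_0[of s] frac_lt_1[of s]
  by (auto simp: bump_word_def)

text \<open>A bump vanishes at both ends of its cell, so points in different cells are compared
  through the boundary between them, and the constant does not depend on the word.\<close>

lemma bump_word_lipschitz: "\<bar>bump_word N w s - bump_word N w t\<bar> \<le> 4 * \<bar>s - t\<bar>"
proof -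
  have *: "\<bar>bump_word N w s - bump_word N w t\<bar> \<le> 4 * (t - s)" if "s \<le> t" for s t
  proof (cases "\<lfloor>s\<rfloor> = \<lfloor>t\<rfloor>")
    case True
    then have "\<bar>frac s - frac t\<bar> = t - s" using that by (simp add: frac_def)
    then show ?thesis
      using True bump_lipschitz[of "frac s" "frac t"] that by (auto simp: bump_word_def)
  next
    case False
    then have "\<lfloor>s\<rfloor> + 1 \<le> \<lfloor>t\<rfloor>"
      using floor_mono[OF that] by simp
    then have fl: "real_of_int \<lfloor>s\<rfloor> + 1 \<le> real_of_int \<lfloor>t\<rfloor>"
      by (metis of_int_1 of_int_add of_int_le_iff)
    have "1 - frac s \<le> t - s"
      unfolding frac_def using fl of_int_floor_le[of t] by linarith
    then have "bump_word N w s \<le> 4 * (t - s)"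
      using bump_word_bounds(4)[of N w s] by (meson mult_left_mono order_trans zero_le_numeral)
    moreover have "frac t \<le> t - s"
      unfolding frac_def using fl real_of_int_floor_add_one_gt[of s] by linarith
    then have "bump_word N w t \<le> 4 * (t - s)"
      using bump_word_bounds(3)[of N w t] by (meson mult_left_mono order_trans zero_le_numeral)
    ultimately show ?thesis
      using bump_word_bounds(1)[of N w s] bump_word_bounds(1)[of N w t] by (simp add: abs_le_iff)
  qed
  show ?thesis
    using *[of s t] *[of t s] by (cases "s \<le> t") auto
qed

lemma bump_word_periodic: "bump_word N w (s + of_int k * real N) = bump_word N w s"
proof -
  have e: "s + of_int k * real N = s + of_int (k * int N)" by simp
  have "\<lfloor>s + of_int (k * int N)\<rfloor> = \<lfloor>s\<rfloor> + k * int N" by (rule floor_add_int[symmetric])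
  then show ?thesis
    unfolding bump_word_def e frac_add_of_int by simp
qed

section \<open>The construction\<close>

text \<open>Powers of two let oddness replace coprimality. In \<open>B_ge\<close> one factor
  \<open>2 ^ n\<close> pays for the return time \<open>2 ^ n * Q n\<close>, the other makes the
  errors over that time decay like \<open>(1/2) ^ n\<close>; 1024 is numerical slack.\<close>

locale stages =
  fixes Q B R :: "nat \<Rightarrow> nat" and w :: "nat \<Rightarrow> nat \<Rightarrow> bool"
  assumes Q_0: "Q 0 = 1" and Q_Suc: "Q (Suc n) = Q n * B n * R n"
    and B_power: "\<exists>k. B n = 2 ^ k" and R_power: "\<exists>k. R n = 2 ^ k"
    and B_ge: "1024 * 4 ^ n * Q n \<le> B n"
begin

text \<open>The near-return time of stage \<open>n\<close>: \<open>Q n\<close> steps close up the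
  base of the periodic approximation, and \<open>2 ^ n\<close> such rounds close up the
  fibre.\<close>

definition P :: "nat \<Rightarrow> nat" where "P n = 2 ^ n * Q n"

lemma Q_power: "\<exists>k. Q n = 2 ^ k"
proof (induction n)
  case (Suc n)
  then show ?case
    using B_power[of n] R_power[of n] by (metis Q_Suc power_add)
qed (simp add: Q_0 exI[of _ 0])

lemma Q_pos: "0 < Q n" using Q_power[of n] by auto
lemma B_pos: "0 < B n" using B_power[of n] by auto
lemma R_pos: "0 < R n" using R_power[of n] by auto

lemma B_ge': "1024 * 4 ^ n * real (Q n) \<le> real (B n)"
  using of_nat_mono[OF B_ge[of n], where 'a = real] by simp

lemma B_ge_1024: "1024 \<le> B n"
proof -
  have "1 \<le> 4 ^ n * Q n"
    using Q_pos[of n] by (simp add: Suc_le_eq)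
  then show ?thesis using B_ge[of n] by linarith
qed

text \<open>Makes one quarter and eleven sixteenths of \<open>B n\<close> integers; between these
  times a bit is read.\<close>

lemma sixteen_dvd_B: "16 dvd B n"
proof -
  obtain k where k: "B n = 2 ^ k" using B_power by blast
  have "\<not> k < 4"
  proof
    assume "k < 4"
    then have "(2::nat) ^ k \<le> 2 ^ 4" by (intro power_increasing) auto
    then show False using B_ge_1024[of n] k by simp
  qed
  then have "(2::nat) ^ 4 dvd 2 ^ k" by (intro le_imp_power_dvd) simp
  then show ?thesis using k by simp
qed

sublocale Qc: divisor_chain Q
proof
  show "2 * Q n dvd Q (Suc n)" for n
    using sixteen_dvd_B[of n] by (auto simp: Q_Suc dvd_def)
qed (auto simp: Q_0 Q_pos)

sublocale Pc: divisor_chain P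
proof
  show "2 * P n dvd P (Suc n)" for n
    using sixteen_dvd_B[of n] by (auto simp: Q_Suc P_def dvd_def)
qed (auto simp: Q_0 P_def Q_pos)

lemma B_double: "2 * B n \<le> B (Suc n)"
proof -
  have "(2::nat) \<le> 1024 * 4 ^ Suc n" "1 \<le> Q n * R n"
    using one_le_power[of "4::nat" "Suc n"] Q_pos[of n] R_pos[of n] by (simp_all add: Suc_le_eq)
  then have "2 * B n * 1 \<le> 1024 * 4 ^ Suc n * B n * (Q n * R n)"
    by (intro mult_le_mono) auto
  also have "\<dots> = 1024 * 4 ^ Suc n * Q (Suc n)"
    by (simp add: Q_Suc)
  also have "\<dots> \<le> B (Suc n)" by (rule B_ge)
  finally show ?thesis by simp
qed

lemma B_growth: "B n * 2 ^ i \<le> B (n + i)"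
proof (induction i)
  case (Suc i)
  then show ?case using B_double[of "n + i"] by simp
qed simp

lemma inverse_B_le: "1 / real (B (n + i)) \<le> (1 / real (B n)) * (1/2) ^ i"
proof -
  have "real (B n) * 2 ^ i \<le> real (B (n + i))"
    using of_nat_mono[OF B_growth[of n i], where 'a = real] by simp
  then have "1 / real (B (n + i)) \<le> 1 / (real (B n) * 2 ^ i)"
    using B_pos by (intro divide_left_mono) auto
  then show ?thesis by (simp add: field_simps power_divide)
qed

definition alpha :: real where "alpha = liouville Q"
definition beta :: real where "beta = liouville P"

definition g :: "nat \<Rightarrow> real \<Rightarrow> real" where
  "g n x = bump_word (R n) (w n) (real (R n * Q n) * x)"

text \<open>\<open>g n\<close> has period \<open>1 / Q n\<close>, so shifts by multiples of it are
  free; the slope is the 4 of the bump times the \<open>R n * Q n\<close> letters per unit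
  length.\<close>

lemma g_near:
  assumes "\<bar>x - x' - of_int k / real (Q n)\<bar> \<le> d"
  shows "\<bar>g n x - g n x'\<bar> \<le> 4 * real (R n * Q n) * d"
proof -
  let ?c = "real (R n * Q n)"
  have "g n x = bump_word (R n) (w n) (?c * x + of_int (- k) * real (R n))"
    unfolding g_def by (rule bump_word_periodic[symmetric])
  then have "\<bar>g n x - g n x'\<bar> \<le> 4 * \<bar>(?c * x + of_int (- k) * real (R n)) - ?c * x'\<bar>"
    using bump_word_lipschitz by (simp add: g_def)
  also have "(?c * x + of_int (- k) * real (R n)) - ?c * x' = ?c * (x - x' - of_int k / real (Q n))"
    using Q_pos[of n] by (simp add: field_simps)
  also have "4 * \<bar>?c * (x - x' - of_int k / real (Q n))\<bar> \<le> 4 * ?c * d"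
    using assms by (simp add: abs_mult mult_left_mono)
  finally show ?thesis .
qed

lemma g_circle_near: "circle_near d x x' \<Longrightarrow> \<bar>g n x - g n x'\<bar> \<le> 4 * real (R n * Q n) * d"
proof -
  assume "circle_near d x x'"
  then obtain k :: int where "\<bar>x - x' - k\<bar> \<le> d" by (auto simp: circle_near_def)
  then have "\<bar>x - x' - of_int (k * int (Q n)) / real (Q n)\<bar> \<le> d"
    using Q_pos[of n] by simp
  then show ?thesis by (rule g_near)
qed

lemma tail_Q_le: "liouville_tail Q n \<le> 2 / (real (Q n) * real (B n) * real (R n))"
  using Qc.tail_le[of n] by (simp add: Q_Suc)

text \<open>Up to \<open>i * liouville_tail Q n\<close> the displacement is a multiple of the
  period. This remainder is at most \<open>2 * i / (Q n * B n * R n)\<close> and meets the slope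
  \<open>4 * R n * Q n\<close>; so stage \<open>n\<close> is invisible while \<open>i\<close> is
  much smaller than \<open>B n\<close>.\<close>

lemma g_increment: "\<bar>g n (x + real i * alpha) - g n x\<bar> \<le> 8 * real i / real (B n)"
proof -
  obtain p :: int where p: "\<And>i. real i * alpha = of_int (int i * p) / real (Q n) + real i * liouville_tail Q n"
    using Qc.multiple_approx[of n] unfolding alpha_def by metis
  have "x + real i * alpha - x - of_int (int i * p) / real (Q n) = real i * liouville_tail Q n"
    by (simp add: p)
  then have "\<bar>x + real i * alpha - x - of_int (int i * p) / real (Q n)\<bar> \<le> real i * liouville_tail Q n"
    using Qc.tail_nonneg[of n] by simp
  then have "\<bar>g n (x + real i * alpha) - g n x\<bar> \<le> 4 * real (R n * Q n) * (real i * liouville_tail Q n)"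
    by (rule g_near)
  also have "\<dots> \<le> 4 * real (R n * Q n) * (real i * (2 / (real (Q n) * real (B n) * real (R n))))"
    using tail_Q_le by (intro mult_left_mono) auto
  also have "\<dots> = 8 * real i / real (B n)"
    using Q_pos[of n] R_pos[of n] by simp
  finally show ?thesis .
qed

lemma summable_inverse_B: "summable (\<lambda>j. c / real (B (n + j)))"
proof -
  have "summable (\<lambda>j. 1 / real (B (n + j)))"
  proof (rule summable_comparison_test')
    show "summable (\<lambda>i. (1 / real (B n)) * (1/2) ^ i)"
      by (intro summable_mult summable_geometric) simp
    show "norm (1 / real (B (n + i))) \<le> (1 / real (B n)) * (1/2) ^ i" if "i \<ge> 0" for i
      using inverse_B_le[of n i] by simp
  qed
  from summable_mult[OF this, of c] show ?thesis by simp
qed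

lemma suminf_inverse_B: "0 \<le> c \<Longrightarrow> (\<Sum>j. c / real (B (n + j))) \<le> 2 * c / real (B n)"
proof -
  assume c: "0 \<le> c"
  have "(\<Sum>j. c / real (B (n + j))) \<le> (\<Sum>j. (c / real (B n)) * (1/2) ^ j)"
  proof (intro suminf_le summable_inverse_B summable_mult summable_geometric)
    show "c / real (B (n + j)) \<le> c / real (B n) * (1 / 2) ^ j" for j
      using mult_left_mono[OF inverse_B_le[of n j] c] by simp
  qed simp
  also have "\<dots> = 2 * c / real (B n)"
    by (subst suminf_mult) (auto simp: suminf_geometric)
  finally show ?thesis .
qed

text \<open>The \<open>i\<close>-th ergodic sum of the cocycle \<open>Phi 1\<close>, with each stage
  already telescoped; \<open>Phi_cocycle\<close> confirms this.\<close>

definition Phi :: "nat \<Rightarrow> real \<Rightarrow> real" where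
  "Phi i x = (\<Sum>n. g n (x + real i * alpha) - g n x)"

lemma summable_Phi: "summable (\<lambda>j. g (n + j) (x + real i * alpha) - g (n + j) x)"
  by (rule summable_comparison_test'[OF summable_inverse_B[of "8 * real i" n], of 0])
    (simp add: g_increment)

definition hsum :: "nat \<Rightarrow> real \<Rightarrow> real" where
  "hsum n x = (\<Sum>j<n. g j x)"

text \<open>The stages below \<open>n\<close> form a genuine coboundary, that of
  \<open>hsum n\<close>; the increments of the later ones are dominated by a geometric
  series.\<close>

lemma Phi_split: "\<bar>Phi i x - (hsum n (x + real i * alpha) - hsum n x)\<bar> \<le> 16 * real i / real (B n)"
proof -
  let ?f = "\<lambda>n. g n (x + real i * alpha) - g n x"
  have "Phi i x = (\<Sum>j. ?f (n + j)) + (\<Sum>j<n. ?f j)"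
    unfolding Phi_def using suminf_split_initial_segment[OF summable_Phi[of 0 x i], of n]
    by (simp add: add.commute)
  then have eq: "Phi i x - (hsum n (x + real i * alpha) - hsum n x) = (\<Sum>j. ?f (n + j))"
    by (simp add: hsum_def sum_subtractf)
  have "\<bar>\<Sum>j. ?f (n + j)\<bar> \<le> (\<Sum>j. 8 * real i / real (B (n + j)))"
  proof -
    have s: "summable (\<lambda>j. \<bar>?f (n + j)\<bar>)"
      by (rule summable_comparison_test'[OF summable_inverse_B[of "8 * real i" n], of 0])
        (simp add: g_increment)
    have "\<bar>\<Sum>j. ?f (n + j)\<bar> \<le> (\<Sum>j. \<bar>?f (n + j)\<bar>)"
      by (rule summable_rabs[OF s])
    also have "\<dots> \<le> (\<Sum>j. 8 * real i / real (B (n + j)))"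
      by (intro suminf_le g_increment s summable_inverse_B)
    finally show ?thesis .
  qed
  also have "\<dots> \<le> 16 * real i / real (B n)"
    using suminf_inverse_B[of "8 * real i" n] by simp
  finally show ?thesis unfolding eq .
qed

text \<open>Each stage multiplies \<open>Q\<close> by \<open>B n * R n\<close> with
  \<open>B n\<close> at least 1024, so the accumulated slopes are a small fraction of
  \<open>Q n\<close>: \<open>hsum n\<close> varies by at most 1/128 over a length
  \<open>1 / Q n\<close>.\<close>

lemma lip_sum: "(\<Sum>j<n. 4 * real (R j * Q j)) \<le> real (Q n) / 128"
proof (induction n)
  case (Suc n)
  have b: "1024 \<le> real (B n)" using B_ge_1024[of n] by simp
  have r: "1 \<le> real (R n)" using R_pos[of n] by simp
  have "(\<Sum>j<Suc n. 4 * real (R j * Q j)) \<le> real (Q n) * 1 / 128 + 4 * real (R n * Q n)"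
    using Suc by simp
  also have "\<dots> \<le> real (Q n) * real (R n) / 128 + 4 * real (R n * Q n)"
    using r by (intro add_right_mono divide_right_mono mult_left_mono) auto
  also have "\<dots> = (real (Q n) * real (R n)) * (513/128)"
    by simp
  also have "\<dots> \<le> (real (Q n) * real (R n)) * (real (B n) / 128)"
    using b by (intro mult_left_mono) auto
  also have "\<dots> = real (Q (Suc n)) / 128"
    by (simp add: Q_Suc)
  finally show ?case .
qed simp

lemma hsum_near: "circle_near d x x' \<Longrightarrow> \<bar>hsum n x - hsum n x'\<bar> \<le> real (Q n) / 128 * d"
proof -
  assume near: "circle_near d x x'"
  then have d: "0 \<le> d" by (auto simp: circle_near_def intro: order_trans[OF abs_ge_zero])
  have "\<bar>hsum n x - hsum n x'\<bar> = \<bar>\<Sum>j<n. g j x - g j x'\<bar>"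
    by (simp add: hsum_def sum_subtractf)
  also have "\<dots> \<le> (\<Sum>j<n. \<bar>g j x - g j x'\<bar>)"
    by (rule sum_abs)
  also have "\<dots> \<le> (\<Sum>j<n. 4 * real (R j * Q j) * d)"
    by (intro sum_mono g_circle_near near)
  also have "\<dots> \<le> real (Q n) / 128 * d"
    unfolding sum_distrib_right[symmetric] using lip_sum d by (intro mult_right_mono)
  finally show ?thesis .
qed

lemma g_add_int: "g n (x + of_int k) = g n x"
proof -
  have "circle_near 0 (x + of_int k) x"
    by (rule circle_nearI[of _ _ k]) simp
  from g_circle_near[OF this, of n] show ?thesis by simp
qed

lemma Phi_frac: "Phi i (frac x) = Phi i x"
proof -
  have "g n (x + real i * alpha) = g n (frac x + real i * alpha)" "g n x = g n (frac x)" for n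
    using g_add_int[of n "frac x + real i * alpha" "\<lfloor>x\<rfloor>"] g_add_int[of n "frac x" "\<lfloor>x\<rfloor>"]
    by (simp_all add: frac_def algebra_simps)
  then show ?thesis by (simp add: Phi_def)
qed

lemma Phi_cocycle: "Phi (Suc i) x = Phi i x + Phi 1 (x + real i * alpha)"
proof -
  have "Phi i x + Phi 1 (x + real i * alpha) =
      (\<Sum>n. (g n (x + real i * alpha) - g n x) +
        (g n (x + real i * alpha + real 1 * alpha) - g n (x + real i * alpha)))"
    unfolding Phi_def
    by (rule suminf_add[OF summable_Phi[of 0, unfolded add_0] summable_Phi[of 0, unfolded add_0]])
  also have "\<dots> = Phi (Suc i) x"
    unfolding Phi_def by (intro suminf_cong) (simp add: algebra_simps)
  finally show ?thesis ..
qed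

lemma g_measurable [measurable]: "g n \<in> borel_measurable borel"
  unfolding g_def bump_word_def bump_def frac_def by measurable

lemma Phi_measurable [measurable]: "Phi i \<in> borel_measurable borel"
  unfolding Phi_def by measurable

definition T :: "real \<times> real \<Rightarrow> real \<times> real" where
  "T = skew_product alpha (\<lambda>x. beta + Phi 1 x)"

lemma T_iso: "measure_iso torus_measure torus_measure T"
  unfolding T_def by (rule measure_iso_skew_product) measurable

lemma T_pow:
  assumes "z \<in> torus"
  shows "(T ^^ i) z = (frac (fst z + real i * alpha), frac (snd z + real i * beta + Phi i (fst z)))"
proof (induction i)
  case 0
  have "Phi 0 x = 0" for x by (simp add: Phi_def)
  then show ?case using assms by (auto simp: torus_def frac_eq)
next
  case (Suc i)
  define a b where "a = fst z + real i * alpha" and "b = snd z + real i * beta + Phi i (fst z)"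
  have "(T ^^ Suc i) z = T (frac a, frac b)"
    by (simp add: Suc a_def b_def)
  also have "\<dots> = (frac (frac a + alpha), frac (frac b + (beta + Phi 1 (frac a))))"
    by (simp add: T_def skew_product_def)
  also have "\<dots> = (frac (a + alpha), frac (b + (beta + Phi 1 a)))"
    by (simp only: frac_frac_add Phi_frac)
  also have "a + alpha = fst z + real (Suc i) * alpha"
    by (simp add: a_def distrib_right)
  also have "b + (beta + Phi 1 a) = snd z + real (Suc i) * beta + Phi (Suc i) (fst z)"
    unfolding Phi_cocycle a_def b_def by (simp add: distrib_right)
  finally show ?case .
qed

lemma mp_system_T: "mp_system torus_measure T"
proof (rule mp_system.intro[OF prob_space_torus_measure])
  have "T \<in> measurable torus_measure torus_measure" "distr torus_measure torus_measure T = torus_measure"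
    using T_iso unfolding measure_iso_def by blast+
  then show "mp_system_axioms torus_measure T"
    by (rule mp_system_axioms.intro)
qed

end

section \<open>Rigidity\<close>

lemma norm_sum3_square_le:
  fixes a b c :: complex
  shows "(cmod (a + b + c))\<^sup>2 \<le> 3 * ((cmod a)\<^sup>2 + (cmod b)\<^sup>2 + (cmod c)\<^sup>2)"
proof -
  have "cmod (a + b + c) \<le> cmod a + cmod b + cmod c"
    by (intro order_trans[OF norm_triangle_ineq] add_right_mono norm_triangle_ineq)
  then have "(cmod (a + b + c))\<^sup>2 \<le> (cmod a + cmod b + cmod c)\<^sup>2"
    by (intro power_mono) auto
  also have "\<dots> \<le> 3 * ((cmod a)\<^sup>2 + (cmod b)\<^sup>2 + (cmod c)\<^sup>2)"
  proof -
    have "0 \<le> (x - y)\<^sup>2 + (y - z)\<^sup>2 + (x - z)\<^sup>2" for x y z :: real by simp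
    then have "(x + y + z)\<^sup>2 \<le> 3 * (x\<^sup>2 + y\<^sup>2 + z\<^sup>2)" for x y z :: real
      by (simp add: power2_eq_square algebra_simps)
    then show ?thesis .
  qed
  finally show ?thesis .
qed

text \<open>As \<open>T\<close> preserves the norm, a simple function approximates \<open>f\<close>
  and its iterated composition with \<open>T\<close> equally well, uniformly in \<open>n\<close>;
  and a simple function changes only where a point leaves its level set.\<close>

lemma (in mp_system) rigid_limit:
  assumes sets_conv: "\<And>A. A \<in> sets M \<Longrightarrow>
      (\<lambda>n. measure M {z \<in> space M. ((T ^^ t n) z \<in> A) \<noteq> (z \<in> A)}) \<longlonglongrightarrow> 0"
    and f: "square_integrable M f"
  shows "(\<lambda>n. \<integral>x. (cmod (f ((T ^^ t n) x) - f x))\<^sup>2 \<partial>M) \<longlonglongrightarrow> 0"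
proof -
  have fm [measurable]: "f \<in> borel_measurable M" and fi: "integrable M (\<lambda>x. (cmod (f x))\<^sup>2)"
    using f by (auto simp: square_integrable_def)
  obtain F where F0: "(\<forall>i. simple_function M (F i)) \<and> (\<forall>x\<in>space M. (\<lambda>i. F i x) \<longlonglongrightarrow> f x) \<and>
      (\<forall>i. \<forall>x\<in>space M. dist (F i x) 0 \<le> 2 * dist (f x) 0)"
    using borel_measurable_implies_sequence_metric[OF fm, of 0] by (elim exE)
  note F = F0[THEN conjunct1, rule_format] F0[THEN conjunct2, THEN conjunct1, rule_format]
    F0[THEN conjunct2, THEN conjunct2, rule_format]
  have Fm [measurable]: "F i \<in> borel_measurable M" for i
    using F(1) by (rule borel_measurable_simple_function)
  have dom: "(cmod (F i x - f x))\<^sup>2 \<le> 9 * (cmod (f x))\<^sup>2" if "x \<in> space M" for i x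
  proof -
    have "cmod (F i x - f x) \<le> 3 * cmod (f x)"
      using F(3)[OF that, of i] norm_triangle_ineq4[of "F i x" "f x"] by simp
    then have "(cmod (F i x - f x))\<^sup>2 \<le> (3 * cmod (f x))\<^sup>2"
      by (intro power_mono) auto
    then show ?thesis by (simp add: power_mult_distrib)
  qed
  have int_diff: "integrable M (\<lambda>x. (cmod (F i x - f x))\<^sup>2)" for i
    by (rule Bochner_Integration.integrable_bound[of M "\<lambda>x. 9 * (cmod (f x))\<^sup>2"])
      (use fi dom in auto)
  have "(\<lambda>i. \<integral>x. (cmod (F i x - f x))\<^sup>2 \<partial>M) \<longlonglongrightarrow> (\<integral>x. 0 \<partial>M)"
  proof (rule integral_dominated_convergence[where w = "\<lambda>x. 9 * (cmod (f x))\<^sup>2"])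
    show "AE x in M. (\<lambda>i. (cmod (F i x - f x))\<^sup>2) \<longlonglongrightarrow> 0"
    proof (rule AE_I2)
      fix x assume "x \<in> space M"
      then have "(\<lambda>i. (cmod (F i x - f x))\<^sup>2) \<longlonglongrightarrow> (cmod (f x - f x))\<^sup>2"
        using F(2) by (intro tendsto_intros)
      then show "(\<lambda>i. (cmod (F i x - f x))\<^sup>2) \<longlonglongrightarrow> 0" by simp
    qed
  qed (use fi dom in auto)
  then have conv: "(\<lambda>i. \<integral>x. (cmod (F i x - f x))\<^sup>2 \<partial>M) \<longlonglongrightarrow> 0" by simp
  show ?thesis
  proof (rule LIMSEQ_I)
    fix r :: real assume r: "0 < r"
    \<comment> \<open>With the constant 3 of \<open>norm_sum3_square_le\<close> the budget is
      \<open>3 * (r / 12 + r / 6 + r / 12) = r\<close>.\<close>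
    obtain i where i: "(\<integral>x. (cmod (F i x - f x))\<^sup>2 \<partial>M) < r / 12"
      using LIMSEQ_D[OF conv, of "r / 12"] r by auto
    define s where "s = F i"
    have s: "simple_function M s" and [measurable]: "s \<in> borel_measurable M"
      using F(1) Fm by (auto simp: s_def)
    have fin: "finite (s ` space M)"
      using s by (rule simple_functionD)
    define C where "C = Max (insert 0 (cmod ` s ` space M))"
    have C: "cmod (s x) \<le> C" if "x \<in> space M" for x
      unfolding C_def using fin that by (intro Max_ge) auto
    have C0: "0 \<le> C" unfolding C_def using fin by (intro Max_ge) auto
    define A where "A v = s -` {v} \<inter> space M" for v
    have A: "A v \<in> sets M" for v
      unfolding A_def using s by (rule simple_functionD)
    define D where "D v n = {z \<in> space M. ((T ^^ t n) z \<in> A v) \<noteq> (z \<in> A v)}" for v n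
    have D: "D v n \<in> sets M" for v n
      unfolding D_def using A by measurable
    have sbound: "(\<integral>x. (cmod (s ((T ^^ t n) x) - s x))\<^sup>2 \<partial>M) \<le>
        (2 * C)\<^sup>2 * (\<Sum>v\<in>s ` space M. measure M (D v n))" for n
    proof -
      have i1: "integrable M (\<lambda>x. indicator (D v n) x :: real)" for v
        using D by (intro integrable_real_indicator) (auto simp: emeasure_eq_measure)
      have bnd: "(cmod (s ((T ^^ t n) x) - s x))\<^sup>2 \<le> (2 * C)\<^sup>2 * (\<Sum>v\<in>s ` space M. indicator (D v n) x)"
        if x: "x \<in> space M" for x
      proof (cases "s ((T ^^ t n) x) = s x")
        case True
        then show ?thesis by (simp add: sum_nonneg)
      next
        case False
        have "cmod (s ((T ^^ t n) x) - s x) \<le> 2 * C"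
          using C[OF x] C[OF T_pow_space[OF x]] norm_triangle_ineq4[of "s ((T ^^ t n) x)" "s x"]
          by (smt (verit, best))
        then have "(cmod (s ((T ^^ t n) x) - s x))\<^sup>2 \<le> (2 * C)\<^sup>2 * 1"
          by (metis mult.right_neutral norm_ge_zero power_mono)
        also have "\<dots> \<le> (2 * C)\<^sup>2 * (\<Sum>v\<in>s ` space M. indicator (D v n) x)"
        proof (intro mult_left_mono)
          \<comment> \<open>If the value changes, \<open>x\<close> has left its own level set, which
            is one of those in the sum.\<close>
          have "(1::real) = indicator (D (s x) n) x"
            using x False T_pow_space[OF x] by (auto simp: D_def A_def)
          also have "\<dots> \<le> (\<Sum>v\<in>s ` space M. indicator (D v n) x)"
            using fin x by (intro member_le_sum) auto
          finally show "1 \<le> (\<Sum>v\<in>s ` space M. indicator (D v n) x :: real)" .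
        qed simp
        finally show ?thesis .
      qed
      have "(\<integral>x. (cmod (s ((T ^^ t n) x) - s x))\<^sup>2 \<partial>M) \<le>
          (\<integral>x. (2 * C)\<^sup>2 * (\<Sum>v\<in>s ` space M. indicator (D v n) x) \<partial>M)"
      proof (rule integral_mono')
        show "integrable M (\<lambda>x. (2 * C)\<^sup>2 * (\<Sum>v\<in>s ` space M. indicator (D v n) x) :: real)"
          using i1 by (intro integrable_mult_right Bochner_Integration.integrable_sum)
      qed (use bnd in \<open>auto intro!: sum_nonneg mult_nonneg_nonneg\<close>)
      also have "\<dots> = (2 * C)\<^sup>2 * (\<Sum>v\<in>s ` space M. measure M (D v n))"
        using i1 D by (simp add: Bochner_Integration.integral_sum)
      finally show ?thesis .
    qed
    have "(\<lambda>n. (2 * C)\<^sup>2 * (\<Sum>v\<in>s ` space M. measure M (D v n))) \<longlonglongrightarrow>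
        (2 * C)\<^sup>2 * (\<Sum>v\<in>s ` space M. 0)"
      unfolding D_def by (intro tendsto_intros sets_conv A)
    then have "(\<lambda>n. (2 * C)\<^sup>2 * (\<Sum>v\<in>s ` space M. measure M (D v n))) \<longlonglongrightarrow> 0" by simp
    then obtain N where N: "\<And>n. n \<ge> N \<Longrightarrow> norm ((2 * C)\<^sup>2 * (\<Sum>v\<in>s ` space M. measure M (D v n)) - 0) < r / 6"
      using LIMSEQ_D[of _ 0 "r / 6"] r by (meson zero_less_divide_iff zero_less_numeral)
    have "norm ((\<integral>x. (cmod (f ((T ^^ t n) x) - f x))\<^sup>2 \<partial>M) - 0) < r" if n: "n \<ge> N" for n
    proof -
      define d where "d x = (cmod (s x - f x))\<^sup>2" for x
      have di: "integrable M d" unfolding d_def s_def by (rule int_diff)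
      then have [measurable]: "d \<in> borel_measurable M" by auto
      have dTi: "integrable M (\<lambda>x. d ((T ^^ t n) x))"
      proof -
        have "integrable (distr M M (T ^^ t n)) d" using di by (simp add: T_pow_distr)
        then show ?thesis by (subst (asm) integrable_distr_eq) auto
      qed
      have dT: "(\<integral>x. d ((T ^^ t n) x) \<partial>M) = (\<integral>x. d x \<partial>M)"
        using integral_distr[of "T ^^ t n" M M d] by (simp add: T_pow_distr)
      have si: "integrable M (\<lambda>x. (cmod (s ((T ^^ t n) x) - s x))\<^sup>2)"
      proof (rule integrable_const_bound[where B = "(2 * C)\<^sup>2"])
        show "AE x in M. norm ((cmod (s ((T ^^ t n) x) - s x))\<^sup>2) \<le> (2 * C)\<^sup>2"
        proof (rule AE_I2)
          fix x assume x: "x \<in> space M"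
          have "cmod (s ((T ^^ t n) x) - s x) \<le> 2 * C"
            using C[OF x] C[OF T_pow_space[OF x]] norm_triangle_ineq4[of "s ((T ^^ t n) x)" "s x"]
            by (smt (verit, best))
          then have "(cmod (s ((T ^^ t n) x) - s x))\<^sup>2 \<le> (2 * C)\<^sup>2"
            by (intro power_mono) auto
          then show "norm ((cmod (s ((T ^^ t n) x) - s x))\<^sup>2) \<le> (2 * C)\<^sup>2"
            unfolding real_norm_def abs_of_nonneg[OF zero_le_power2] .
        qed
      qed measurable
      have "(\<integral>x. (cmod (f ((T ^^ t n) x) - f x))\<^sup>2 \<partial>M) \<le>
          (\<integral>x. 3 * (d ((T ^^ t n) x) + (cmod (s ((T ^^ t n) x) - s x))\<^sup>2 + d x) \<partial>M)"
      proof (rule integral_mono')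
        show "integrable M (\<lambda>x. 3 * (d ((T ^^ t n) x) + (cmod (s ((T ^^ t n) x) - s x))\<^sup>2 + d x))"
          by (intro integrable_mult_right Bochner_Integration.integrable_add dTi si di)
        fix x assume "x \<in> space M"
        have "(cmod (f ((T ^^ t n) x) - f x))\<^sup>2 =
            (cmod ((f ((T ^^ t n) x) - s ((T ^^ t n) x)) + (s ((T ^^ t n) x) - s x) + (s x - f x)))\<^sup>2"
          by simp
        also have "\<dots> \<le> 3 * (d ((T ^^ t n) x) + (cmod (s ((T ^^ t n) x) - s x))\<^sup>2 + d x)"
          unfolding d_def using norm_sum3_square_le
          by (metis norm_minus_commute)
        finally show "(cmod (f ((T ^^ t n) x) - f x))\<^sup>2 \<le>
          3 * (d ((T ^^ t n) x) + (cmod (s ((T ^^ t n) x) - s x))\<^sup>2 + d x)" .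
      qed (auto simp: d_def)
      also have "\<dots> = 3 * ((\<integral>x. d x \<partial>M) + (\<integral>x. (cmod (s ((T ^^ t n) x) - s x))\<^sup>2 \<partial>M) + (\<integral>x. d x \<partial>M))"
        using dTi si di by (simp add: dT)
      also have "\<dots> < 3 * (r / 12 + r / 6 + r / 12)"
      proof -
        have "(\<integral>x. d x \<partial>M) < r / 12" using i by (simp add: d_def s_def)
        moreover have "(\<integral>x. (cmod (s ((T ^^ t n) x) - s x))\<^sup>2 \<partial>M) < r / 6"
          using sbound[of n] N[OF n] by simp
        ultimately show ?thesis by simp
      qed
      finally show ?thesis using r by simp
    qed
    then show "\<exists>N. \<forall>n\<ge>N. norm ((\<integral>x. (cmod (f ((T ^^ t n) x) - f x))\<^sup>2 \<partial>M) - 0) < r"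
      by blast
  qed
qed

lemma abs_sum3_le:
  fixes a b c :: real
  shows "\<bar>a\<bar> \<le> r \<Longrightarrow> \<bar>b\<bar> \<le> s \<Longrightarrow> \<bar>c\<bar> \<le> t \<Longrightarrow> \<bar>a + b + c\<bar> \<le> r + s + t"
  by linarith

context stages
begin

sublocale mp: mp_system torus_measure T
  by (rule mp_system_T)

lemma scale_bound: "real (P n) / real (B n) \<le> (1/2) ^ n / 1024"
proof -
  have "real (P n) * (1024 * 2 ^ n) = 1024 * (2 ^ n * 2 ^ n) * real (Q n)"
    by (simp add: P_def)
  also have "(2::real) ^ n * 2 ^ n = 4 ^ n"
    by (simp flip: power_mult_distrib)
  also have "1024 * 4 ^ n * real (Q n) \<le> real (B n)"
    by (rule B_ge')
  finally have "real (P n) * (1024 * 2 ^ n) \<le> real (B n)" .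
  then show ?thesis
    using B_pos[of n] by (simp add: field_simps power_divide)
qed

text \<open>Everything reduces to \<open>P n / B n\<close>, which is at most
  \<open>(1/2) ^ n / 1024\<close>. The first bound carries an extra \<open>Q n\<close> because
  \<open>hsum n\<close> may have a slope of that order.\<close>

lemma drift_bounds:
  assumes "i \<le> P n"
  shows "real (Q n) * (real i * liouville_tail Q n) \<le> (1/2) ^ n / 400"
    and "real i * liouville_tail Q n \<le> (1/2) ^ n / 400"
    and "real i * liouville_tail P n \<le> (1/2) ^ n / 400"
    and "16 * real i / real (B n) \<le> (1/2) ^ n / 64"
proof -
  have i: "real i \<le> real (P n)" using assms by simp
  have BR: "real (B n) \<le> real (B n) * real (R n)"
    using R_pos[of n] mult_left_mono[of 1 "real (R n)" "real (B n)"] by (simp add: Suc_le_eq)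
  have "real (Q n) * (real i * liouville_tail Q n) \<le>
      real (Q n) * (real (P n) * (2 / (real (Q n) * real (B n) * real (R n))))"
    using i tail_Q_le by (intro mult_left_mono mult_mono) (auto simp: Qc.tail_nonneg)
  also have "\<dots> = 2 * (real (P n) / (real (B n) * real (R n)))"
    using Q_pos[of n] by simp
  also have "\<dots> \<le> 2 * (real (P n) / real (B n))"
    using BR B_pos[of n] by (intro mult_left_mono divide_left_mono) auto
  also have "\<dots> \<le> (1/2) ^ n / 400"
    using scale_bound[of n] zero_le_power[of "1/2 :: real" n] by linarith
  finally show 1: "real (Q n) * (real i * liouville_tail Q n) \<le> (1/2) ^ n / 400" .
  have "1 * (real i * liouville_tail Q n) \<le> real (Q n) * (real i * liouville_tail Q n)"
    using Q_pos[of n] Qc.tail_nonneg[of n] by (intro mult_right_mono) (auto simp: Suc_le_eq)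
  then show "real i * liouville_tail Q n \<le> (1/2) ^ n / 400"
    using 1 by simp
  have "real i * liouville_tail P n \<le> real (P n) * (2 / real (P (Suc n)))"
    using i Pc.tail_le Pc.tail_nonneg by (intro mult_mono) auto
  also have "\<dots> = 1 / (real (B n) * real (R n))"
    using Q_pos[of n] by (simp add: P_def Q_Suc)
  also have "\<dots> \<le> real (P n) / real (B n)"
    using BR B_pos[of n] R_pos[of n] Pc.D_pos[of n] by (intro frac_le) (auto simp: Suc_le_eq)
  also have "\<dots> \<le> (1/2) ^ n / 400"
    using scale_bound[of n] by (rule order_trans) simp
  finally show "real i * liouville_tail P n \<le> (1/2) ^ n / 400" .
  have "16 * real i / real (B n) \<le> 16 * (real (P n) / real (B n))"
    using i by (simp add: divide_right_mono)
  then show "16 * real i / real (B n) \<le> (1/2) ^ n / 64"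
    using scale_bound[of n] by linarith
qed

text \<open>Up to time \<open>P n\<close> the orbit of \<open>(x, y)\<close> is that of a periodic rotation, sheared by \<open>hsum n\<close>.\<close>

lemma orbit_near:
  assumes i: "i \<le> P n"
    and p: "\<And>i. real i * alpha = of_int (int i * p) / real (Q n) + real i * liouville_tail Q n"
    and p': "\<And>i. real i * beta = of_int (int i * p') / real (P n) + real i * liouville_tail P n"
    and a: "circle_near 0 a (x + of_int (int i * p) / real (Q n))"
  shows "circle_near ((1/2) ^ n / 400) (x + real i * alpha) a"
    and "circle_near ((1/2) ^ n) (y + real i * beta + Phi i x)
      (y + hsum n a - hsum n x + of_int (int i * p') / real (P n))"
proof -
  note d = drift_bounds[OF i]
  have "circle_near (real i * liouville_tail Q n) (x + real i * alpha) (x + of_int (int i * p) / real (Q n))"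
    using Qc.tail_nonneg[of n] by (intro circle_near_abs) (simp add: p)
  then have 1: "circle_near (real i * liouville_tail Q n) (x + real i * alpha) a"
    using circle_near_trans[OF _ circle_near_sym[OF a]] by fastforce
  then show "circle_near ((1/2) ^ n / 400) (x + real i * alpha) a"
    using d(2) by (rule circle_near_mono)
  have "\<bar>hsum n (x + real i * alpha) - hsum n a\<bar> \<le> real (Q n) / 128 * (real i * liouville_tail Q n)"
    by (rule hsum_near[OF 1])
  also have "\<dots> = (real (Q n) * (real i * liouville_tail Q n)) / 128"
    by simp
  also have "\<dots> \<le> (1/2) ^ n / 400"
    using d(1) zero_le_power[of "1/2 :: real" n] by linarith
  finally have h: "\<bar>hsum n (x + real i * alpha) - hsum n a\<bar> \<le> (1/2) ^ n / 400" .
  have "\<bar>real i * beta - of_int (int i * p') / real (P n)\<bar> \<le> (1/2) ^ n / 400"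
    unfolding p' using d(3) Pc.tail_nonneg[of n] by simp
  then have b: "\<bar>real i * beta - of_int (int i * p') / real (P n)\<bar> \<le> (1/2) ^ n / 400" .
  \<comment> \<open>Three sources of error: the angle of the fibre rotation, the stages from
    \<open>n\<close> on, and the drift of the base as seen by \<open>hsum n\<close>.\<close>
  have "(y + real i * beta + Phi i x) - (y + hsum n a - hsum n x + of_int (int i * p') / real (P n)) =
      (real i * beta - of_int (int i * p') / real (P n)) +
      (Phi i x - (hsum n (x + real i * alpha) - hsum n x)) + (hsum n (x + real i * alpha) - hsum n a)"
    by (simp only: algebra_simps)
  then have "\<bar>(y + real i * beta + Phi i x) -
      (y + hsum n a - hsum n x + of_int (int i * p') / real (P n))\<bar> \<le>
      (1/2) ^ n / 400 + (1/2) ^ n / 64 + (1/2) ^ n / 400"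
    using abs_sum3_le[OF b order_trans[OF Phi_split[of i x n] d(4)] h] by (simp only:)
  also have "\<dots> \<le> (1/2) ^ n" by simp
  finally show "circle_near ((1/2) ^ n) (y + real i * beta + Phi i x)
      (y + hsum n a - hsum n x + of_int (int i * p') / real (P n))"
    by (rule circle_near_abs)
qed

text \<open>At time \<open>P n\<close> both rotations of the periodic approximation amount to
  integers, and the shear cancels because the base has returned.\<close>

lemma return_near:
  assumes z: "z \<in> torus"
  shows "circle_near ((1/2) ^ n) (fst ((T ^^ P n) z)) (fst z)"
    "circle_near ((1/2) ^ n) (snd ((T ^^ P n) z)) (snd z)"
proof -
  obtain p :: int where p: "\<And>i. real i * alpha = of_int (int i * p) / real (Q n) + real i * liouville_tail Q n"
    using Qc.multiple_approx[of n] unfolding alpha_def by metis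
  obtain p' :: int where p': "\<And>i. real i * beta = of_int (int i * p') / real (P n) + real i * liouville_tail P n"
    using Pc.multiple_approx[of n] unfolding beta_def by metis
  have e1: "of_int (int (P n) * p) / real (Q n) = (of_int (2 ^ n * p) :: real)"
    using Q_pos[of n] by (simp add: P_def)
  have e2: "of_int (int (P n) * p') / real (P n) = (of_int p' :: real)"
    using Pc.D_pos[of n] by simp
  have a: "circle_near 0 (fst z) (fst z + of_int (int (P n) * p) / real (Q n))"
    unfolding e1 by (rule circle_nearI[of _ _ "- (2 ^ n * p)"]) simp
  note o = orbit_near(1)[OF le_refl p p' a] orbit_near(2)[OF le_refl p p' a, where y = "snd z"]
  show "circle_near ((1/2) ^ n) (fst ((T ^^ P n) z)) (fst z)"
    unfolding T_pow[OF z] using o(1) by (simp add: circle_near_mono)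
  have "circle_near 0 (snd z + hsum n (fst z) - hsum n (fst z) + of_int p') (snd z)"
    by (rule circle_nearI[of _ _ p']) simp
  then show "circle_near ((1/2) ^ n) (snd ((T ^^ P n) z)) (snd z)"
    unfolding T_pow[OF z] using circle_near_trans[OF o(2)[unfolded e2]] by fastforce
qed

lemma partition_pair:
  assumes "A \<in> sets torus_measure" "A \<noteq> {}" "A \<noteq> torus"
  shows "[A, torus - A] \<in> finite_measurable_partitions torus_measure"
proof -
  have "A \<subseteq> torus" using assms by (simp add: sets_torus_measure)
  moreover have "torus - A \<in> sets torus_measure"
    using sets.compl_sets[OF assms(1)] by simp
  ultimately show ?thesis
    using assms by (auto simp: finite_measurable_partitions_def partition_on_def disjoint_def)
qed

text \<open>A point and its return at time \<open>P n\<close> are close; if both lie in the Lusin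
  set \<open>K\<close>, they lie on the same side of \<open>A\<close>. The exceptional set has at
  most twice the measure of the complement of \<open>K\<close>.\<close>

lemma rigid_T: "rigid torus_measure T"
  unfolding rigid_def
proof (intro exI conjI allI impI)
  show "strict_mono P"
  proof (rule strict_mono_Suc_iff[THEN iffD2], rule allI)
    fix n
    have "2 * P n \<le> P (Suc n)" by (rule dvd_imp_le[OF Pc.D_dvd Pc.D_pos])
    then show "P n < P (Suc n)" using Pc.D_pos[of n] by simp
  qed
  show "0 < P n" for n by (rule Pc.D_pos)
  fix f :: "real \<times> real \<Rightarrow> complex"
  assume f: "square_integrable torus_measure f"
  show "(\<lambda>n. \<integral>x. (cmod (f ((T ^^ P n) x) - f x))\<^sup>2 \<partial>torus_measure) \<longlonglongrightarrow> 0"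
  proof (rule mp.rigid_limit[OF _ f])
    fix A assume A: "A \<in> sets torus_measure"
    show "(\<lambda>n. measure torus_measure {z \<in> space torus_measure. ((T ^^ P n) z \<in> A) \<noteq> (z \<in> A)}) \<longlonglongrightarrow> 0"
    \<comment> \<open>Trivial sets are treated apart because the cells of a partition must be
      nonempty.\<close>
    proof (cases "A = {} \<or> A = torus")
      case True
      then have "{z \<in> space torus_measure. ((T ^^ P n) z \<in> A) \<noteq> (z \<in> A)} = {}" for n
        using True mp.T_pow_space[of _ "P n"] by auto
      then show ?thesis by (simp only: measure_empty tendsto_const)
    next
      case False
      then have part: "[A, torus - A] \<in> finite_measurable_partitions torus_measure"
        using partition_pair[OF A] by simp
      show ?thesis
      proof (rule LIMSEQ_I)
        fix r :: real assume r: "0 < r"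
        obtain K d where K: "K \<in> sets torus_measure" "measure torus_measure (torus - K) < r / 2"
          and d: "0 < d" "\<And>z z'. z \<in> K \<Longrightarrow> z' \<in> K \<Longrightarrow> circle_near d (fst z) (fst z') \<Longrightarrow>
            circle_near d (snd z) (snd z') \<Longrightarrow> cell_index [A, torus - A] z = cell_index [A, torus - A] z'"
          using torus_lusin[OF part, of "r / 2"] r by auto
        have KT: "K \<subseteq> torus" using K by (simp add: sets_torus_measure)
        have Kc: "torus - K \<in> sets torus_measure" using sets.compl_sets[OF K(1)] by simp
        have same: "z \<in> A \<longleftrightarrow> z' \<in> A" if "z \<in> K" "z' \<in> K" "circle_near d (fst z) (fst z')"
            "circle_near d (snd z) (snd z')" for z z'
        proof -
          have "z \<in> A \<longleftrightarrow> cell_index [A, torus - A] z = 0" if "z \<in> K" for z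
            using cell_index_props[OF part, of z] cell_index_eqI[OF part, of z 0] that KT
            by (auto simp: less_Suc_eq)
          then show ?thesis using d(2)[OF that] that by simp
        qed
        obtain N where N: "(1/2 :: real) ^ N < d"
          using real_arch_pow_inv[OF d(1)] by fastforce
        have "norm (measure torus_measure {z \<in> space torus_measure. ((T ^^ P n) z \<in> A) \<noteq> (z \<in> A)} - 0) < r"
          if n: "n \<ge> N" for n
        proof -
          have "(1/2 :: real) ^ n \<le> (1/2) ^ N"
            using n by (intro power_decreasing) auto
          then have le: "(1/2 :: real) ^ n \<le> d" using N by linarith
          let ?K' = "(T ^^ P n) -` (torus - K) \<inter> space torus_measure"
          have K': "?K' \<in> sets torus_measure"
            using measurable_sets[OF mp.T_pow_measurable Kc] .
          have "{z \<in> space torus_measure. ((T ^^ P n) z \<in> A) \<noteq> (z \<in> A)} \<subseteq> (torus - K) \<union> ?K'"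
          proof (rule subsetI, rule ccontr)
            fix z assume z: "z \<in> {z \<in> space torus_measure. ((T ^^ P n) z \<in> A) \<noteq> (z \<in> A)}"
              and nz: "z \<notin> (torus - K) \<union> ?K'"
            have zt: "z \<in> torus" using z by simp
            have "(T ^^ P n) z \<in> torus" using mp.T_pow_space[of z] zt by simp
            then have "z \<in> K" "(T ^^ P n) z \<in> K" using nz zt by auto
            then have "(T ^^ P n) z \<in> A \<longleftrightarrow> z \<in> A"
              using return_near[OF zt, of n] le by (intro same) (auto intro: circle_near_mono)
            then show False using z by simp
          qed
          then have "measure torus_measure {z \<in> space torus_measure. ((T ^^ P n) z \<in> A) \<noteq> (z \<in> A)} \<le>
              measure torus_measure ((torus - K) \<union> ?K')"
            using Kc K' by (intro mp.finite_measure_mono) auto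
          also have "\<dots> \<le> measure torus_measure (torus - K) + measure torus_measure ?K'"
            using Kc K' by (rule measure_Un_le)
          also have "measure torus_measure ?K' = measure torus_measure (torus - K)"
            by (rule mp.T_pow_vimage[OF Kc])
          also have "measure torus_measure (torus - K) + measure torus_measure (torus - K) < r"
            using K by simp
          finally show ?thesis by simp
        qed
        then show "\<exists>N. \<forall>n\<ge>N. norm (measure torus_measure
            {z \<in> space torus_measure. ((T ^^ P n) z \<in> A) \<noteq> (z \<in> A)} - 0) < r"
          by blast
      qed
    qed
  qed
qed

end

section \<open>Ergodicity\<close>

text \<open>Rounded down to the grid of mesh \<open>1 / K\<close>, the points
  \<open>c + l * p / K\<close> run modulo 1 through every grid point exactly once, as
  \<open>p\<close> is invertible modulo \<open>K\<close>. Each of the \<open>K\<close> terms is off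
  by at most \<open>L / K\<close>.\<close>

lemma rotation_sum:
  fixes f :: "real \<Rightarrow> real" and K :: nat and p :: int
  assumes f: "\<And>x y d. circle_near d x y \<Longrightarrow> \<bar>f x - f y\<bar> \<le> L * d"
    and K: "0 < K" and p: "coprime p (int K)"
  shows "\<bar>(\<Sum>l<K. f (c + of_int (int l * p) / real K)) - (\<Sum>l<K. f (real l / real K))\<bar> \<le> L"
proof -
  define s where "s = \<lfloor>c * real K\<rfloor>"
  define h where "h l = nat ((s + int l * p) mod int K)" for l
  have h_int: "int (h l) = (s + int l * p) mod int K" for l
    using K by (simp add: h_def)
  have "inj_on h {..<K}"
  proof (rule inj_onI)
    fix l l' assume l: "l \<in> {..<K}" "l' \<in> {..<K}" "h l = h l'"
    then have "(s + int l * p) mod int K = (s + int l' * p) mod int K"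
      using h_int by metis
    then have "int K dvd (s + int l * p) - (s + int l' * p)"
      by (rule mod_eq_dvd_iff[THEN iffD1])
    also have "(s + int l * p) - (s + int l' * p) = (int l - int l') * p"
      by (simp add: algebra_simps)
    finally have "int K dvd int l - int l'"
      using p coprime_commute coprime_dvd_mult_left_iff by blast
    then have "int l mod int K = int l' mod int K"
      by (rule mod_eq_dvd_iff[THEN iffD2])
    then show "l = l'" using l by simp
  qed
  moreover have "h ` {..<K} \<subseteq> {..<K}"
    using K by (auto simp: h_def nat_less_iff)
  ultimately have "bij_betw h {..<K} {..<K}"
    by (simp add: bij_betw_def endo_inj_surj)
  then have reidx: "(\<Sum>l<K. f (real l / real K)) = (\<Sum>l<K. f (real (h l) / real K))"
    by (rule sum.reindex_bij_betw[symmetric])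
  have near: "circle_near (1 / real K) (c + of_int (int l * p) / real K) (real (h l) / real K)" for l
  proof -
    define q where "q = (s + int l * p) div int K"
    have e: "s + int l * p = q * int K + int (h l)"
      unfolding h_int q_def by simp
    have "real_of_int (s + int l * p) = real_of_int q * real K + real (h l)"
      unfolding e by simp
    then have "real (h l) / real K = (of_int s + of_int (int l * p)) / real K - of_int q"
      using K by (simp add: field_simps)
    then have "c + of_int (int l * p) / real K - real (h l) / real K - of_int q = c - of_int s / real K"
      by (simp add: add_divide_distrib)
    moreover have "\<bar>c - of_int s / real K\<bar> \<le> 1 / real K"
    proof -
      have "0 \<le> c * real K - of_int s" "c * real K - of_int s \<le> 1"
        unfolding s_def using of_int_floor_le[of "c * real K"] real_of_int_floor_add_one_ge[of "c * real K"]
        by linarith+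
      moreover have "c - of_int s / real K = (c * real K - of_int s) / real K"
        using K by (simp add: field_simps)
      ultimately show ?thesis
        using K by (simp add: divide_right_mono)
    qed
    ultimately show ?thesis
      by (intro circle_nearI[of _ _ q]) simp
  qed
  have "\<bar>\<Sum>l<K. f (c + of_int (int l * p) / real K) - f (real (h l) / real K)\<bar> \<le>
      (\<Sum>l<K. \<bar>f (c + of_int (int l * p) / real K) - f (real (h l) / real K)\<bar>)"
    by (rule sum_abs)
  also have "\<dots> \<le> (\<Sum>l<K. L * (1 / real K))"
    by (intro sum_mono f near)
  also have "\<dots> = L" using K by simp
  finally show ?thesis
    unfolding reidx by (simp only: sum_subtractf)
qed

lemma sum_residue_quotient:
  fixes f :: "nat \<Rightarrow> real"
  assumes "0 < q"
  shows "(\<Sum>i<q * k. f i) = (\<Sum>a<q. \<Sum>l<k. f (a + q * l))"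
proof -
  have lt: "a + q * l < q * k" if "a < q" "l < k" for a l
  proof -
    have "a + q * l < q * Suc l" "q * Suc l \<le> q * k"
      using that by (simp, intro mult_le_mono) auto
    then show ?thesis by simp
  qed
  have "bij_betw (\<lambda>(a, l). a + q * l) ({..<q} \<times> {..<k}) {..<q * k}"
  proof (rule bij_betw_byWitness[where f' = "\<lambda>i. (i mod q, i div q)"])
    show "(\<lambda>(a, l). a + q * l) ` ({..<q} \<times> {..<k}) \<subseteq> {..<q * k}"
      using lt by auto
    show "(\<lambda>i. (i mod q, i div q)) ` {..<q * k} \<subseteq> {..<q} \<times> {..<k}"
      using assms by (auto simp: div_less_iff_less_mult mult.commute)
  qed (use assms in auto)
  then have "(\<Sum>i<q * k. f i) = (\<Sum>x\<in>{..<q} \<times> {..<k}. f (case x of (a, l) \<Rightarrow> a + q * l))"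
    by (rule sum.reindex_bij_betw[symmetric])
  also have "\<dots> = (\<Sum>a<q. \<Sum>l<k. f (a + q * l))"
    by (simp add: sum.cartesian_product case_prod_unfold)
  finally show ?thesis .
qed

context stages
begin

text \<open>Write the time as \<open>a + Q n * l\<close>. In the periodic approximation the base
  position depends on \<open>a\<close> alone, while \<open>l\<close> moves the fibre by
  \<open>l * p' / 2 ^ n\<close>. The sum over \<open>l\<close> averages a fibre and forgets the
  shear, the sum over \<open>a\<close> averages the base; the resulting value \<open>W\<close> does
  not depend on the point.\<close>

lemma orbit_sum_near_constant:
  fixes F :: "real \<Rightarrow> real \<Rightarrow> real"
  assumes F: "\<And>x x' y y' d. circle_near d x x' \<Longrightarrow> circle_near d y y' \<Longrightarrow> \<bar>F x y - F x' y'\<bar> \<le> L * d"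
    and L: "0 \<le> L"
  shows "\<exists>c. \<forall>z\<in>torus. \<bar>(\<Sum>i<P n. F (fst ((T ^^ i) z)) (snd ((T ^^ i) z))) - real (P n) * c\<bar> \<le>
    real (P n) * (3 * L * (1/2) ^ n)"
proof -
  obtain p :: int where p: "odd p"
    "\<And>i. real i * alpha = of_int (int i * p) / real (Q n) + real i * liouville_tail Q n"
    using Qc.multiple_approx[of n] unfolding alpha_def by metis
  obtain p' :: int where p': "odd p'"
    "\<And>i. real i * beta = of_int (int i * p') / real (P n) + real i * liouville_tail P n"
    using Pc.multiple_approx[of n] unfolding beta_def by metis
  let ?r = "(1/2 :: real) ^ n"
  define K :: nat where "K = 2 ^ n"
  have K0: "0 < K" by (simp add: K_def)
  have PK: "P n = Q n * K" by (simp add: P_def K_def)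
  have cp: "coprime p (int (Q n))"
    using Q_power[of n] p(1) by auto
  have cp': "coprime p' (int K)"
    using p'(1) by (simp add: K_def)
  define V where "V x = (\<Sum>l<K. F x (real l / real K))" for x
  have V: "\<bar>V x - V x'\<bar> \<le> (real K * L) * d" if "circle_near d x x'" for x x' d
  proof -
    have d: "0 \<le> d" using that by (auto simp: circle_near_def intro: order_trans[OF abs_ge_zero])
    have "\<bar>V x - V x'\<bar> = \<bar>\<Sum>l<K. F x (real l / real K) - F x' (real l / real K)\<bar>"
      by (simp add: V_def sum_subtractf)
    also have "\<dots> \<le> (\<Sum>l<K. \<bar>F x (real l / real K) - F x' (real l / real K)\<bar>)"
      by (rule sum_abs)
    also have "\<dots> \<le> (\<Sum>l<K. L * d)"
      using d by (intro sum_mono F that circle_near_abs) simp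
    finally show ?thesis by simp
  qed
  define W where "W = (\<Sum>a<Q n. V (real a / real (Q n)))"
  have "\<bar>(\<Sum>i<P n. F (fst ((T ^^ i) z)) (snd ((T ^^ i) z))) - W\<bar> \<le> real (P n) * (3 * L * ?r)"
    if z: "z \<in> torus" for z
  proof -
    let ?x = "fst z" and ?y = "snd z"
    define xa where "xa a = ?x + of_int (int a * p) / real (Q n)" for a
    define ya where "ya a = ?y + hsum n (xa a) - hsum n ?x + of_int (int a * p') / real (P n)" for a
    have step: "\<bar>F (fst ((T ^^ (a + Q n * l)) z)) (snd ((T ^^ (a + Q n * l)) z)) -
        F (xa a) (ya a + of_int (int l * p') / real K)\<bar> \<le> L * ?r" if al: "a < Q n" "l < K" for a l
    proof -
      define i where "i = a + Q n * l"
      have "a + Q n * l < Q n * Suc l" "Q n * Suc l \<le> Q n * K"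
        using al by (simp, intro mult_le_mono) auto
      then have iP: "i \<le> P n" by (simp add: i_def PK)
      have e: "?x + of_int (int i * p) / real (Q n) = xa a + of_int (int l * p)"
        using Q_pos[of n] by (simp add: xa_def i_def field_simps)
      have a0: "circle_near 0 (xa a) (?x + of_int (int i * p) / real (Q n))"
        unfolding e by (rule circle_nearI[of _ _ "- (int l * p)"]) simp
      have e': "?y + hsum n (xa a) - hsum n ?x + of_int (int i * p') / real (P n) =
          ya a + of_int (int l * p') / real K"
        using Q_pos[of n] K0 by (simp add: ya_def i_def PK field_simps)
      have n1: "circle_near ?r (?x + real i * alpha) (xa a)"
        by (rule circle_near_mono[OF orbit_near(1)[OF iP p(2) p'(2) a0]]) simp
      have n2: "circle_near ?r (?y + real i * beta + Phi i ?x) (ya a + of_int (int l * p') / real K)"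
        using orbit_near(2)[OF iP p(2) p'(2) a0, of ?y] unfolding e' .
      show ?thesis
        unfolding i_def[symmetric] T_pow[OF z] fst_conv snd_conv
        by (rule F) (use n1 n2 in auto)
    qed
    have inner: "\<bar>(\<Sum>l<K. F (xa a) (ya a + of_int (int l * p') / real K)) - V (xa a)\<bar> \<le> L" for a
      unfolding V_def
    proof (rule rotation_sum[OF _ K0 cp'])
      show "\<bar>F (xa a) x - F (xa a) y\<bar> \<le> L * d" if "circle_near d x y" for x y d
      proof -
        have "0 \<le> d" using that by (auto simp: circle_near_def intro: order_trans[OF abs_ge_zero])
        then have "circle_near d (xa a) (xa a)" by (intro circle_near_abs) simp
        then show ?thesis using that by (rule F)
      qed
    qed
    have outer: "\<bar>(\<Sum>a<Q n. V (xa a)) - W\<bar> \<le> real K * L"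
      unfolding W_def xa_def by (rule rotation_sum[OF V Q_pos cp])
    have "(\<Sum>i<P n. F (fst ((T ^^ i) z)) (snd ((T ^^ i) z))) =
        (\<Sum>a<Q n. \<Sum>l<K. F (fst ((T ^^ (a + Q n * l)) z)) (snd ((T ^^ (a + Q n * l)) z)))"
      unfolding PK by (rule sum_residue_quotient[OF Q_pos])
    then have "(\<Sum>i<P n. F (fst ((T ^^ i) z)) (snd ((T ^^ i) z))) - W =
        (\<Sum>a<Q n. \<Sum>l<K. F (fst ((T ^^ (a + Q n * l)) z)) (snd ((T ^^ (a + Q n * l)) z)) -
          F (xa a) (ya a + of_int (int l * p') / real K)) +
        (\<Sum>a<Q n. (\<Sum>l<K. F (xa a) (ya a + of_int (int l * p') / real K)) - V (xa a)) +
        ((\<Sum>a<Q n. V (xa a)) - W)"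
      by (simp add: sum_subtractf)
    also have "\<bar>\<dots>\<bar> \<le> real (Q n) * (real K * (L * ?r)) + real (Q n) * L + real K * L"
    proof (rule abs_sum3_le[OF _ _ outer])
      have "\<bar>\<Sum>a<Q n. \<Sum>l<K. F (fst ((T ^^ (a + Q n * l)) z)) (snd ((T ^^ (a + Q n * l)) z)) -
          F (xa a) (ya a + of_int (int l * p') / real K)\<bar> \<le>
          (\<Sum>a<Q n. \<Sum>l<K. \<bar>F (fst ((T ^^ (a + Q n * l)) z)) (snd ((T ^^ (a + Q n * l)) z)) -
          F (xa a) (ya a + of_int (int l * p') / real K)\<bar>)"
        by (intro order_trans[OF sum_abs] sum_mono sum_abs)
      also have "\<dots> \<le> (\<Sum>a<Q n. \<Sum>l<K. L * ?r)"
        by (intro sum_mono step) auto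
      finally show "\<bar>\<Sum>a<Q n. \<Sum>l<K. F (fst ((T ^^ (a + Q n * l)) z)) (snd ((T ^^ (a + Q n * l)) z)) -
          F (xa a) (ya a + of_int (int l * p') / real K)\<bar> \<le> real (Q n) * (real K * (L * ?r))"
        by simp
      have "\<bar>\<Sum>a<Q n. (\<Sum>l<K. F (xa a) (ya a + of_int (int l * p') / real K)) - V (xa a)\<bar> \<le>
          (\<Sum>a<Q n. \<bar>(\<Sum>l<K. F (xa a) (ya a + of_int (int l * p') / real K)) - V (xa a)\<bar>)"
        by (rule sum_abs)
      also have "\<dots> \<le> (\<Sum>a<Q n. L)"
        by (intro sum_mono inner)
      finally show "\<bar>\<Sum>a<Q n. (\<Sum>l<K. F (xa a) (ya a + of_int (int l * p') / real K)) - V (xa a)\<bar> \<le>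
          real (Q n) * L"
        by simp
    qed
    \<comment> \<open>Each error is at most \<open>P n * L * (1/2) ^ n\<close>: the second because
      \<open>P n = Q n * 2 ^ n\<close>, the third because moreover \<open>2 ^ n\<close> is at most
      \<open>Q n\<close>.\<close>
    also have "\<dots> \<le> real (P n) * (L * ?r) + real (P n) * (L * ?r) + real (P n) * (L * ?r)"
    proof (intro add_mono)
      show "real (Q n) * (real K * (L * ?r)) \<le> real (P n) * (L * ?r)"
        by (simp add: PK)
      have Kr: "real K * ?r = 1"
        by (simp add: K_def flip: power_mult_distrib)
      have "real (P n) * (L * ?r) = real (Q n) * L * (real K * ?r)"
        by (simp add: PK)
      then have eq: "real (P n) * (L * ?r) = real (Q n) * L"
        unfolding Kr by simp
      then show "real (Q n) * L \<le> real (P n) * (L * ?r)"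
        by linarith
      have "K \<le> Q n"
        using Qc.D_growth[of 0 n] by (simp add: Q_0 K_def)
      then have "real K * L \<le> real (Q n) * L"
        using L by (intro mult_right_mono) auto
      then show "real K * L \<le> real (P n) * (L * ?r)"
        unfolding eq .
    qed
    finally show ?thesis by (simp add: algebra_simps)
  qed
  then show ?thesis
    using Pc.D_pos[of n] by (intro exI[of _ "W / real (P n)"]) simp
qed

text \<open>An invariant indicator equals its own orbit averages. Those of a Lipschitz approximation
  \<open>G\<close> are nearly constant, so the indicator lies within \<open>3 * e\<close> of a
  constant in mean. For a set of measure \<open>a\<close> this distance is at least
  \<open>min a (1 - a)\<close>, which is \<open>4 * e\<close>.\<close>

lemma ergodic_T: "ergodic torus_measure T"
  unfolding ergodic_def
proof (intro ballI impI, rule ccontr)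
  fix A assume A: "A \<in> sets torus_measure" and inv: "T -` A \<inter> space torus_measure = A"
    and not: "\<not> (measure torus_measure A = 0 \<or> measure torus_measure A = 1)"
  define a where "a = measure torus_measure A"
  have a: "0 < a" "a < 1"
    using not mp.prob_le_1[of A] by (auto simp: a_def zero_less_measure_iff less_le)
  define e where "e = min a (1 - a) / 4"
  have e: "0 < e" "4 * e \<le> a" "4 * e \<le> 1 - a"
    using a by (auto simp: e_def)
  have Ac: "torus - A \<in> sets torus_measure"
    using sets.compl_sets[OF A] by simp
  have mAc: "measure torus_measure (torus - A) = 1 - a"
    using mp.prob_compl[OF A] by (simp add: a_def)
  obtain C1 where C1: "C1 \<subseteq> A" "compact C1" "C1 \<in> sets torus_measure" "measure torus_measure (A - C1) < e"
    using torus_inner_compact[OF A e(1)] by blast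
  obtain C2 where C2: "C2 \<subseteq> torus - A" "compact C2" "C2 \<in> sets torus_measure"
      "measure torus_measure (torus - A - C2) < e"
    using torus_inner_compact[OF Ac e(1)] by blast
  have C1ne: "C1 \<noteq> {}" using C1(4) e by (auto simp: a_def)
  define C where "C b = (if b then C1 else C2)" for b
  have "\<exists>d>0. \<forall>i\<in>UNIV. \<forall>j\<in>UNIV. \<forall>x\<in>C i. \<forall>y\<in>C j. i \<noteq> j \<longrightarrow> d \<le> dist (torus_emb x) (torus_emb y)"
    using C1 C2 by (intro compact_family_separated) (auto simp: C_def sets_torus_measure split: if_splits)
  then obtain d where d: "0 < d" "\<And>x y. x \<in> C1 \<Longrightarrow> y \<in> C2 \<Longrightarrow> d \<le> dist (torus_emb x) (torus_emb y)"
    unfolding C_def by (metis UNIV_I)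
  \<comment> \<open>A Urysohn function, 1 on \<open>C1\<close> and 0 on \<open>C2\<close>; measuring
    the distance in the embedded torus makes it Lipschitz with respect to
    \<open>circle_near\<close>.\<close>
  define G where "G z = max 0 (1 - infdist (torus_emb z) (torus_emb ` C1) / d)" for z
  have G01: "0 \<le> G z" "G z \<le> 1" for z
    using d(1) infdist_nonneg[of "torus_emb z" "torus_emb ` C1"] by (auto simp: G_def)
  have G1: "G z = 1" if "z \<in> C1" for z
    using that by (simp add: G_def)
  have G2: "G z = 0" if "z \<in> C2" for z
  proof -
    have "d \<le> infdist (torus_emb z) (torus_emb ` C1)"
    proof -
      have ne: "torus_emb ` C1 \<noteq> {}" using C1ne by simp
      have "d \<le> (INF u\<in>torus_emb ` C1. dist (torus_emb z) u)"
      proof (rule cINF_greatest[OF ne])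
        fix u assume "u \<in> torus_emb ` C1"
        then obtain x where "x \<in> C1" "u = torus_emb x" by blast
        then show "d \<le> dist (torus_emb z) u"
          using d(2)[of x z] that by (simp add: dist_commute)
      qed
      then show ?thesis unfolding infdist_notempty[OF ne] .
    qed
    then show ?thesis using d(1) by (simp add: G_def)
  qed
  define L where "L = 4 * pi / d"
  have L: "0 \<le> L" using d(1) by (simp add: L_def)
  have GL: "\<bar>G (x, y) - G (x', y')\<bar> \<le> L * r" if "circle_near r x x'" "circle_near r y y'" for x x' y y' r
  proof -
    have "\<bar>G (x, y) - G (x', y')\<bar> \<le> \<bar>infdist (torus_emb (x, y)) (torus_emb ` C1) / d -
        infdist (torus_emb (x', y')) (torus_emb ` C1) / d\<bar>"
      by (auto simp: G_def max_def)
    also have "\<dots> = \<bar>infdist (torus_emb (x, y)) (torus_emb ` C1) - infdist (torus_emb (x', y')) (torus_emb ` C1)\<bar> / d"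
      using d(1) by (simp add: abs_divide flip: diff_divide_distrib)
    also have "\<dots> \<le> dist (torus_emb (x, y)) (torus_emb (x', y')) / d"
      using d(1) by (intro divide_right_mono infdist_triangle_abs) auto
    also have "\<dots> \<le> (4 * pi * r) / d"
      using torus_emb_near[of r "(x, y)" "(x', y')"] that d(1) by (intro divide_right_mono) auto
    finally show ?thesis by (simp add: L_def)
  qed
  have "continuous_on UNIV G"
    unfolding G_def using d(1)
    by (intro continuous_intros continuous_on_max continuous_on_infdist continuous_torus_emb) auto
  then have "G \<in> borel_measurable borel"
    by (rule borel_measurable_continuous_onI)
  then have Gr: "G \<in> borel_measurable (restrict_space borel torus)"
    by (rule measurable_restrict_space1)
  have "sets torus_measure = sets (restrict_space borel torus)"
    by (auto simp: sets_torus_measure sets_restrict_space_iff)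
  from measurable_cong_sets[OF this refl] Gr have Gm [measurable]: "G \<in> borel_measurable torus_measure"
    by blast
  have [measurable]: "A \<in> sets torus_measure" by (rule A)
  define f where "f z = indicator A z - G z" for z
  have fm [measurable]: "f \<in> borel_measurable torus_measure" unfolding f_def by measurable
  have fi: "integrable torus_measure (\<lambda>z. \<bar>f z\<bar>)"
  proof (rule mp.integrable_const_bound[where B = 1])
    have "norm \<bar>f z\<bar> \<le> 1" for z
      using G01[of z] by (simp add: f_def indicator_def)
    then show "AE z in torus_measure. norm \<bar>f z\<bar> \<le> 1" by (rule AE_I2)
  qed measurable
  define Z where "Z = (A - C1) \<union> (torus - A - C2)"
  have Z: "Z \<in> sets torus_measure" unfolding Z_def using A Ac C1 C2 by auto
  have "(\<integral>z. \<bar>f z\<bar> \<partial>torus_measure) \<le> (\<integral>z. indicator Z z \<partial>torus_measure)"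
  proof (rule integral_mono[OF fi])
    show "integrable torus_measure (\<lambda>z. indicator Z z :: real)"
      using Z by (intro integrable_real_indicator) (auto simp: mp.emeasure_eq_measure)
    fix z assume "z \<in> space torus_measure"
    then show "\<bar>f z\<bar> \<le> indicator Z z"
      using G01[of z] G1[of z] G2[of z] C1(1) C2(1)
      by (auto simp: f_def Z_def indicator_def abs_le_iff)
  qed
  also have "\<dots> = measure torus_measure Z"
    using sets.sets_into_space[OF Z] by (simp add: Int_absorb2)
  also have "\<dots> \<le> measure torus_measure (A - C1) + measure torus_measure (torus - A - C2)"
    unfolding Z_def using A Ac C1 C2 by (intro measure_Un_le) auto
  also have "\<dots> < 2 * e" using C1 C2 by simp
  finally have f2e: "(\<integral>z. \<bar>f z\<bar> \<partial>torus_measure) < 2 * e" .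
  obtain n where n: "(1/2 :: real) ^ n < e / (3 * L + 1)"
    using real_arch_pow_inv[of "e / (3 * L + 1)" "1/2"] e(1) L by (auto simp: add_nonneg_pos)
  then have "(1/2 :: real) ^ n * (3 * L + 1) < e"
    using L by (simp add: pos_less_divide_eq add_nonneg_pos)
  then have Lr: "3 * L * (1/2) ^ n < e"
  proof -
    have "0 \<le> (1/2 :: real) ^ n" by simp
    moreover have "(1/2 :: real) ^ n * (3 * L + 1) = 3 * L * (1/2) ^ n + (1/2) ^ n"
      by (simp add: algebra_simps)
    ultimately show ?thesis using \<open>(1/2 :: real) ^ n * (3 * L + 1) < e\<close> by linarith
  qed
  have "\<exists>c. \<forall>z\<in>torus. \<bar>(\<Sum>i<P n. G ((T ^^ i) z)) - real (P n) * c\<bar> \<le>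
      real (P n) * (3 * L * (1/2) ^ n)"
    using orbit_sum_near_constant[of "\<lambda>x y. G (x, y)" L n, OF GL L] by simp
  then obtain c where c: "\<And>z. z \<in> torus \<Longrightarrow> \<bar>(\<Sum>i<P n. G ((T ^^ i) z)) - real (P n) * c\<bar> \<le>
    real (P n) * (3 * L * (1/2) ^ n)"
    by blast
  have Pn: "0 < real (P n)" using Pc.D_pos[of n] by simp
  have invi: "(T ^^ i) z \<in> A \<longleftrightarrow> z \<in> A" if "z \<in> torus" for i z
  proof (induction i)
    case (Suc i)
    have "(T ^^ i) z \<in> torus" using mp.T_pow_space[of z i] that by simp
    then have "T ((T ^^ i) z) \<in> A \<longleftrightarrow> (T ^^ i) z \<in> A"
      using inv by auto
    then show ?case using Suc by simp
  qed simp
  have pt: "real (P n) * \<bar>indicator A z - c\<bar> \<le> (\<Sum>i<P n. \<bar>f ((T ^^ i) z)\<bar>) + real (P n) * e"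
    if z: "z \<in> torus" for z
  proof -
    have "(\<Sum>i<P n. f ((T ^^ i) z)) = real (P n) * indicator A z - (\<Sum>i<P n. G ((T ^^ i) z))"
      using invi[OF z] by (simp add: f_def sum_subtractf indicator_def)
    then have "real (P n) * (indicator A z - c) =
        (\<Sum>i<P n. f ((T ^^ i) z)) + ((\<Sum>i<P n. G ((T ^^ i) z)) - real (P n) * c)"
      by (simp add: algebra_simps)
    then have "real (P n) * \<bar>indicator A z - c\<bar> =
        \<bar>(\<Sum>i<P n. f ((T ^^ i) z)) + ((\<Sum>i<P n. G ((T ^^ i) z)) - real (P n) * c)\<bar>"
      using Pn by (metis abs_mult abs_of_pos)
    also have "\<dots> \<le> \<bar>\<Sum>i<P n. f ((T ^^ i) z)\<bar> + \<bar>(\<Sum>i<P n. G ((T ^^ i) z)) - real (P n) * c\<bar>"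
      by (rule abs_triangle_ineq)
    also have "\<dots> \<le> (\<Sum>i<P n. \<bar>f ((T ^^ i) z)\<bar>) + real (P n) * e"
    proof (intro add_mono sum_abs)
      have "real (P n) * (3 * L * (1/2) ^ n) \<le> real (P n) * e"
        using Lr Pn by (intro mult_left_mono) auto
      then show "\<bar>(\<Sum>i<P n. G ((T ^^ i) z)) - real (P n) * c\<bar> \<le> real (P n) * e"
        using c[OF z] by simp
    qed
    finally show ?thesis .
  qed
  have fTi: "integrable torus_measure (\<lambda>z. \<bar>f ((T ^^ i) z)\<bar>)" for i
  proof -
    have "integrable (distr torus_measure torus_measure (T ^^ i)) (\<lambda>z. \<bar>f z\<bar>)"
      using fi by (simp add: mp.T_pow_distr)
    then show ?thesis
      by (subst (asm) integrable_distr_eq[OF mp.T_pow_measurable]) auto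
  qed
  have fT: "(\<integral>z. \<bar>f ((T ^^ i) z)\<bar> \<partial>torus_measure) = (\<integral>z. \<bar>f z\<bar> \<partial>torus_measure)" for i
  proof -
    have "(\<integral>z. \<bar>f z\<bar> \<partial>distr torus_measure torus_measure (T ^^ i)) =
        (\<integral>z. \<bar>f ((T ^^ i) z)\<bar> \<partial>torus_measure)"
      by (rule integral_distr[OF mp.T_pow_measurable]) measurable
    then show ?thesis by (simp add: mp.T_pow_distr)
  qed
  have iA: "integrable torus_measure (\<lambda>z. \<bar>indicator A z - c\<bar> :: real)"
    by (rule mp.integrable_const_bound[where B = "1 + \<bar>c\<bar>"]) (auto simp: indicator_def intro!: AE_I2)
  have "real (P n) * (\<integral>z. \<bar>indicator A z - c\<bar> \<partial>torus_measure) =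
      (\<integral>z. real (P n) * \<bar>indicator A z - c\<bar> \<partial>torus_measure)"
    by simp
  also have "\<dots> \<le> (\<integral>z. (\<Sum>i<P n. \<bar>f ((T ^^ i) z)\<bar>) + real (P n) * e \<partial>torus_measure)"
    using pt iA fTi by (intro integral_mono) auto
  also have "\<dots> = real (P n) * (\<integral>z. \<bar>f z\<bar> \<partial>torus_measure) + real (P n) * e"
    using fTi mp.prob_space by (simp add: fT)
  finally have "real (P n) * (\<integral>z. \<bar>indicator A z - c\<bar> \<partial>torus_measure) \<le>
      real (P n) * ((\<integral>z. \<bar>f z\<bar> \<partial>torus_measure) + e)"
    by (simp add: distrib_left)
  then have "(\<integral>z. \<bar>indicator A z - c\<bar> \<partial>torus_measure) \<le> (\<integral>z. \<bar>f z\<bar> \<partial>torus_measure) + e"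
    using Pn mult_le_cancel_left_pos by blast
  then have up: "(\<integral>z. \<bar>indicator A z - c\<bar> \<partial>torus_measure) < 3 * e"
    using f2e by simp
  have AT: "A \<inter> torus = A" "(torus - A) \<inter> torus = torus - A"
    using sets.sets_into_space[OF A] by auto
  have "(\<integral>z. \<bar>indicator A z - c\<bar> \<partial>torus_measure) =
      (\<integral>z. \<bar>1 - c\<bar> * indicator A z + \<bar>c\<bar> * indicator (torus - A) z \<partial>torus_measure)"
    by (rule Bochner_Integration.integral_cong) (auto simp: indicator_def)
  also have "\<dots> = \<bar>1 - c\<bar> * a + \<bar>c\<bar> * (1 - a)"
    using A Ac mAc AT by (subst Bochner_Integration.integral_add)
      (auto simp: a_def mp.emeasure_eq_measure intro!: integrable_mult_right integrable_real_indicator)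
  also have "\<dots> \<ge> \<bar>1 - c\<bar> * (4 * e) + \<bar>c\<bar> * (4 * e)"
    using e by (intro add_mono mult_left_mono) auto
  finally have "(\<bar>1 - c\<bar> + \<bar>c\<bar>) * (4 * e) < 3 * e"
    using up by (simp add: distrib_right)
  moreover have "1 * (4 * e) \<le> (\<bar>1 - c\<bar> + \<bar>c\<bar>) * (4 * e)"
    using e by (intro mult_right_mono) auto
  ultimately show False using e(1) by simp
qed

end

section \<open>Bounds for the covering numbers\<close>

context stages
begin

section \<open>Upper bound between consecutive stages\<close>

lemma hsum_Suc_lipschitz:
  assumes "\<bar>x - x'\<bar> \<le> d"
  shows "\<bar>hsum (Suc n) x - hsum (Suc n) x'\<bar> \<le> 5 * real (R n * Q n) * d"
proof -
  have d: "0 \<le> d" using assms by linarith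
  have near: "circle_near d x x'" by (rule circle_near_abs[OF assms])
  have r: "1 \<le> real (R n)" using R_pos[of n] by (simp add: Suc_le_eq)
  have "real (Q n) / 128 * d \<le> real (R n * Q n) * d"
    using r d mult_right_mono[OF r, of "real (Q n)"] by (intro mult_right_mono) auto
  then have 1: "\<bar>hsum n x - hsum n x'\<bar> \<le> real (R n * Q n) * d"
    using hsum_near[OF near, of n] by linarith
  have 2: "\<bar>g n x - g n x'\<bar> \<le> 4 * real (R n * Q n) * d"
    by (rule g_circle_near[OF near])
  have "\<bar>hsum (Suc n) x - hsum (Suc n) x'\<bar> = \<bar>(hsum n x - hsum n x') + (g n x - g n x')\<bar>"
    by (simp add: hsum_def)
  also have "\<dots> \<le> real (R n * Q n) * d + 4 * real (R n * Q n) * d"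
    by (rule order_trans[OF abs_triangle_ineq add_mono[OF 1 2]])
  finally show ?thesis by (simp add: algebra_simps)
qed

text \<open>Times up to \<open>B (Suc n) / k\<close> hardly see the stages beyond \<open>n\<close>,
  and the others have slope at most \<open>5 * R n * Q n\<close>. Points in one cell of a grid with
  \<open>k * R n * Q n\<close> columns and \<open>k\<close> rows therefore stay close, and the cells
  serve as the classes of \<open>covering_number_upper\<close>.\<close>

lemma covering_number_T_upper:
  assumes part: "X \<in> finite_measurable_partitions torus_measure" and e: "0 < e"
  shows "\<exists>k::nat. 0 < k \<and> (\<forall>n m. 0 < m \<longrightarrow> k * m \<le> B (Suc n) \<longrightarrow>
    covering_number torus_measure X T m e \<le> k * k * (R n * Q n))"
proof -
  obtain K d where K: "K \<in> sets torus_measure" "measure torus_measure (torus - K) < e\<^sup>2 / 2"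
    and d: "0 < d" "\<And>z z'. z \<in> K \<Longrightarrow> z' \<in> K \<Longrightarrow> circle_near d (fst z) (fst z') \<Longrightarrow>
      circle_near d (snd z) (snd z') \<Longrightarrow> cell_index X z = cell_index X z'"
    using torus_lusin[OF part, of "e\<^sup>2 / 2"] e by auto
  \<comment> \<open>43 is 1 + 16 + 5 + 5 + 16: the initial vertical distance, the late stages at
    both points, and the variation of \<open>hsum\<close> at the start and at the end.\<close>
  obtain k0 :: nat where k0: "43 / d < real k0"
    using reals_Archimedean2 by blast
  define k where "k = Suc k0"
  have k: "0 < k" by (simp add: k_def)
  have kd: "43 / real k \<le> d"
  proof -
    have "43 / d < real k" using k0 by (simp add: k_def)
    then show ?thesis using d(1) k by (simp add: field_simps)
  qed
  have "covering_number torus_measure X T m e \<le> k * k * (R n * Q n)"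
    if m: "0 < m" and mB: "k * m \<le> B (Suc n)" for n m
  proof -
    define N where "N = k * (R n * Q n)"
    have N: "0 < N" using k R_pos Q_pos by (simp add: N_def)
    have RQ: "0 < real (R n * Q n)" using R_pos[of n] Q_pos[of n] by simp
    define c where "c z = (nat \<lfloor>real N * fst z\<rfloor>, nat \<lfloor>real k * snd z\<rfloor>)" for z :: "real \<times> real"
    have cell: "nat \<lfloor>real M * x\<rfloor> < M" if "0 \<le> x" "x < 1" "0 < M" for M x
    proof -
      have "real M * x < real M * 1" using that by (intro mult_strict_left_mono) auto
      then have "\<lfloor>real M * x\<rfloor> < int M" by (simp add: floor_less_iff)
      then show ?thesis using that by (simp add: nat_less_iff)
    qed
    have close: "\<bar>x - x'\<bar> \<le> 1 / real M"
      if "0 \<le> x" "0 \<le> x'" "0 < M" "nat \<lfloor>real M * x\<rfloor> = nat \<lfloor>real M * x'\<rfloor>" for M x x'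
    proof -
      have "\<lfloor>real M * x\<rfloor> = \<lfloor>real M * x'\<rfloor>"
        using that by (metis floor_mono floor_zero mult_nonneg_nonneg nat_eq_iff2 of_nat_0_le_iff zero_le_floor)
      then have "\<bar>real M * x - real M * x'\<bar> \<le> 1"
        using floor_correct[of "real M * x"] floor_correct[of "real M * x'"] by linarith
      then have "real M * \<bar>x - x'\<bar> \<le> 1"
        by (simp add: abs_mult flip: right_diff_distrib)
      then show ?thesis using that by (simp add: field_simps)
    qed
    have sub: "c ` space torus_measure \<subseteq> {..<N} \<times> {..<k}"
      using cell N k by (auto simp: c_def torus_def)
    show ?thesis
    proof (rule mp.covering_number_upper[OF part e m K(1)])
      show "measure torus_measure (space torus_measure - K) < e\<^sup>2 / 2"
        using K by simp
      show "finite (c ` space torus_measure)"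
        using sub by (rule finite_subset) auto
      have "card (c ` space torus_measure) \<le> card ({..<N} \<times> {..<k})"
        using sub by (intro card_mono) auto
      then show "card (c ` space torus_measure) \<le> k * k * (R n * Q n)"
        by (simp add: card_cartesian_product N_def mult_ac)
      fix z z' i
      assume z: "z \<in> space torus_measure" "z' \<in> space torus_measure" and cz: "c z = c z'"
        and i: "i < m" and zK: "(T ^^ i) z \<in> K" "(T ^^ i) z' \<in> K"
      have zt: "z \<in> torus" "z' \<in> torus" using z by auto
      have x: "\<bar>fst z - fst z'\<bar> \<le> 1 / real N" and y: "\<bar>snd z - snd z'\<bar> \<le> 1 / real k"
        using close[of "fst z" "fst z'" N] close[of "snd z" "snd z'" k] zt cz N k
        by (auto simp: c_def torus_def)
      have "1 / real N \<le> 43 / real k"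
      proof -
        have "k * 1 \<le> k * (R n * Q n)"
          using R_pos[of n] Q_pos[of n] by (intro mult_le_mono) (auto simp: Suc_le_eq)
        then have "1 / real N \<le> 1 / real k"
          using k N by (intro divide_left_mono) (auto simp: N_def simp flip: of_nat_mult)
        also have "\<dots> \<le> 43 / real k" by (simp add: divide_right_mono)
        finally show ?thesis .
      qed
      then have n1: "circle_near d (fst ((T ^^ i) z)) (fst ((T ^^ i) z'))"
        unfolding T_pow[OF zt(1)] T_pow[OF zt(2)] using x kd
        by (simp, intro circle_near_abs) simp
      have Phi: "\<bar>Phi i (fst z) - Phi i (fst z')\<bar> \<le> 42 / real k"
      proof -
        let ?h = "hsum (Suc n)"
        let ?x = "fst z" and ?x' = "fst z'"
        have tail: "16 * real i / real (B (Suc n)) \<le> 16 / real k"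
        proof -
          have "real k * real i \<le> real (B (Suc n))"
            using mB i by (metis less_imp_le mult_le_mono2 of_nat_le_iff of_nat_mult order_trans)
          then show ?thesis using k B_pos[of "Suc n"] by (simp add: field_simps)
        qed
        have lip: "\<bar>?h u - ?h u'\<bar> \<le> 5 / real k" if "\<bar>u - u'\<bar> \<le> 1 / real N" for u u'
        proof -
          have "\<bar>?h u - ?h u'\<bar> \<le> 5 * real (R n * Q n) * (1 / real N)"
            by (rule hsum_Suc_lipschitz[OF that])
          also have "\<dots> = 5 / real k"
            unfolding N_def of_nat_mult using R_pos[of n] Q_pos[of n] k by simp
          finally show ?thesis .
        qed
        have l1: "\<bar>?h (?x + real i * alpha) - ?h (?x' + real i * alpha)\<bar> \<le> 5 / real k"
          using x by (intro lip) simp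
        have l2: "\<bar>?h ?x' - ?h ?x\<bar> \<le> 5 / real k"
          using x by (intro lip) (simp add: abs_minus_commute)
        have p1: "\<bar>Phi i ?x - (?h (?x + real i * alpha) - ?h ?x)\<bar> \<le> 16 / real k"
          by (rule order_trans[OF Phi_split tail])
        have p2: "\<bar>(?h (?x' + real i * alpha) - ?h ?x') - Phi i ?x'\<bar> \<le> 16 / real k"
          using order_trans[OF Phi_split[of i ?x' "Suc n"] tail] by (simp add: abs_minus_commute)
        have "Phi i ?x - Phi i ?x' = ((Phi i ?x - (?h (?x + real i * alpha) - ?h ?x)) +
            (?h (?x + real i * alpha) - ?h (?x' + real i * alpha)) + (?h ?x' - ?h ?x)) +
            ((?h (?x' + real i * alpha) - ?h ?x') - Phi i ?x')"
          by simp
        then have "\<bar>Phi i ?x - Phi i ?x'\<bar> \<le> (16 / real k + 5 / real k + 5 / real k) + 16 / real k"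
          using order_trans[OF abs_triangle_ineq add_mono[OF abs_sum3_le[OF p1 l1 l2] p2]] by (simp only:)
        then show ?thesis by simp
      qed
      have "\<bar>(snd z + real i * beta + Phi i (fst z)) - (snd z' + real i * beta + Phi i (fst z'))\<bar> \<le>
          \<bar>snd z - snd z'\<bar> + \<bar>Phi i (fst z) - Phi i (fst z')\<bar>"
        by linarith
      also have "\<dots> \<le> 1 / real k + 42 / real k"
        by (rule add_mono[OF y Phi])
      also have "\<dots> \<le> d" using kd by simp
      finally have n2: "circle_near d (snd ((T ^^ i) z)) (snd ((T ^^ i) z'))"
        unfolding T_pow[OF zt(1)] T_pow[OF zt(2)] by (simp add: circle_near_abs)
      show "cell_index X ((T ^^ i) z) = cell_index X ((T ^^ i) z')"
        by (rule d(2)[OF zK n1 n2])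
    qed
  qed
  then show ?thesis using k by blast
qed

section \<open>Lower bound from separated boxes\<close>

text \<open>Four strips suffice: a vertical displacement by about \<open>1/2\<close> always changes the strip.\<close>

definition strips :: "(real \<times> real) set list" where
  "strips = map (\<lambda>v. {0..<1} \<times> {real v / 4..<real (Suc v) / 4}) [0..<4]"

lemma strips_partition: "strips \<in> finite_measurable_partitions torus_measure"
proof -
  let ?S = "\<lambda>v. {0..<1::real} \<times> {real v / 4..<real (Suc v) / 4}"
  have inj: "inj_on ?S {0..<4}"
  proof (rule inj_onI)
    fix u v assume "?S u = ?S v"
    moreover have "(0, real u / 4) \<in> ?S u" "(0, real v / 4) \<in> ?S v" by auto
    ultimately have "(0, real u / 4) \<in> ?S v" "(0, real v / 4) \<in> ?S u" by simp_all
    then show "u = v" by auto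
  qed
  have set: "set strips = ?S ` {0..<4}" by (simp add: strips_def)
  have "distinct strips"
    using inj by (simp add: strips_def distinct_map)
  moreover have "set strips \<subseteq> sets torus_measure"
  proof -
    have "?S v \<in> sets torus_measure" if "v < 4" for v
    proof -
      have "?S v \<subseteq> torus" using that by (auto simp: torus_def)
      moreover have "?S v \<in> sets borel" by (intro borel_Times) auto
      ultimately show ?thesis by (simp add: sets_torus_measure)
    qed
    then show ?thesis unfolding set by auto
  qed
  moreover have "partition_on torus (set strips)"
  proof (rule partition_onI)
    show "\<Union>(set strips) = torus"
    proof (intro equalityI subsetI)
      fix z assume z: "z \<in> torus"
      define v where "v = nat \<lfloor>4 * snd z\<rfloor>"
      have "0 \<le> 4 * snd z" "4 * snd z < 4" using z by (auto simp: torus_def)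
      then have "v < 4" "real v \<le> 4 * snd z" "4 * snd z < real v + 1"
        by (auto simp: v_def nat_less_iff floor_less_iff)
      then have "z \<in> ?S v" using z by (auto simp: torus_def)
      then show "z \<in> \<Union>(set strips)" unfolding set using \<open>v < 4\<close> by auto
    qed (auto simp: set torus_def)
    show "disjnt S S'" if S: "S \<in> set strips" "S' \<in> set strips" "S \<noteq> S'" for S S'
    proof (rule ccontr)
      assume "\<not> disjnt S S'"
      then obtain z where z: "z \<in> S" "z \<in> S'" by (auto simp: disjnt_def)
      obtain u v where uv: "S = ?S u" "S' = ?S v" using S unfolding set by auto
      then have "u = v" using z by auto
      then show False using uv S by simp
    qed
    have "?S v \<noteq> {}" for v
    proof -
      have "(0, real v / 4) \<in> ?S v" by auto
      then show ?thesis by blast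
    qed
    then show "{} \<notin> set strips" unfolding set by (metis (no_types, lifting) imageE)
  qed
  ultimately show ?thesis by (simp add: finite_measurable_partitions_def)
qed

lemma strips_index_near:
  assumes z: "z \<in> torus" "z' \<in> torus" and eq: "cell_index strips z = cell_index strips z'"
  shows "\<bar>snd z - snd z'\<bar> < 1/4"
proof -
  define v where "v = cell_index strips z"
  have "v < length strips" "z \<in> strips ! v" "z' \<in> strips ! v"
    using cell_index_props[OF strips_partition, of z] cell_index_props[OF strips_partition, of z'] z eq
    by (auto simp: v_def)
  then have "z \<in> {0..<1} \<times> {real v / 4..<real (Suc v) / 4}" "z' \<in> {0..<1} \<times> {real v / 4..<real (Suc v) / 4}"
    by (auto simp: strips_def)
  then have "real v / 4 \<le> snd z" "snd z < real v / 4 + 1/4" "real v / 4 \<le> snd z'" "snd z' < real v / 4 + 1/4"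
    by (auto simp: add_divide_distrib)
  then show ?thesis by linarith
qed

text \<open>In period \<open>k\<close> of \<open>g n\<close>, the initial sixteenth of letter
  \<open>j\<close>, at height \<open>v\<close>. The width 1/16 keeps the start in the zero part of
  the bump and, after a shift by between 1/4 and 11/16 of a letter, on the plateau. The pair
  \<open>(k, v)\<close> selects a stack, \<open>j\<close> a box in it.\<close>

definition tower_box :: "nat \<Rightarrow> nat \<times> nat \<Rightarrow> nat \<Rightarrow> (real \<times> real) set" where
  "tower_box n = (\<lambda>(k, v) j.
     {(real k + real j / real (R n)) / real (Q n)..<(real k + (real j + 1/16) / real (R n)) / real (Q n)} \<times>
     {real v / 16..<real (Suc v) / 16})"

lemma tower_box_decode:
  assumes "(x, y) \<in> tower_box n (k, v) j" "j < R n"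
  shows "\<exists>t. 0 \<le> t \<and> t < 1/16 \<and> x = (real k + (real j + t) / real (R n)) / real (Q n)"
    and "real v / 16 \<le> y" "y < real (Suc v) / 16"
    and "real k \<le> real (Q n) * x" "real (Q n) * x < real k + 1"
proof -
  have R: "0 < real (R n)" and Q: "0 < real (Q n)" using R_pos[of n] Q_pos[of n] by auto
  define t where "t = (real (Q n) * x - real k) * real (R n) - real j"
  have xeq: "x = (real k + (real j + t) / real (R n)) / real (Q n)"
    using R Q by (simp add: t_def)
  have "(real k + real j / real (R n)) / real (Q n) \<le> x" "x < (real k + (real j + 1/16) / real (R n)) / real (Q n)"
    using assms by (auto simp: tower_box_def)
  then have "real j / real (R n) \<le> (real j + t) / real (R n)"
    "(real j + t) / real (R n) < (real j + 1/16) / real (R n)"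
    using Q unfolding xeq by (auto simp: divide_le_cancel divide_less_cancel)
  then have t: "0 \<le> t" "t < 1/16"
    using R by (auto simp: divide_le_cancel divide_less_cancel)
  then show "\<exists>t. 0 \<le> t \<and> t < 1/16 \<and> x = (real k + (real j + t) / real (R n)) / real (Q n)"
    using xeq by blast
  show "real v / 16 \<le> y" "y < real (Suc v) / 16"
    using assms by (auto simp: tower_box_def)
  have "real (Q n) * x = real k + (real j + t) / real (R n)"
    using Q by (simp add: xeq)
  moreover have "real j + 1 \<le> real (R n)" using assms(2) by simp
  then have "(real j + t) / real (R n) < 1" "0 \<le> (real j + t) / real (R n)"
    using t R by auto
  ultimately show "real k \<le> real (Q n) * x" "real (Q n) * x < real k + 1" by auto
qed

lemma tower_box_in_sets:
  assumes "k < Q n" "v < 16" "j < R n"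
  shows "tower_box n (k, v) j \<in> sets torus_measure"
    "measure torus_measure (tower_box n (k, v) j) = 1 / (256 * (real (R n) * real (Q n)))"
proof -
  have R: "0 < real (R n)" and Q: "0 < real (Q n)" using R_pos[of n] Q_pos[of n] by auto
  have sub: "tower_box n (k, v) j \<subseteq> torus"
  proof
    fix z assume z: "z \<in> tower_box n (k, v) j"
    obtain x y where xy: "z = (x, y)" by fastforce
    note d = tower_box_decode[OF z[unfolded xy] assms(3)]
    have "real k + 1 \<le> real (Q n)" using assms(1) by simp
    then have "real (Q n) * 0 \<le> real (Q n) * x" "real (Q n) * x < real (Q n) * 1"
      using d(4,5) by linarith+
    then have "0 \<le> x" "x < 1"
      using Q by (metis mult_le_cancel_left_pos, metis mult_less_cancel_left_pos)
    moreover have "real (Suc v) \<le> 16" using assms(2) by simp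
    then have "0 \<le> y" "y < 1" using d(2,3) by auto
    ultimately show "z \<in> torus" by (simp add: xy torus_def)
  qed
  show s: "tower_box n (k, v) j \<in> sets torus_measure"
    using sub by (auto simp: sets_torus_measure tower_box_def intro!: borel_Times)
  have w: "(real k + (real j + 1/16) / real (R n)) / real (Q n) - (real k + real j / real (R n)) / real (Q n) =
      1 / (16 * (real (R n) * real (Q n)))"
    using R Q by (simp add: field_simps)
  have "emeasure torus_measure (tower_box n (k, v) j) = emeasure lborel (tower_box n (k, v) j)"
    by (rule emeasure_torus_measure[OF s])
  also have "\<dots> = ennreal (1 / (16 * (real (R n) * real (Q n)))) * ennreal (1 / 16)"
  proof -
    have le: "(real k + real j / real (R n)) / real (Q n) \<le> (real k + (real j + 1/16) / real (R n)) / real (Q n)"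
      using R Q by (intro divide_right_mono add_left_mono) auto
    have I1: "emeasure lborel {(real k + real j / real (R n)) / real (Q n)..<
        (real k + (real j + 1/16) / real (R n)) / real (Q n)} = ennreal (1 / (16 * (real (R n) * real (Q n))))"
      using le by (simp only: emeasure_lborel_Ico w)
    have "real v / 16 \<le> real (Suc v) / 16" "real (Suc v) / 16 - real v / 16 = (1/16 :: real)"
      by (simp_all add: add_divide_distrib)
    then have I2: "emeasure lborel {real v / 16..<real (Suc v) / 16} = ennreal (1/16)"
      by (simp only: emeasure_lborel_Ico)
    show ?thesis
      unfolding tower_box_def split by (subst emeasure_lborel_Times) (simp_all only: I1 I2 atLeastLessThan_borel)
  qed
  also have "\<dots> = ennreal (1 / (256 * (real (R n) * real (Q n))))"
    using R Q by (subst ennreal_mult[symmetric]) auto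
  finally show "measure torus_measure (tower_box n (k, v) j) = 1 / (256 * (real (R n) * real (Q n)))"
    using R Q by (simp add: measure_def)
qed

lemma tower_box_disjoint: "disjoint_family_on (\<lambda>(i, j). tower_box n i j) (({..<Q n} \<times> {..<16}) \<times> {..<R n})"
proof (unfold disjoint_family_on_def, intro ballI impI, rule ccontr)
  fix a b assume ab: "a \<in> ({..<Q n} \<times> {..<16}) \<times> {..<R n}" "b \<in> ({..<Q n} \<times> {..<16}) \<times> {..<R n}" "a \<noteq> b"
    "(case a of (i, j) \<Rightarrow> tower_box n i j) \<inter> (case b of (i, j) \<Rightarrow> tower_box n i j) \<noteq> {}"
  obtain k v j where a: "a = ((k, v), j)" by (metis surj_pair)
  obtain k' v' j' where b: "b = ((k', v'), j')" by (metis surj_pair)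
  obtain x y where xy: "(x, y) \<in> tower_box n (k, v) j" "(x, y) \<in> tower_box n (k', v') j'"
    using ab(4) unfolding a b by auto
  have j: "j < R n" "j' < R n" using ab a b by auto
  note d = tower_box_decode[OF xy(1) j(1)] and d' = tower_box_decode[OF xy(2) j(2)]
  have "v = v'" using d(2,3) d'(2,3) by auto
  moreover have k: "k = k'" using d(4,5) d'(4,5) by linarith
  moreover have "j = j'"
  proof -
    obtain t t' where t: "0 \<le> t" "t < 1/16" "0 \<le> t'" "t' < 1/16"
      "(real k + (real j + t) / real (R n)) / real (Q n) = (real k + (real j' + t') / real (R n)) / real (Q n)"
      using d(1) d'(1) k by metis
    then have "real j + t = real j' + t'"
      using R_pos[of n] Q_pos[of n] by simp
    then show ?thesis using t by linarith
  qed
  ultimately show False using ab(3) a b by simp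
qed

text \<open>Two points of the same stack of boxes differ only in the window of the word that they read at
  stage \<open>n\<close>. Where the windows differ, their vertical distance is close to \<open>1/2\<close>; the earlier
  stages are nearly constant on the stack and the later ones have not yet been activated.\<close>

lemma tower_box_separated_step:
  assumes j: "j + l < R n" "j' + l < R n" and k: "k < Q n" and v: "v < 16" and L: "L \<le> R n" and l: "l < L"
    and z: "z \<in> tower_box n (k, v) j" "z' \<in> tower_box n (k, v) j'"
    and r: "B n \<le> 4 * r" "16 * r < 11 * B n"
    and w: "w n (j + l) \<noteq> w n (j' + l)"
  shows "cell_index strips ((T ^^ (l * B n + r)) z) \<noteq> cell_index strips ((T ^^ (l * B n + r)) z')"
proof
  assume eq: "cell_index strips ((T ^^ (l * B n + r)) z) = cell_index strips ((T ^^ (l * B n + r)) z')"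
  define i where "i = l * B n + r"
  have RR: "1 \<le> real (R n)" and QQ: "1 \<le> real (Q n)" and BB: "0 < real (B n)"
    using R_pos[of n] Q_pos[of n] B_pos[of n] by (simp_all add: Suc_le_eq)
  have jR: "j < R n" "j' < R n" using j by auto
  have zt: "z \<in> torus" "z' \<in> torus"
    using tower_box_in_sets(1)[OF k v] jR z by (auto simp: sets_torus_measure)
  let ?x = "fst z" and ?y = "snd z" and ?x' = "fst z'" and ?y' = "snd z'"
  obtain t where t: "0 \<le> t" "t < 1/16" "?x = (real k + (real j + t) / real (R n)) / real (Q n)"
    using tower_box_decode(1)[of ?x ?y n k v j] z jR by auto
  obtain t' where t': "0 \<le> t'" "t' < 1/16" "?x' = (real k + (real j' + t') / real (R n)) / real (Q n)"
    using tower_box_decode(1)[of ?x' ?y' n k v j'] z jR by auto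
  have y: "\<bar>?y' - ?y\<bar> \<le> 1/16"
  proof -
    have "real v / 16 \<le> ?y" "?y < real v / 16 + 1/16" "real v / 16 \<le> ?y'" "?y' < real v / 16 + 1/16"
      using tower_box_decode(2,3)[of ?x ?y n k v j] tower_box_decode(2,3)[of ?x' ?y' n k v j'] z jR
      by (simp_all add: add_divide_distrib)
    then show ?thesis by linarith
  qed
  have xx: "\<bar>?x' - ?x\<bar> \<le> 1 / real (Q n)"
  proof -
    have "\<bar>real (Q n) * ?x' - real (Q n) * ?x\<bar> \<le> 1"
      using tower_box_decode(4,5)[of ?x ?y n k v j] tower_box_decode(4,5)[of ?x' ?y' n k v j'] z jR by auto
    then have "real (Q n) * \<bar>?x' - ?x\<bar> \<le> 1"
      by (simp add: abs_mult flip: right_diff_distrib)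
    then show ?thesis using QQ by (simp add: field_simps)
  qed
  have iB: "real i \<le> real (R n) * real (B n)"
  proof -
    have "r < B n" using r by linarith
    then have "i \<le> Suc l * B n" by (simp add: i_def)
    also have "\<dots> \<le> R n * B n" using l L by (intro mult_le_mono) auto
    finally show ?thesis by (metis of_nat_le_iff of_nat_mult)
  qed
  have QS: "real (Q (Suc n)) = real (Q n) * real (B n) * real (R n)"
    by (simp add: Q_Suc)
  have BS: "4096 * real (Q (Suc n)) \<le> real (B (Suc n))"
  proof -
    have "4 * real (Q (Suc n)) \<le> 4 ^ Suc n * real (Q (Suc n))"
      using one_le_power[of "4::real" n] by (intro mult_right_mono) auto
    then show ?thesis using B_ge'[of "Suc n"] by linarith
  qed
  have RB: "real (R n) * real (B n) \<le> real (Q (Suc n))"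
    using mult_right_mono[OF QQ, of "real (B n) * real (R n)"] by (simp add: QS mult_ac)
  have tail: "16 * real i / real (B (Suc n)) \<le> 1/256"
  proof -
    have "16 * real i * 256 \<le> real (B (Suc n))"
      using iB RB BS by linarith
    then show ?thesis using B_pos[of "Suc n"] by (simp add: field_simps)
  qed
  \<comment> \<open>The displacement due to the angles beyond \<open>1 / Q (Suc n)\<close>, measured
    in letters. The angle \<open>1 / Q (Suc n)\<close> itself advances the word by one letter in
    \<open>B n\<close> steps.\<close>
  define e where "e = real (R n * Q n) * (real i * liouville_tail Q (Suc n))"
  have e0: "0 \<le> e" unfolding e_def using Qc.tail_nonneg by simp
  have e1: "e \<le> 1/2048"
  proof -
    have "e \<le> real (R n * Q n) * (real i * (2 / (real (Q (Suc n)) * real (B (Suc n)) * real (R (Suc n)))))"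
      unfolding e_def using tail_Q_le[of "Suc n"] by (intro mult_left_mono) auto
    also have "\<dots> \<le> real (R n * Q n) * ((real (R n) * real (B n)) * (2 / (real (Q (Suc n)) * real (B (Suc n)) * real (R (Suc n)))))"
      using iB by (intro mult_left_mono mult_right_mono) auto
    also have "\<dots> = 2 * real (R n) / (real (B (Suc n)) * real (R (Suc n)))"
      using RR QQ BB by (simp add: QS field_simps)
    also have "\<dots> \<le> 2 * real (R n) / real (B (Suc n))"
      using B_pos[of "Suc n"] R_pos[of "Suc n"]
      by (intro divide_left_mono) (auto simp: Suc_le_eq)
    also have "\<dots> \<le> 1/2048"
    proof -
      have "real (R n) * 1 \<le> real (R n) * (real (Q n) * real (B n))"
      proof (intro mult_left_mono)
        have "1 \<le> real (B n)" using B_pos[of n] by (simp add: Suc_le_eq)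
        then show "1 \<le> real (Q n) * real (B n)" using QQ mult_mono[of 1 "real (Q n)" 1 "real (B n)"] by simp
      qed simp
      then have "real (R n) \<le> real (Q (Suc n))" by (simp add: QS mult_ac)
      then have "2 * real (R n) * 2048 \<le> real (B (Suc n))" using BS by linarith
      then show ?thesis using B_pos[of "Suc n"] by (simp add: field_simps)
    qed
    finally show ?thesis .
  qed
  obtain p :: int where p: "\<And>i. real i * alpha = of_int (int i * p) / real (Q n) + real i * liouville_tail Q n"
    using Qc.multiple_approx[of n] unfolding alpha_def by metis
  \<comment> \<open>At time \<open>l * B n + r\<close> a point that started in letter
    \<open>jj\<close> stands in letter \<open>jj + l\<close>, on the middle half where a set bit has
    its plateau.\<close>
  have val: "g n (xx + real i * alpha) \<in> {of_bool (w n (jj + l)) / 2 - 1/256..of_bool (w n (jj + l)) / 2 + 1/256}"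
    and zero: "g n xx = 0"
    if xj: "xx = (real k + (real jj + s) / real (R n)) / real (Q n)" "0 \<le> s" "s < 1/16" "jj + l < R n" for xx jj s
  proof -
    have RQx: "real (R n * Q n) * xx = real jj + s + of_int (int k) * real (R n)"
      using RR QQ by (simp add: xj(1) field_simps)
    have m: "nat (\<lfloor>real c + u\<rfloor> mod int (R n)) = c" "frac (real c + u) = u"
      if "0 \<le> u" "u < 1" "c < R n" for c u
    proof -
      have "\<lfloor>real c + u\<rfloor> = int c" using that by (simp add: floor_unique)
      then show "nat (\<lfloor>real c + u\<rfloor> mod int (R n)) = c" "frac (real c + u) = u"
        using that by (simp_all add: frac_def)
    qed
    have "g n xx = bump_word (R n) (w n) (real jj + s)"
      unfolding g_def RQx by (rule bump_word_periodic)
    also have "\<dots> = 0"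
      using m[of s jj] xj by (simp add: bump_word_def bump_zero)
    finally show "g n xx = 0" .
    define u where "u = s + real r / real (B n)"
    have u: "1/4 \<le> u" "u \<le> 3/4"
    proof -
      have "real (B n) \<le> 4 * real r" "16 * real r \<le> 11 * real (B n)"
        using r by linarith+
      then have "1/4 \<le> real r / real (B n)" "real r / real (B n) \<le> 11/16"
        using BB by (simp_all add: field_simps)
      then show "1/4 \<le> u" "u \<le> 3/4" using xj(2,3) unfolding u_def by linarith+
    qed
    have tl: "liouville_tail Q n = 1 / (real (Q n) * real (B n) * real (R n)) + liouville_tail Q (Suc n)"
      using Qc.tail_Suc[of n] by (simp add: QS)
    have "real (R n * Q n) * (real i * alpha) = of_int (int i * p) * real (R n) + real i / real (B n) + e"
      unfolding p tl e_def using RR QQ BB by (simp add: field_simps)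
    moreover have "real i / real (B n) = real l + real r / real (B n)"
      using BB by (simp add: i_def field_simps)
    ultimately have "real (R n * Q n) * (xx + real i * alpha) =
        (real (jj + l) + u + e) + of_int (int k + int i * p) * real (R n)"
      unfolding distrib_left RQx by (simp add: u_def algebra_simps)
    then have "g n (xx + real i * alpha) = bump_word (R n) (w n) (real (jj + l) + u + e)"
      unfolding g_def by (simp only: bump_word_periodic)
    moreover have "bump_word (R n) (w n) (real (jj + l) + u) = of_bool (w n (jj + l)) / 2"
      using m[of u "jj + l"] u xj(4) unfolding bump_word_def by (simp add: bump_plateau)
    moreover have "\<bar>bump_word (R n) (w n) (real (jj + l) + u + e) - bump_word (R n) (w n) (real (jj + l) + u)\<bar> \<le> 4 * e"
      using bump_word_lipschitz[of "R n" "w n" "real (jj + l) + u + e" "real (jj + l) + u"] e0 by simp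
    ultimately have "\<bar>g n (xx + real i * alpha) - of_bool (w n (jj + l)) / 2\<bar> \<le> 4 * e" by simp
    then show "g n (xx + real i * alpha) \<in> {of_bool (w n (jj + l)) / 2 - 1/256..of_bool (w n (jj + l)) / 2 + 1/256}"
      using e1 by (auto simp: abs_le_iff)
  qed
  note v1 = val[OF t(3,1,2) j(1)] and v2 = val[OF t'(3,1,2) j(2)]
  note z1 = zero[OF t(3,1,2) j(1)] and z2 = zero[OF t'(3,1,2) j(2)]
  let ?Y = "?y + real i * beta + Phi i ?x" and ?Y' = "?y' + real i * beta + Phi i ?x'"
  have hn: "\<bar>hsum n a' - hsum n a\<bar> \<le> 1/128" if "\<bar>a' - a\<bar> \<le> 1 / real (Q n)" for a a'
  proof -
    have "\<bar>hsum n a' - hsum n a\<bar> \<le> real (Q n) / 128 * (1 / real (Q n))"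
      by (rule hsum_near[OF circle_near_abs[OF that]])
    then show ?thesis using QQ by simp
  qed
  have h1: "\<bar>hsum n (?x' + real i * alpha) - hsum n (?x + real i * alpha)\<bar> \<le> 1/128"
    using xx by (intro hn) simp
  have h2: "\<bar>hsum n ?x' - hsum n ?x\<bar> \<le> 1/128"
    by (rule hn[OF xx])
  have P1: "\<bar>Phi i ?x - (hsum n (?x + real i * alpha) + g n (?x + real i * alpha) - hsum n ?x)\<bar> \<le> 1/256"
    using order_trans[OF Phi_split[of i ?x "Suc n"] tail] z1 by (simp add: hsum_def)
  have P2: "\<bar>Phi i ?x' - (hsum n (?x' + real i * alpha) + g n (?x' + real i * alpha) - hsum n ?x')\<bar> \<le> 1/256"
    using order_trans[OF Phi_split[of i ?x' "Suc n"] tail] z2 by (simp add: hsum_def)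
  define D where "D = of_bool (w n (j' + l)) / 2 - of_bool (w n (j + l)) / (2::real)"
  have D: "D = 1/2 \<or> D = -1/2" using w by (auto simp: D_def)
  have G: "\<bar>(g n (?x' + real i * alpha) - g n (?x + real i * alpha)) - D\<bar> \<le> 1/128"
    using v1[unfolded atLeastAtMost_iff] v2[unfolded atLeastAtMost_iff] unfolding D_def by linarith
  \<comment> \<open>The heights cost 1/16, the early stages 1/128 at the start and at the end, the
    two readings together 1/128, the late stages 1/256 for each point: 12/128 in all.\<close>
  have dist: "\<bar>(?Y' - ?Y) - D\<bar> \<le> 1/8"
    using y h1 h2 P1 P2 G by (simp only: abs_le_iff) linarith
  have near: "\<bar>snd ((T ^^ i) z) - snd ((T ^^ i) z')\<bar> < 1/4"
    using strips_index_near[OF _ _ eq[folded i_def]] mp.T_pow_space zt by simp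
  then have "\<bar>frac ?Y - frac ?Y'\<bar> < 1/4"
    unfolding T_pow[OF zt(1)] T_pow[OF zt(2)] by simp
  define m where "m = \<lfloor>?Y'\<rfloor> - \<lfloor>?Y\<rfloor>"
  \<comment> \<open>No integer lies within 3/8 of 1/2 or of -1/2.\<close>
  have "\<bar>D - of_int m\<bar> < 3/8"
    using dist \<open>\<bar>frac ?Y - frac ?Y'\<bar> < 1/4\<close> unfolding frac_def m_def
    by (simp only: abs_less_iff abs_le_iff of_int_diff) linarith
  then have "(0 < real_of_int m \<and> real_of_int m < 1) \<or> (-1 < real_of_int m \<and> real_of_int m < 0)"
    using D by (simp only: abs_less_iff) linarith
  then show False by auto
qed

text \<open>A differing bit shows during the 7/16 of its time slot between \<open>B n / 4\<close>
  and \<open>11 * B n / 16\<close>, and at least one eighth of the bits differ; the product is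
  7/128.\<close>

lemma tower_box_separated:
  assumes L: "0 < L" "L \<le> R n"
    and sep: "\<And>j j'. j < j' \<Longrightarrow> j' + L \<le> R n \<Longrightarrow> L \<le> 8 * card {l \<in> {..<L}. w n (j + l) \<noteq> w n (j' + l)}"
    and k: "k < Q n" and v: "v < 16" and j: "j < j'" "j' < R n - L"
    and z: "z \<in> tower_box n (k, v) j" "z' \<in> tower_box n (k, v) j'"
  shows "7/128 \<le> hamming_dist (L * B n) (name strips T (L * B n) z) (name strips T (L * B n) z')"
proof -
  obtain c where c: "B n = 16 * c" using sixteen_dvd_B[of n] by (auto simp: dvd_def)
  have c0: "0 < c" using c B_pos[of n] by simp
  define S where "S = {l \<in> {..<L}. w n (j + l) \<noteq> w n (j' + l)}"
  have S: "L \<le> 8 * card S" unfolding S_def using j by (intro sep) auto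
  define Bad where "Bad = {i \<in> {..<L * B n}. cell_index strips ((T ^^ i) z) \<noteq> cell_index strips ((T ^^ i) z')}"
  let ?h = "\<lambda>(l, r). l * B n + r"
  have inj: "inj_on ?h (S \<times> {4 * c..<11 * c})"
  proof (rule inj_onI)
    fix a b assume ab: "a \<in> S \<times> {4 * c..<11 * c}" "b \<in> S \<times> {4 * c..<11 * c}" "?h a = ?h b"
    obtain l r l' r' where lr: "a = (l, r)" "b = (l', r')" by (metis surj_pair)
    have lt: "r < B n" "r' < B n" using ab lr c by auto
    have eq: "l * B n + r = l' * B n + r'" using ab(3) lr by simp
    have "(l * B n + r) mod B n = (l' * B n + r') mod B n" by (simp only: eq)
    then have "r = r'" using lt by simp
    with eq show "a = b" using lr B_pos[of n] by simp
  qed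
  have "?h ` (S \<times> {4 * c..<11 * c}) \<subseteq> Bad"
  proof
    fix i assume "i \<in> ?h ` (S \<times> {4 * c..<11 * c})"
    then obtain l r where lr: "l \<in> S" "4 * c \<le> r" "r < 11 * c" "i = l * B n + r" by auto
    have l: "l < L" "w n (j + l) \<noteq> w n (j' + l)" using lr by (auto simp: S_def)
    have "cell_index strips ((T ^^ (l * B n + r)) z) \<noteq> cell_index strips ((T ^^ (l * B n + r)) z')"
      using j l(1) lr c by (intro tower_box_separated_step[OF _ _ k v L(2) l(1) z _ _ l(2)]) auto
    moreover have "i < Suc l * B n" using lr c by simp
    then have "i < L * B n"
      using mult_le_mono1[of "Suc l" L "B n"] l(1) by simp
    ultimately show "i \<in> Bad" using lr by (simp add: Bad_def)
  qed
  then have "card (?h ` (S \<times> {4 * c..<11 * c})) \<le> card Bad"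
    by (intro card_mono) (auto simp: Bad_def)
  then have "card S * (7 * c) \<le> card Bad"
    by (simp add: card_image[OF inj] card_cartesian_product)
  moreover have "L * (7 * c) \<le> 8 * card S * (7 * c)"
    using S by (rule mult_le_mono1)
  ultimately have "7 * (L * c) \<le> 8 * card Bad" by linarith
  then have "7 * (real L * real c) \<le> 8 * real (card Bad)"
    by (metis of_nat_le_iff of_nat_mult of_nat_numeral)
  then have "7/128 * real (L * B n) \<le> real (card Bad)"
    by (simp add: c)
  then show ?thesis
    unfolding hamming_dist_name Bad_def[symmetric] using L(1) B_pos[of n]
    by (simp add: pos_le_divide_eq)
qed

text \<open>Starting letters are restricted to \<open>j < R n - L\<close>, so that windows do not
  run over the end of the word; \<open>2 * L \<le> R n\<close> keeps at least half of them. The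
  boxes then fill measure at least 1/32, which \<open>2 * e\<close> does not exceed for
  \<open>e\<close> up to 1/64, and 1/32 is also below the separation 7/128.\<close>

lemma covering_number_T_lower:
  assumes L: "0 < L" "2 * L \<le> R n"
    and sep: "\<And>j j'. j < j' \<Longrightarrow> j' + L \<le> R n \<Longrightarrow> L \<le> 8 * card {l \<in> {..<L}. w n (j + l) \<noteq> w n (j' + l)}"
    and e: "0 < e" "e \<le> 1/64"
  shows "real (R n) \<le> 4 * real (covering_number torus_measure strips T (L * B n) e)"
proof -
  let ?I = "{..<Q n} \<times> {..<16::nat}" and ?J = "{..<R n - L}"
  let ?s = "1 / (256 * (real (R n) * real (Q n)))"
  have R: "0 < real (R n)" and Q: "0 < real (Q n)" using R_pos[of n] Q_pos[of n] by auto
  have half: "real (R n) \<le> 2 * real (R n - L)"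
    using L by (simp add: of_nat_diff)
  have "real (card ?J) \<le> 2 * real (covering_number torus_measure strips T (L * B n) e)"
  proof (rule mp.covering_number_lower[OF strips_partition e(1), where I = ?I and A = "tower_box n" and s = ?s])
    show "tower_box n i j \<in> sets torus_measure" "measure torus_measure (tower_box n i j) = ?s"
      if "i \<in> ?I" "j \<in> ?J" for i j
      using tower_box_in_sets[of "fst i" n "snd i" j] that by auto
    show "disjoint_family_on (\<lambda>(i, j). tower_box n i j) (?I \<times> ?J)"
      by (rule disjoint_family_on_mono[OF _ tower_box_disjoint[of n]]) auto
    have "2 * e \<le> 1/32" using e by simp
    also have "\<dots> \<le> real (R n - L) / (16 * real (R n))"
      using half R by (simp add: field_simps)
    also have "\<dots> = real (card ?I) * real (card ?J) * ?s"
      using R Q by (simp add: card_cartesian_product field_simps)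
    finally show "2 * e \<le> real (card ?I) * real (card ?J) * ?s" .
    fix i j j' z z'
    assume ij: "i \<in> ?I" "j \<in> ?J" "j' \<in> ?J" "j \<noteq> j'" and z: "z \<in> tower_box n i j" "z' \<in> tower_box n i j'"
    obtain k v where i: "i = (k, v)" "k < Q n" "v < 16" using ij(1) by auto
    have LR: "L \<le> R n" using L by simp
    have "7/128 \<le> hamming_dist (L * B n) (name strips T (L * B n) z) (name strips T (L * B n) z')"
    proof (cases "j < j'")
      case True
      then show ?thesis
        using ij z unfolding i(1)
        by (intro tower_box_separated[OF L(1) LR sep i(2,3)]) auto
    next
      case False
      then have "j' < j" using ij by simp
      then show ?thesis
        using ij z unfolding i(1)
        by (subst hamming_dist_commute, intro tower_box_separated[OF L(1) LR sep i(2,3)]) auto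
    qed
    then show "2 * e \<le> hamming_dist (L * B n) (name strips T (L * B n) z) (name strips T (L * B n) z')"
      using e by linarith
  qed auto
  then show ?thesis using half by simp
qed

end

section \<open>Slow entropy of the construction\<close>

context stages
begin

text \<open>Each large time \<open>m\<close> is assigned to a stage \<open>n\<close> with
  \<open>k * m\<close> between \<open>B n\<close> and \<open>B (Suc n)\<close>. There the covering
  number is at most \<open>k * k * R n * Q n\<close>, while \<open>m powr t\<close> is at least
  \<open>(B n / k) powr t\<close>; so the hypothesis on the stages controls all times.\<close>

lemma limsup_covering_T:
  assumes part: "X \<in> finite_measurable_partitions torus_measure" and e: "0 < e" and t: "0 < t"
    and conv: "(\<lambda>n. real (R n * Q n) / real (B n) powr t) \<longlonglongrightarrow> 0"
  shows "limsup (\<lambda>m. ereal (real (covering_number torus_measure X T m e) / polynomial_scale m t)) \<le> 0"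
proof -
  obtain k :: nat where k: "0 < k"
    "\<And>n m. 0 < m \<Longrightarrow> k * m \<le> B (Suc n) \<Longrightarrow>
      covering_number torus_measure X T m e \<le> k * k * (R n * Q n)"
    using covering_number_T_upper[OF part e] by blast
  define c where "c = real (k * k) * real k powr t"
  have c: "0 < c" using k by (simp add: c_def)
  have "(\<lambda>m. real (covering_number torus_measure X T m e) / polynomial_scale m t) \<longlonglongrightarrow> 0"
  proof (rule LIMSEQ_I)
    fix r :: real assume r: "0 < r"
    obtain N where N: "\<And>n. n \<ge> N \<Longrightarrow> norm (real (R n * Q n) / real (B n) powr t - 0) < r / c"
      using LIMSEQ_D[OF conv, of "r / c"] r c by auto
    have "norm (real (covering_number torus_measure X T m e) / polynomial_scale m t - 0) < r"
      if m: "m \<ge> Suc (B N)" for m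
    proof -
      have m0: "0 < m" using m by simp
      have km: "m \<le> k * m" using k by simp
      have ex: "\<exists>n. k * m \<le> B (Suc n)"
      proof -
        have "k * m \<le> 2 ^ (k * m)" using less_exp[of "k * m"] by simp
        also have "\<dots> \<le> B 0 * 2 ^ Suc (k * m)" using B_pos[of 0] by (simp add: Suc_le_eq)
        also have "\<dots> \<le> B (0 + Suc (k * m))" by (rule B_growth)
        finally show ?thesis by auto
      qed
      define n where "n = (LEAST n. k * m \<le> B (Suc n))"
      have n1: "k * m \<le> B (Suc n)" unfolding n_def using ex by (rule LeastI_ex)
      have mono: "B i \<le> B j" if "i \<le> j" for i j
      proof -
        have "B i * 1 \<le> B i * 2 ^ (j - i)" by (intro mult_le_mono) auto
        also have "\<dots> \<le> B (i + (j - i))" by (rule B_growth)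
        finally show ?thesis using that by simp
      qed
      have nN: "N \<le> n"
      proof (rule ccontr)
        assume "\<not> N \<le> n"
        then have "B (Suc n) \<le> B N" by (intro mono) auto
        then show False using n1 m km by linarith
      qed
      have n2: "B n \<le> k * m"
      proof (cases n)
        \<comment> \<open>For \<open>n = 0\<close> minimality says nothing; the bound comes from
          \<open>m\<close> exceeding \<open>B N\<close> with \<open>N = 0\<close>.\<close>
        case 0
        then have "N = 0" using nN by simp
        then show ?thesis using m km 0 by (metis Suc_leD le_trans)
      next
        case (Suc n')
        have "\<not> k * m \<le> B (Suc n')"
          using not_less_Least[of n' "\<lambda>n. k * m \<le> B (Suc n)"] Suc unfolding n_def by simp
        then show ?thesis using Suc by simp
      qed
      have "real (covering_number torus_measure X T m e) \<le> real (k * k) * real (R n * Q n)"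
        using k(2)[OF m0 n1] by (metis of_nat_le_iff of_nat_mult)
      moreover have "real (B n) powr t \<le> real k powr t * real m powr t"
      proof -
        have "real (B n) \<le> real k * real m" using n2 by (metis of_nat_le_iff of_nat_mult)
        then have "real (B n) powr t \<le> (real k * real m) powr t" using t by (intro powr_mono2) auto
        then show ?thesis by (simp add: powr_mult)
      qed
      ultimately have "real (covering_number torus_measure X T m e) * real (B n) powr t \<le>
          (real (k * k) * real (R n * Q n)) * (real k powr t * real m powr t)"
        by (intro mult_mono) auto
      also have "\<dots> = c * real (R n * Q n) * real m powr t"
        by (simp add: c_def)
      finally have "real (covering_number torus_measure X T m e) / real m powr t \<le>
          c * (real (R n * Q n) / real (B n) powr t)"
        using m0 B_pos[of n] by (simp add: field_simps)
      also have "\<dots> < r"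
        using N[OF nN] c by (simp add: field_simps)
      finally show ?thesis
        by (simp add: polynomial_scale_def)
    qed
    then show "\<exists>M. \<forall>m\<ge>M. norm (real (covering_number torus_measure X T m e) / polynomial_scale m t - 0) < r"
      by blast
  qed
  then have "(\<lambda>m. ereal (real (covering_number torus_measure X T m e) / polynomial_scale m t)) \<longlonglongrightarrow> ereal 0"
    by simp
  then have "limsup (\<lambda>m. ereal (real (covering_number torus_measure X T m e) / polynomial_scale m t)) = ereal 0"
    by (intro lim_imp_Limsup) auto
  then show ?thesis by simp
qed

text \<open>At the times \<open>L n * B n\<close> the ratio is at least 1/4 by
  \<open>covering_number_T_lower\<close>; a limit superior notices this however sparse the times
  are.\<close>

lemma limsup_covering_strips:
  assumes e: "0 < e" "e < 1/64"
    and ev: "\<forall>\<^sub>F n in sequentially. 0 < L n \<and> 2 * L n \<le> R n \<and> real (L n * B n) powr t \<le> real (R n) \<and>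
      (\<forall>j j'. j < j' \<and> j' + L n \<le> R n \<longrightarrow> L n \<le> 8 * card {l \<in> {..<L n}. w n (j + l) \<noteq> w n (j' + l)})"
  shows "0 < limsup (\<lambda>m. ereal (real (covering_number torus_measure strips T m e) / polynomial_scale m t))"
proof (rule ccontr)
  assume "\<not> ?thesis"
  then have "limsup (\<lambda>m. ereal (real (covering_number torus_measure strips T m e) / polynomial_scale m t)) \<le> 0"
    by (simp only: not_less)
  also have "(0 :: ereal) < ereal (1/4)" by simp
  finally have "limsup (\<lambda>m. ereal (real (covering_number torus_measure strips T m e) / polynomial_scale m t)) < ereal (1/4)" .
  then have "\<forall>\<^sub>F m in sequentially. ereal (real (covering_number torus_measure strips T m e) / polynomial_scale m t) < ereal (1/4)"
    by (rule Limsup_lessD)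
  then obtain M where M: "\<And>m. m \<ge> M \<Longrightarrow> real (covering_number torus_measure strips T m e) / polynomial_scale m t < 1/4"
    unfolding eventually_sequentially by auto
  obtain N where N: "\<And>n. n \<ge> N \<Longrightarrow> 0 < L n \<and> 2 * L n \<le> R n \<and> real (L n * B n) powr t \<le> real (R n) \<and>
      (\<forall>j j'. j < j' \<and> j' + L n \<le> R n \<longrightarrow> L n \<le> 8 * card {l \<in> {..<L n}. w n (j + l) \<noteq> w n (j' + l)})"
    using ev unfolding eventually_sequentially by blast
  \<comment> \<open>\<open>B\<close> grows at least like \<open>2 ^ n\<close>, so this
    \<open>n\<close> gives a time \<open>L n * B n\<close> not before \<open>M\<close>.\<close>
  define n where "n = max N M"
  have n: "0 < L n" "2 * L n \<le> R n" "real (L n * B n) powr t \<le> real (R n)"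
    "\<And>j j'. j < j' \<Longrightarrow> j' + L n \<le> R n \<Longrightarrow> L n \<le> 8 * card {l \<in> {..<L n}. w n (j + l) \<noteq> w n (j' + l)}"
    using N[of n] by (auto simp: n_def)
  have "M \<le> n" by (simp add: n_def)
  also have "n \<le> 2 ^ n" using less_exp[of n] by simp
  also have "\<dots> \<le> B 0 * 2 ^ n" using B_pos[of 0] by (simp add: Suc_le_eq)
  also have "\<dots> \<le> B (0 + n)" by (rule B_growth)
  also have "\<dots> \<le> L n * B n" using n(1) by simp
  finally have "real (covering_number torus_measure strips T (L n * B n) e) / polynomial_scale (L n * B n) t < 1/4"
    by (rule M)
  moreover have pos: "0 < real (L n * B n) powr t" using n(1) B_pos[of n] by simp
  ultimately have "4 * real (covering_number torus_measure strips T (L n * B n) e) < real (L n * B n) powr t"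
    unfolding polynomial_scale_def by (simp add: pos_divide_less_eq)
  moreover have "real (R n) \<le> 4 * real (covering_number torus_measure strips T (L n * B n) e)"
    using e by (intro covering_number_T_lower n) auto
  ultimately show False using n(3) by linarith
qed

lemma upper_slow_entropy_T:
  assumes u: "0 \<le> u"
    and upper: "\<And>t. 0 < t \<Longrightarrow> u < ereal t \<Longrightarrow> (\<lambda>n. real (R n * Q n) / real (B n) powr t) \<longlonglongrightarrow> 0"
    and lower: "\<And>t. 0 < t \<Longrightarrow> ereal t < u \<Longrightarrow>
      \<forall>\<^sub>F n in sequentially. 0 < L n \<and> 2 * L n \<le> R n \<and> real (L n * B n) powr t \<le> real (R n) \<and>
      (\<forall>j j'. j < j' \<and> j' + L n \<le> R n \<longrightarrow> L n \<le> 8 * card {l \<in> {..<L n}. w n (j + l) \<noteq> w n (j' + l)})"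
  shows "upper_slow_entropy polynomial_scale torus_measure T = u"
proof (rule mp.upper_slow_entropy_eqI[OF u _ _ strips_partition, where ?e0.0 = "1/64"])
  show "0 \<le> polynomial_scale n t" for n t by (simp add: polynomial_scale_def)
  show "limsup (\<lambda>n. ereal (real (covering_number torus_measure X T n e) / polynomial_scale n t)) \<le> 0"
    if "X \<in> finite_measurable_partitions torus_measure" "0 < e" "0 < t" "u < ereal t" for X e t
    by (rule limsup_covering_T[OF that(1,2,3) upper[OF that(3,4)]])
  show "0 < limsup (\<lambda>n. ereal (real (covering_number torus_measure strips T n e) / polynomial_scale n t))"
    if "0 < e" "e < 1/64" "0 < t" "ereal t < u" for e t
    by (rule limsup_covering_strips[OF that(1,2) lower[OF that(3,4)]])
qed simp

end

section \<open>The choice of parameters\<close>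

text \<open>The exponents of \<open>Q n\<close> as powers of two. The exponent \<open>e\<close> of \<open>B n\<close> is so much larger that \<open>Q n\<close>
  is negligible against \<open>B n\<close>, and \<open>R n = 2 ^ F n e\<close> fixes the growth rate.\<close>

fun ladder :: "(nat \<Rightarrow> nat \<Rightarrow> nat) \<Rightarrow> nat \<Rightarrow> nat" where
  "ladder F 0 = 0"
| "ladder F (Suc n) = ladder F n + Suc n * (ladder F n + 2 * n + 10) + F n (Suc n * (ladder F n + 2 * n + 10))"

text \<open>7 is the least integer with \<open>4 * (4/5) ^ 7 < 1\<close>; with it windows of length
  \<open>7 * f\<close> satisfy the hypothesis of \<open>ex_separated_windows\<close> for words of
  length \<open>2 ^ f\<close>.\<close>

lemma ex_code: "\<exists>w :: nat \<Rightarrow> bool. 0 < f \<longrightarrow> (\<forall>j j'. j < j' \<and> j' + 7 * f \<le> 2 ^ f \<longrightarrow>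
      7 * f \<le> 8 * card {l \<in> {..<7 * f}. w (j + l) \<noteq> w (j' + l)})"
proof (cases "0 < f")
  case True
  have 2: "real (2 ^ f) ^ 2 = 4 ^ f"
    using power_mult[of "2::real" 2 f] power_mult[of "2::real" f 2] by (simp add: mult.commute)
  have "real (2 ^ f) ^ 2 * (4/5) ^ (7 * f) = (4 * (4/5) ^ 7) ^ f"
    unfolding 2 power_mult power_mult_distrib ..
  also have "\<dots> < 1"
  proof -
    have "(4 * (4/5) ^ 7 :: real) < 1" by (simp add: power_divide)
    then show ?thesis using True by (intro power_less_one_iff[THEN iffD2]) auto
  qed
  finally have "real (2 ^ f) ^ 2 * (4/5) ^ (7 * f) < 1" .
  from ex_separated_windows[OF this] show ?thesis by blast
qed simp

lemma ex_torus_example: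
  assumes u: "0 \<le> u"
  shows "\<exists>T. invertible_measure_preserving torus_measure T \<and> ergodic torus_measure T \<and>
    rigid torus_measure T \<and> upper_slow_entropy polynomial_scale torus_measure T = u"
proof -
  \<comment> \<open>\<open>R n\<close> is to be about \<open>B n\<close> to the power
    \<open>u\<close>; for infinite \<open>u\<close> the power \<open>n\<close> grows with the stage
    instead. For \<open>u = 0\<close> the words have length one and only the upper bound has
    content.\<close>
  define F where "F n e = (if u = \<infinity> then n * e else nat \<lfloor>real_of_ereal u * real e\<rfloor>)" for n e :: nat
  define a where "a = ladder F"
  \<comment> \<open>\<open>a n + 2 * n + 10\<close> is the exponent of
    \<open>1024 * 4 ^ n * Q n\<close>, as \<open>B_ge\<close> demands. The factor
    \<open>Suc n\<close> makes \<open>Q n\<close> at most \<open>B n\<close> to the power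
    \<open>1 / Suc n\<close>, which is negligible against every fixed positive power.\<close>
  define e where "e n = Suc n * (a n + 2 * n + 10)" for n
  define f where "f n = F n (e n)" for n
  define Q :: "nat \<Rightarrow> nat" where "Q n = 2 ^ a n" for n
  define B :: "nat \<Rightarrow> nat" where "B n = 2 ^ e n" for n
  define R :: "nat \<Rightarrow> nat" where "R n = 2 ^ f n" for n
  define w where "w n = (SOME v :: nat \<Rightarrow> bool. 0 < f n \<longrightarrow> (\<forall>j j'. j < j' \<and> j' + 7 * f n \<le> 2 ^ f n \<longrightarrow>
      7 * f n \<le> 8 * card {l \<in> {..<7 * f n}. v (j + l) \<noteq> v (j' + l)}))" for n
  have w: "0 < f n \<longrightarrow> (\<forall>j j'. j < j' \<and> j' + 7 * f n \<le> 2 ^ f n \<longrightarrow>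
      7 * f n \<le> 8 * card {l \<in> {..<7 * f n}. w n (j + l) \<noteq> w n (j' + l)})" for n
    unfolding w_def by (rule someI_ex[OF ex_code])
  have a0: "a 0 = 0" and aS: "a (Suc n) = a n + e n + f n" for n
    by (simp_all only: a_def e_def f_def ladder.simps)
  have en: "n \<le> e n" "a n + 2 * n + 10 \<le> e n" for n
  proof -
    have "Suc n * 1 \<le> e n" unfolding e_def by (intro mult_le_mono2) simp
    then show "n \<le> e n" by simp
    have "1 * (a n + 2 * n + 10) \<le> e n" unfolding e_def by (intro mult_le_mono1) simp
    then show "a n + 2 * n + 10 \<le> e n" by simp
  qed
  interpret stages Q B R w
  proof
    show "Q 0 = 1" by (simp add: Q_def a0)
    show "Q (Suc n) = Q n * B n * R n" for n
      by (simp add: Q_def B_def R_def aS power_add)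
    show "\<exists>k. B n = 2 ^ k" "\<exists>k. R n = 2 ^ k" for n by (auto simp: B_def R_def)
    show "1024 * 4 ^ n * Q n \<le> B n" for n
    proof -
      have "1024 * 4 ^ n * Q n = 2 ^ (a n + 2 * n + 10)"
        by (simp add: Q_def power_add power_mult)
      also have "\<dots> \<le> 2 ^ e n" using en by (intro power_increasing) auto
      finally show ?thesis by (simp add: B_def)
    qed
  qed
  have pow2: "real (2 ^ k) = 2 powr real k" for k by (simp add: powr_realpow)
  have "upper_slow_entropy polynomial_scale torus_measure T = u"
  proof (rule upper_slow_entropy_T[OF u, where L = "\<lambda>n. 7 * f n"])
    fix t :: real assume t: "0 < t" "u < ereal t"
    then obtain v where v: "u = ereal v" "0 \<le> v" "v < t"
      using u by (cases u) auto
    \<comment> \<open>One half of the gap between \<open>v\<close> and \<open>t\<close> absorbs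
      \<open>Q n\<close>, the other half gives the decay.\<close>
    define d where "d = (t - v) / 2"
    have d: "0 < d" using v by (simp add: d_def)
    have fle: "real (f n) \<le> v * real (e n)" for n
      using v by (simp add: f_def F_def)
    have ale: "real (a n) * real (Suc n) \<le> real (e n)" for n
    proof -
      have "a n * Suc n \<le> e n"
        unfolding e_def by (subst mult.commute, intro mult_le_mono2) simp
      then show ?thesis by (metis of_nat_le_iff of_nat_mult)
    qed
    have eq: "real (R n * Q n) / real (B n) powr t = 2 powr (real (f n) + real (a n) - t * real (e n))" for n
    proof -
      have "real (R n * Q n) = 2 powr (real (f n) + real (a n))"
        by (simp add: R_def Q_def pow2 powr_add flip: powr_realpow)
      moreover have "real (B n) powr t = 2 powr (t * real (e n))"
        by (simp add: B_def pow2 powr_powr mult.commute flip: powr_realpow)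
      ultimately show ?thesis by (simp add: powr_diff)
    qed
    have bound: "\<forall>\<^sub>F n in sequentially. real (R n * Q n) / real (B n) powr t \<le> 2 powr (- d * real n)"
    proof -
      obtain N :: nat where N: "1 / d < real N" using reals_Archimedean2 by blast
      have "real (R n * Q n) / real (B n) powr t \<le> 2 powr (- d * real n)" if n: "n \<ge> N" for n
      proof -
        have "1 / d < real (Suc n)" using N n by simp
        then have "1 \<le> d * real (Suc n)" using d by (simp add: field_simps)
        then have "real (a n) \<le> d * (real (a n) * real (Suc n))"
          using mult_left_mono[of 1 "d * real (Suc n)" "real (a n)"] by (simp add: mult_ac)
        also have "\<dots> \<le> d * real (e n)" using ale d by (intro mult_left_mono) auto
        finally have "real (f n) + real (a n) - t * real (e n) \<le> v * real (e n) + d * real (e n) - t * real (e n)"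
          using fle[of n] by linarith
        also have "\<dots> = - d * real (e n)" by (simp add: d_def field_simps)
        also have "\<dots> \<le> - d * real n" using d en(1)[of n] by simp
        finally show ?thesis unfolding eq by (intro powr_mono) auto
      qed
      then show ?thesis unfolding eventually_sequentially by blast
    qed
    show "(\<lambda>n. real (R n * Q n) / real (B n) powr t) \<longlonglongrightarrow> 0"
    proof (rule tendsto_sandwich[OF _ bound tendsto_const])
      show "\<forall>\<^sub>F n in sequentially. 0 \<le> real (R n * Q n) / real (B n) powr t" by simp
      show "(\<lambda>n. 2 powr (- d * real n)) \<longlonglongrightarrow> 0" using d by real_asymp
    qed
  next
    fix t :: real assume t: "0 < t" "ereal t < u"
    \<comment> \<open>The room between \<open>t\<close> and \<open>t'\<close> pays for the factor
      \<open>7 * f n\<close> in the time, which is logarithmic in \<open>R n\<close>.\<close>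
    obtain t' where t': "t < t'" "ereal t' < u"
      using ereal_dense2[OF t(2)] by auto
    have fge: "\<forall>\<^sub>F n in sequentially. t' * real (e n) \<le> real (f n)"
    proof (cases "u = \<infinity>")
      case True
      obtain N :: nat where N: "t' < real N" using reals_Archimedean2 by blast
      have "t' * real (e n) \<le> real (f n)" if "n \<ge> N" for n
      proof -
        have "t' * real (e n) \<le> real n * real (e n)" using N that by (intro mult_right_mono) auto
        then show ?thesis using True by (simp add: f_def F_def)
      qed
      then show ?thesis unfolding eventually_sequentially by blast
    next
      case False
      then obtain v where v: "u = ereal v" "t' < v" using t' u by (cases u) auto
      \<comment> \<open>The floor costs less than 1, which is made up for once
        \<open>(v - t') * e n\<close> reaches 1.\<close>
      obtain N :: nat where N: "1 / (v - t') < real N" using reals_Archimedean2 by blast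
      have "t' * real (e n) \<le> real (f n)" if n: "n \<ge> N" for n
      proof -
        have "1 / (v - t') < real (e n)" using N n en(1)[of n] by simp
        then have "1 \<le> (v - t') * real (e n)" using v by (simp add: field_simps)
        then have "t' * real (e n) \<le> v * real (e n) - 1" by (simp add: algebra_simps)
        also have "\<dots> \<le> real_of_int \<lfloor>v * real (e n)\<rfloor>" by linarith
        also have "\<dots> \<le> real (nat \<lfloor>v * real (e n)\<rfloor>)" by linarith
        finally show ?thesis using v by (simp add: f_def F_def)
      qed
      then show ?thesis unfolding eventually_sequentially by blast
    qed
    \<comment> \<open>\<open>R n\<close> is split into its powers with exponents \<open>c\<close>
      and \<open>t / t'\<close>: the former beats \<open>(7 * f n) powr t\<close>, the latter
      \<open>B n powr t\<close>.\<close>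
    define c where "c = 1 - t / t'"
    have c: "0 < c" using t t' by (simp add: c_def)
    have "filterlim (\<lambda>n. t' * real n) at_top sequentially"
      using t t' by real_asymp
    then have "filterlim (\<lambda>n. real (f n)) at_top sequentially"
    proof (rule filterlim_at_top_mono)
      show "\<forall>\<^sub>F n in sequentially. t' * real n \<le> real (f n)"
        using fge
      proof (rule eventually_mono)
        fix n assume "t' * real (e n) \<le> real (f n)"
        moreover have "t' * real n \<le> t' * real (e n)" using en(1)[of n] t t' by (intro mult_left_mono) auto
        ultimately show "t' * real n \<le> real (f n)" by simp
      qed
    qed
    note flim = this
    have "\<forall>\<^sub>F x in at_top. (7 * x) powr t \<le> 2 powr (c * x) \<and> 14 * x \<le> 2 powr x \<and> (0::real) < x"
      using t(1) c by (intro eventually_conj) real_asymp+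
    from eventually_compose_filterlim[OF this flim]
    have "\<forall>\<^sub>F n in sequentially. (7 * real (f n)) powr t \<le> 2 powr (c * real (f n)) \<and>
        14 * real (f n) \<le> 2 powr real (f n) \<and> 0 < real (f n)" .
    then show "\<forall>\<^sub>F n in sequentially. 0 < 7 * f n \<and> 2 * (7 * f n) \<le> R n \<and>
        real (7 * f n * B n) powr t \<le> real (R n) \<and>
        (\<forall>j j'. j < j' \<and> j' + 7 * f n \<le> R n \<longrightarrow>
          7 * f n \<le> 8 * card {l \<in> {..<7 * f n}. w n (j + l) \<noteq> w n (j' + l)})"
      using fge
    proof eventually_elim
      case (elim n)
      have Rn: "real (R n) = 2 powr real (f n)" by (simp add: R_def pow2 flip: powr_realpow)
      have "real (2 * (7 * f n)) \<le> real (R n)" using elim unfolding Rn by simp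
      then have "2 * (7 * f n) \<le> R n" by linarith
      moreover have "real (7 * f n * B n) powr t = (7 * real (f n)) powr t * 2 powr (t * real (e n))"
        by (simp add: B_def pow2 powr_mult powr_powr mult.commute flip: powr_realpow)
      moreover have "(7 * real (f n)) powr t * 2 powr (t * real (e n)) \<le>
          2 powr (c * real (f n)) * 2 powr ((t / t') * real (f n))"
      proof (intro mult_mono)
        have "t * real (e n) = (t / t') * (t' * real (e n))" using t t' by simp
        also have "\<dots> \<le> (t / t') * real (f n)" using elim t t' by (intro mult_left_mono) auto
        finally show "2 powr (t * real (e n)) \<le> 2 powr ((t / t') * real (f n))"
          by (intro powr_mono) auto
      qed (use elim in auto)
      moreover have "2 powr (c * real (f n)) * 2 powr ((t / t') * real (f n)) = real (R n)"
        unfolding Rn powr_add[symmetric] by (simp add: c_def algebra_simps)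
      ultimately show ?case using elim w[of n] by (simp add: R_def)
    qed
  qed
  moreover have "invertible_measure_preserving torus_measure T"
    using T_iso by (simp add: invertible_measure_preserving_iff_iso)
  ultimately show ?thesis using ergodic_T rigid_T by blast
qed

theorem theorem1p2:
  fixes u :: ereal and X :: "(real \<times> real) set"
  assumes "0 \<le> u"
    and "X \<in> {torus, disc, annulus}"
  shows "\<exists>T. invertible_measure_preserving (normalized_lebesgue X) T \<and>
             ergodic (normalized_lebesgue X) T \<and>
             rigid (normalized_lebesgue X) T \<and>
             upper_slow_entropy polynomial_scale (normalized_lebesgue X) T = u"
proof -
  obtain T where T: "invertible_measure_preserving torus_measure T" "ergodic torus_measure T"
    "rigid torus_measure T" "upper_slow_entropy polynomial_scale torus_measure T = u"
    using ex_torus_example[OF assms(1)] by blast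
  consider "X = torus" | "X = disc" | "X = annulus"
    using assms(2) by blast
  then show ?thesis
  proof cases
    case 1
    then show ?thesis using T by blast
  next
    case 2
    obtain h where "measure_iso torus_measure (normalized_lebesgue disc) h"
      using measure_iso_torus_disc by blast
    from slow_entropy_example_transport[OF this T] show ?thesis unfolding 2 .
  next
    case 3
    obtain h where "measure_iso torus_measure (normalized_lebesgue annulus) h"
      using measure_iso_torus_annulus by blast
    from slow_entropy_example_transport[OF this T] show ?thesis unfolding 3 .
  qed
qed

end
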